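(* There exist $\chi_{0,1},\chi_{1,2},\chi_{2,3}\in H^1(\mathbf{Q},\mathbf{Z}/8)$ such that the triple Massey product $\langle\chi_{0,1},\chi_{1,2},\chi_{2,3}\rangle\subseteq H^2(\mathbf{Q},\mathbf{Z}/8)$ is defined (non-empty) but does not contain $0$.
   Context: Coefficients $\mathbf{Z}/8$ carry the trivial Galois action, and cup products use ring multiplication $\mathbf{Z}/8\otimes\mathbf{Z}/8\to\mathbf{Z}/8$ on continuous cochains of $\Gamma_{\mathbf{Q}}$. A defining system for $\chi_{0,1},\chi_{1,2},\chi_{2,3}$ is a collection of continuous $1$-cochains $a_{i,j}$, $0\le i<j\le 3$, $(i,j)\ne(0,3)$, with values in $\mathbf{Z}/8$, such that $\partial a_{i,j}=-\sum_{m=i+1}^{j-1}a_{i,m}\cup a_{m,j}$ and $[a_{i,i+1}]=\chi_{i,i+1}$; its value is the class of $-\sum_{m=1}^{2}a_{0,m}\cup a_{m,3}$ in $H^2(\mathbf{Q},\mathbf{Z}/8)$, and the triple Massey product is the set of all such values. *)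

theory Defs
  imports
    "HOL-Analysis.Analysis"
    "HOL-Library.Numeral_Type"
    "HOL-Algebra.Coset"
    "HOL-Algebra.Algebraic_Closure_Type"
begin

section \<open>The absolute Galois group of the rationals\<close>

typedef gal_Q = "{\<sigma> :: rat alg_closure \<Rightarrow> rat alg_closure.
    bij \<sigma> \<and> (\<forall>x y. \<sigma> (x + y) = \<sigma> x + \<sigma> y) \<and> (\<forall>x y. \<sigma> (x * y) = \<sigma> x * \<sigma> y) \<and>
    (\<forall>q. \<sigma> (to_ac q) = to_ac q)}"
  morphisms act Gal
  by (intro exI[of _ id]) auto

setup_lifting type_definition_gal_Q

instantiation gal_Q :: monoid_mult
begin

lift_definition one_gal_Q :: gal_Q is id
  by auto

lift_definition times_gal_Q :: "gal_Q \<Rightarrow> gal_Q \<Rightarrow> gal_Q" is "(\<circ>)"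
  by (auto intro: bij_comp)

instance
  by standard (transfer; simp add: comp_assoc)+

end

lemma gal_Q_has_inverse:
  fixes \<sigma> :: gal_Q
  shows "\<exists>\<tau>. \<tau> * \<sigma> = 1 \<and> \<sigma> * \<tau> = 1"
proof -
  define f where "f = act \<sigma>"
  have f: "bij f" "f (x + y) = f x + f y" "f (x * y) = f x * f y" "f (to_ac q) = to_ac q" for x y q
    using act[of \<sigma>] by (auto simp: f_def)
  define g where "g = the_inv f"
  have gf: "g (f x) = x" and fg: "f (g x) = x" for x
    using f(1) by (simp_all add: g_def bij_is_inj the_inv_f_f f_the_inv_into_f_bij_betw)
  have "bij g"
    by (rule bij_betw_byWitness[where f' = f]) (auto simp: gf fg)
  moreover have "g (x + y) = g x + g y" "g (x * y) = g x * g y" "g (to_ac q) = to_ac q" for x y q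
    using f(2,3)[of "g x" "g y"] f(4)[of q] by (metis gf fg)+
  ultimately have "act (Gal g) = g"
    by (intro Gal_inverse) auto
  hence "Gal g * \<sigma> = 1 \<and> \<sigma> * Gal g = 1"
    by (simp flip: act_inject add: times_gal_Q.rep_eq one_gal_Q.rep_eq fun_eq_iff gf fg
        flip: f_def)
  thus ?thesis by blast
qed

text \<open>Finite degree over the rationals: a subspace of a finitely spanned space is finite-dimensional.\<close>

definition finite_subextension :: "rat alg_closure set \<Rightarrow> bool" where
  "finite_subextension E \<longleftrightarrow>
     range to_ac \<subseteq> E \<and>
     (\<forall>x\<in>E. \<forall>y\<in>E. x - y \<in> E \<and> x * y \<in> E) \<and> (\<forall>x\<in>E. inverse x \<in> E) \<and>
     (\<exists>B. finite B \<and> E \<subseteq> module.span (\<lambda>q x. to_ac q * x) B)"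

definition fixing_subgroup :: "rat alg_closure set \<Rightarrow> gal_Q set" where
  "fixing_subgroup E = {\<sigma>. \<forall>x\<in>E. act \<sigma> x = x}"

text \<open>The Krull topology.\<close>

instantiation gal_Q :: topological_space
begin

definition open_gal_Q :: "gal_Q set \<Rightarrow> bool" where
  "open_gal_Q = generate_topology
     {(\<lambda>\<tau>. \<sigma> * \<tau>) ` fixing_subgroup E | \<sigma> E. finite_subextension E}"

instance
  by standard (auto simp: open_gal_Q_def intro: generate_topology.intros)

end


section \<open>Continuous cohomology in low degrees, with trivial coefficients\<close>

text \<open>
  The type \<open>'g\<close> is a topological group (only its multiplication occurs in the formulas), and the
  coefficient ring \<open>'r\<close> is discrete, with trivial action of \<open>'g\<close>.  An inhomogeneous 1-cochain is a
  continuous function on \<open>'g\<close>, a 2-cochain one on \<open>'g \<times> 'g\<close>, and a 0-cochain is an element of \<open>'r\<close>.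
\<close>

definition cochains :: "('x::topological_space \<Rightarrow> 'r) set" where
  "cochains = {f. continuous_map euclidean (discrete_topology UNIV) f}"

text \<open>The general formula in degree 0 is \<open>g \<mapsto> g \<cdot> c - c\<close>, which vanishes for the trivial action.\<close>

definition d0 :: "'r::comm_ring_1 \<Rightarrow> 'g::monoid_mult \<Rightarrow> 'r" where
  "d0 c = (\<lambda>g. c - c)"

definition d1 :: "('g::monoid_mult \<Rightarrow> 'r::comm_ring_1) \<Rightarrow> 'g \<times> 'g \<Rightarrow> 'r" where
  "d1 f = (\<lambda>(g, h). f h - f (g * h) + f g)"

definition d2 :: "('g::monoid_mult \<times> 'g \<Rightarrow> 'r::comm_ring_1) \<Rightarrow> 'g \<times> 'g \<times> 'g \<Rightarrow> 'r" where
  "d2 f = (\<lambda>(g, h, k). f (h, k) - f (g * h, k) + f (g, h * k) - f (g, h))"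

definition cup :: "('g \<Rightarrow> 'r::comm_ring_1) \<Rightarrow> ('g \<Rightarrow> 'r) \<Rightarrow> 'g \<times> 'g \<Rightarrow> 'r"  (infixl \<open>\<smile>\<close> 70) where
  "a \<smile> b = (\<lambda>(g, h). a g * b h)"

text \<open>Groups in \<^theory>\<open>HOL-Algebra.Coset\<close> are multiplicative, so the operation of the
  group below is pointwise addition, and the element \<open>\<one>\<close> of a cohomology group is its zero class.\<close>

definition pointwise_add_group :: "('x \<Rightarrow> 'r::comm_ring_1) set \<Rightarrow> ('x \<Rightarrow> 'r) monoid" where
  "pointwise_add_group S = \<lparr>carrier = S, mult = (\<lambda>f g x. f x + g x), one = (\<lambda>_. 0)\<rparr>"

definition cocycles1 :: "('g::{monoid_mult,topological_space} \<Rightarrow> 'r::comm_ring_1) monoid" where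
  "cocycles1 = pointwise_add_group {f \<in> cochains. d1 f = (\<lambda>_. 0)}"

definition coboundaries1 :: "('g::{monoid_mult,topological_space} \<Rightarrow> 'r::comm_ring_1) set" where
  "coboundaries1 = range d0"

definition cocycles2 :: "('g::{monoid_mult,topological_space} \<times> 'g \<Rightarrow> 'r::comm_ring_1) monoid" where
  "cocycles2 = pointwise_add_group {f \<in> cochains. d2 f = (\<lambda>_. 0)}"

definition coboundaries2 :: "('g::{monoid_mult,topological_space} \<times> 'g \<Rightarrow> 'r::comm_ring_1) set" where
  "coboundaries2 = d1 ` cochains"

definition H1 :: "('g::{monoid_mult,topological_space} \<Rightarrow> 'r::comm_ring_1) set monoid" where
  "H1 = cocycles1 Mod coboundaries1"

definition H2 :: "('g::{monoid_mult,topological_space} \<times> 'g \<Rightarrow> 'r::comm_ring_1) set monoid" where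
  "H2 = cocycles2 Mod coboundaries2"

definition class1 ::
    "('g::{monoid_mult,topological_space} \<Rightarrow> 'r::comm_ring_1) \<Rightarrow> ('g \<Rightarrow> 'r) set" where
  "class1 f = coboundaries1 #>\<^bsub>cocycles1\<^esub> f"

definition class2 ::
    "('g::{monoid_mult,topological_space} \<times> 'g \<Rightarrow> 'r::comm_ring_1) \<Rightarrow> ('g \<times> 'g \<Rightarrow> 'r) set" where
  "class2 f = coboundaries2 #>\<^bsub>cocycles2\<^esub> f"


text \<open>The type \<open>8\<close> of \<^theory>\<open>HOL-Library.Numeral_Type\<close> is the ring of integers modulo 8.\<close>

type_synonym Z8 = 8


section \<open>Triple Massey products\<close>

text \<open>Only the values \<open>a i j\<close> with \<open>i < j \<le> 3\<close> and \<open>(i, j) \<noteq> (0, 3)\<close> are constrained or used.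
  For \<open>j = i + 1\<close> the sum is empty, so \<open>a i j\<close> is a cocycle and its class makes sense.\<close>

definition defining_system ::
    "('g::{monoid_mult,topological_space} \<Rightarrow> 'r::comm_ring_1) set \<Rightarrow> ('g \<Rightarrow> 'r) set \<Rightarrow>
     ('g \<Rightarrow> 'r) set \<Rightarrow> (nat \<Rightarrow> nat \<Rightarrow> 'g \<Rightarrow> 'r) \<Rightarrow> bool" where
  "defining_system \<chi>01 \<chi>12 \<chi>23 a \<longleftrightarrow>
     (\<forall>i j. i < j \<and> j \<le> 3 \<and> (i, j) \<noteq> (0, 3) \<longrightarrow>
        a i j \<in> cochains \<and> d1 (a i j) = (\<lambda>x. - (\<Sum>m\<in>{i<..<j}. (a i m \<smile> a m j) x))) \<and>
     class1 (a 0 1) = \<chi>01 \<and> class1 (a 1 2) = \<chi>12 \<and> class1 (a 2 3) = \<chi>23"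

definition massey_cocycle ::
    "(nat \<Rightarrow> nat \<Rightarrow> 'g \<Rightarrow> 'r::comm_ring_1) \<Rightarrow> 'g \<times> 'g \<Rightarrow> 'r" where
  "massey_cocycle a = (\<lambda>x. - (\<Sum>m\<in>{1..2}. (a 0 m \<smile> a m 3) x))"

definition triple_massey ::
    "('g::{monoid_mult,topological_space} \<Rightarrow> 'r::comm_ring_1) set \<Rightarrow> ('g \<Rightarrow> 'r) set \<Rightarrow>
     ('g \<Rightarrow> 'r) set \<Rightarrow> ('g \<times> 'g \<Rightarrow> 'r) set set" where
  "triple_massey \<chi>01 \<chi>12 \<chi>23 = {class2 (massey_cocycle a) | a. defining_system \<chi>01 \<chi>12 \<chi>23 a}"

lemma continuous_map_discrete_binop:
  fixes c :: "'a \<Rightarrow> 'b \<Rightarrow> 'c"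
  assumes "continuous_map T (discrete_topology UNIV) f" "continuous_map T (discrete_topology UNIV) g"
  shows "continuous_map T (discrete_topology UNIV) (\<lambda>x. c (f x) (g x))"
proof -
  have "continuous_map T (discrete_topology UNIV) (\<lambda>x. (f x, g x))"
    using continuous_map_pairedI[OF assms] by (simp flip: prod_topology_discrete_topology)
  from continuous_map_compose[OF this, of "discrete_topology UNIV" "\<lambda>(u, v). c u v"]
  show ?thesis by (simp add: o_def)
qed

lemma cup_in_cochains:
  fixes a b :: "'g::topological_space \<Rightarrow> 'r::comm_ring_1"
  assumes "a \<in> cochains" "b \<in> cochains"
  shows "a \<smile> b \<in> cochains"
proof -
  have *: "continuous_map euclidean euclidean (fst :: 'g \<times> 'g \<Rightarrow> 'g)"
          "continuous_map euclidean euclidean (snd :: 'g \<times> 'g \<Rightarrow> 'g)"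
    by (auto intro!: continuous_intros)
  have "continuous_map euclidean (discrete_topology UNIV) a"
       "continuous_map euclidean (discrete_topology UNIV) b"
    using assms by (simp_all add: cochains_def)
  from *(1)[THEN continuous_map_compose, OF this(1)] *(2)[THEN continuous_map_compose, OF this(2)]
  have "continuous_map euclidean (discrete_topology UNIV) (\<lambda>x :: 'g \<times> 'g. a (fst x))"
       "continuous_map euclidean (discrete_topology UNIV) (\<lambda>x :: 'g \<times> 'g. b (snd x))"
    by (simp_all add: o_def)
  from continuous_map_discrete_binop[OF this, of "(*)"] show ?thesis
    by (simp add: cochains_def cup_def case_prod_unfold)
qed

text \<open>The value of a defining system is a 2-cocycle.\<close>

lemma triple_massey_subset_H2: "triple_massey \<chi>01 \<chi>12 \<chi>23 \<subseteq> carrier H2"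
proof
  fix v assume "v \<in> triple_massey \<chi>01 \<chi>12 \<chi>23"
  then obtain a where v: "v = class2 (massey_cocycle a)" and a: "defining_system \<chi>01 \<chi>12 \<chi>23 a"
    by (auto simp: triple_massey_def)
  have C: "a 0 1 \<in> cochains" "a 1 3 \<in> cochains" "a 0 2 \<in> cochains" "a 2 3 \<in> cochains"
    using a by (auto simp: defining_system_def)
  have I: "{0<..<Suc 0} = {}" "{2<..<3::nat} = {}" "{0<..<2::nat} = {1}" "{Suc 0<..<3} = {2}"
      "{Suc 0..2} = {1, 2}"
    by auto
  have D: "d1 (a 0 1) x = 0" "d1 (a 2 3) x = 0"
      "d1 (a 0 2) x = - (a 0 1 \<smile> a 1 2) x" "d1 (a 1 3) x = - (a 1 2 \<smile> a 2 3) x" for x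
    using a by (auto simp: defining_system_def I)
  have eq: "massey_cocycle a = (\<lambda>x. - ((a 0 1 \<smile> a 1 3) x + (a 0 2 \<smile> a 2 3) x))"
    by (simp add: massey_cocycle_def I)
  have "continuous_map euclidean (discrete_topology UNIV) (massey_cocycle a)"
    unfolding eq using cup_in_cochains C
    by (intro continuous_map_discrete_binop[of _ _ _ "\<lambda>u v. - (u + v)"]) (auto simp: cochains_def)
  moreover have "d2 (massey_cocycle a) (g, h, k) = 0" for g h k
  proof -
    have "a 0 1 (g * h) = a 0 1 g + a 0 1 h" "a 2 3 (h * k) = a 2 3 h + a 2 3 k"
      using D(1)[of "(g, h)"] D(2)[of "(h, k)"] by (auto simp: d1_def algebra_simps)
    moreover have "a 0 2 (g * h) = a 0 2 g + a 0 2 h + a 0 1 g * a 1 2 h"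
        "a 1 3 (h * k) = a 1 3 h + a 1 3 k + a 1 2 h * a 2 3 k"
      using D(3)[of "(g, h)"] D(4)[of "(h, k)"] by (auto simp: d1_def cup_def algebra_simps)
    ultimately show ?thesis
      by (simp add: d2_def eq cup_def algebra_simps)
  qed
  ultimately show "v \<in> carrier H2"
    by (auto simp: v H2_def carrier_FactGroup class2_def cocycles2_def pointwise_add_group_def
        cochains_def fun_eq_iff)
qed

end

theory Submission
  imports Defs
begin

text \<open>
  Let \<open>\<chi>\<close> be the character of order 8 of the real subfield of \<open>\<rat>(\<zeta>\<^sub>3\<^sub>2)\<close>, let \<open>r\<^sup>8 = (2 + i) / (2 - i)\<close>, and
  let \<open>k\<close> be the Kummer function with \<open>g r = \<zeta>\<^sub>8 ^ (\<plusminus> k g) r ^ (\<plusminus> 1)\<close>, the sign being that of \<open>g i = \<plusminus> i\<close>.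
  Then \<open>k (g h) = k g + k h + 4 \<chi> g k h\<close>, so the Massey product of \<open>2 \<chi>\<close>, \<open>\<chi>\<close>, \<open>4 k\<close> is defined: take
  \<open>a\<^sub>0\<^sub>2 = \<chi>\<^sup>2\<close> and \<open>a\<^sub>1\<^sub>3 = k\<close>.

  The obstruction to vanishing is local at 5, where \<open>\<chi>\<close> is inert and \<open>k\<close> is totally ramified modulo 4.
  By Zorn's lemma there is a subfield \<open>K\<close> of the algebraic numbers carrying a discrete valuation with
  uniformizer 5 and residue field of order 5 in which every principal unit is a square.  Its square
  classes are generated by \<open>i\<close> and 5, the quaternion algebra \<open>(i, 5)\<close> over it does not split, and both
  facts persist in the tower of the fields \<open>K(\<zeta>, \<pi>)\<close>, where \<open>\<zeta>\<close> and \<open>\<pi>\<close> are iterated square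
  roots of \<open>i\<close> and 5; so the union \<open>M\<close> of the tower is quadratically closed.  Hence the cochains of a
  defining system, which restrict to homomorphisms on the group fixing \<open>M\<close>, vanish there, and the
  automorphisms \<open>\<sigma>\<close>: \<open>\<zeta> \<mapsto> \<zeta>\<^sup>5\<close>, \<open>\<pi> \<mapsto> \<pi>\<close> and \<open>\<tau>\<close>: \<open>\<zeta> \<mapsto> \<zeta>\<close>, \<open>\<pi> \<mapsto> \<zeta>\<^sup>4 \<pi>\<close> may be treated as if \<open>\<sigma> \<tau> = \<tau>\<^sup>5 \<sigma>\<close>.
  A unipotent representation over \<open>\<int>/8\<close> with the given superdiagonal violates this relation.
\<close>

section \<open>Five-adic valuation rings\<close>

text \<open>Discrete valuation rings with uniformizer 5 and residue field of order 5.\<close>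

locale five_adic =
  fixes A :: "'a::field_char_0 set"
  assumes one_mem: "1 \<in> A"
    and diff_mem: "x \<in> A \<Longrightarrow> y \<in> A \<Longrightarrow> x - y \<in> A"
    and mult_mem: "x \<in> A \<Longrightarrow> y \<in> A \<Longrightarrow> x * y \<in> A"
    and inverse_5: "inverse 5 \<notin> A"
    and five_power_unit: "x \<in> A \<Longrightarrow> x \<noteq> 0 \<Longrightarrow> \<exists>n u. u \<in> A \<and> inverse u \<in> A \<and> x = 5 ^ n * u"
    and residue: "x \<in> A \<Longrightarrow> \<exists>k<5. (x - of_nat k) / 5 \<in> A"
begin

lemma zero_mem: "0 \<in> A"
  using diff_mem[OF one_mem one_mem] by simp

lemma uminus_mem: "x \<in> A \<Longrightarrow> - x \<in> A"
  using diff_mem[OF zero_mem] by fastforce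

lemma add_mem: "x \<in> A \<Longrightarrow> y \<in> A \<Longrightarrow> x + y \<in> A"
  using diff_mem[of x "- y"] uminus_mem by simp

lemma power_mem: "x \<in> A \<Longrightarrow> x ^ n \<in> A"
  by (induction n) (auto simp: one_mem mult_mem)

lemma of_nat_mem: "of_nat n \<in> A"
  by (induction n) (auto simp: zero_mem one_mem add_mem)

lemma of_int_mem: "of_int n \<in> A"
  by (cases n rule: int_cases2) (auto simp: of_nat_mem uminus_mem)

lemma numeral_mem: "numeral n \<in> A"
  using of_nat_mem[of "numeral n"] by simp

lemmas mems = zero_mem one_mem uminus_mem add_mem diff_mem mult_mem power_mem numeral_mem of_nat_mem of_int_mem

text \<open>A positive exponent in \<open>five_power_unit\<close> would make \<open>x / 5\<close>
  integral. So \<open>A\<close> is a local ring whose maximal ideal is generated by 5.\<close>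

lemma inverse_mem:
  assumes "x \<in> A" "x / 5 \<notin> A"
  shows "inverse x \<in> A"
proof -
  have "x \<noteq> 0" using assms zero_mem by auto
  then obtain n u where u: "u \<in> A" "inverse u \<in> A" "x = 5 ^ n * u"
    using five_power_unit assms by blast
  show ?thesis
  proof (cases n)
    case (Suc m)
    then have "x / 5 = 5 ^ m * u" using u by simp
    then have "x / 5 \<in> A" using mult_mem[OF power_mem[OF numeral_mem] u(1)] by simp
    then show ?thesis using assms by blast
  qed (use u in simp)
qed

text \<open>By Bezout, an integer \<open>k\<close> prime to 5 with \<open>k / 5\<close> in
  \<open>A\<close> would put \<open>inverse 5\<close> in \<open>A\<close>. This turns congruences
  modulo 5 in \<open>A\<close> into divisibility of integers.\<close>

lemma of_int_div_5: "of_int k / 5 \<in> A \<longleftrightarrow> 5 dvd k"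
proof
  assume *: "of_int k / 5 \<in> A"
  show "5 dvd k"
  proof (rule ccontr)
    assume "\<not> 5 dvd k"
    then have "coprime 5 k" by (intro prime_imp_coprime) auto
    then obtain a b where "a * k + b * 5 = 1"
      by (metis bezout_int coprime_commute coprime_imp_gcd_eq_1)
    then have "of_int (a * k + b * 5) = (1::'a)" by simp
    then have "inverse 5 = of_int a * (of_int k / 5) + (of_int b :: 'a)"
      by (simp add: field_simps)
    then show False using inverse_5 * by (metis add_mem mult_mem of_int_mem)
  qed
qed (auto simp: of_int_mem)

text \<open>The field of fractions of \<open>A\<close>: every nonzero element of \<open>A\<close> is
  a power of 5 times a unit, so inverting 5 suffices.\<close>

definition frac :: "'a set" where
  "frac = {x. \<exists>n. x * 5 ^ n \<in> A}"

lemma fracE: assumes "x \<in> frac" obtains n where "\<And>m. m \<ge> n \<Longrightarrow> x * 5 ^ m \<in> A"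
proof -
  obtain n where n: "x * 5 ^ n \<in> A" using assms by (auto simp: frac_def)
  have "x * 5 ^ m \<in> A" if "m \<ge> n" for m
  proof -
    have "x * 5 ^ m = (x * 5 ^ n) * 5 ^ (m - n)"
      using that by (simp only: mult.assoc power_add[symmetric] le_add_diff_inverse)
    then show ?thesis using n by (metis mult_mem power_mem numeral_mem)
  qed
  then show ?thesis using that by blast
qed

lemma subset_frac: "x \<in> A \<Longrightarrow> x \<in> frac"
  unfolding frac_def by (auto intro!: exI[of _ 0])

lemma frac_diff: assumes "x \<in> frac" "y \<in> frac" shows "x - y \<in> frac"
proof -
  obtain n where n: "\<And>m. m \<ge> n \<Longrightarrow> x * 5 ^ m \<in> A" using assms fracE by metis
  obtain k where k: "\<And>m. m \<ge> k \<Longrightarrow> y * 5 ^ m \<in> A" using assms fracE by metis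
  have "(x - y) * 5 ^ (n + k) \<in> A"
    using n[of "n + k"] k[of "n + k"] by (simp add: mems left_diff_distrib)
  then show ?thesis by (auto simp: frac_def)
qed

lemma frac_mult: assumes "x \<in> frac" "y \<in> frac" shows "x * y \<in> frac"
proof -
  obtain n where n: "x * 5 ^ n \<in> A" using assms by (auto simp: frac_def)
  obtain k where k: "y * 5 ^ k \<in> A" using assms by (auto simp: frac_def)
  have "(x * y) * 5 ^ (n + k) = (x * 5 ^ n) * (y * 5 ^ k)" by (simp add: power_add)
  then show ?thesis using n k mult_mem unfolding frac_def by (metis (mono_tags) mem_Collect_eq)
qed

lemma frac_unit:
  assumes "x \<in> frac" "x \<noteq> 0"
  obtains m n u where "u \<in> A" "inverse u \<in> A" "x = 5 ^ m * u / 5 ^ n"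
proof -
  obtain n where n: "x * 5 ^ n \<in> A" using assms by (auto simp: frac_def)
  then obtain m u where "u \<in> A" "inverse u \<in> A" "x * 5 ^ n = 5 ^ m * u"
    using five_power_unit[of "x * 5 ^ n"] assms by auto
  then show ?thesis using that[of u m n] by (auto simp: field_simps)
qed

lemma frac_inverse: assumes "x \<in> frac" shows "inverse x \<in> frac"
proof (cases "x = 0")
  case False
  then obtain m n u where u: "u \<in> A" "inverse u \<in> A" "x = 5 ^ m * u / 5 ^ n"
    using assms frac_unit by metis
  have "inverse x * 5 ^ m = inverse u * 5 ^ n" using u False by (auto simp: field_simps)
  then have "inverse x * 5 ^ m \<in> A" using u by (simp add: mems)
  then show ?thesis by (auto simp: frac_def)
qed (auto intro: subset_frac zero_mem)

lemma frac_divide: "x \<in> frac \<Longrightarrow> y \<in> frac \<Longrightarrow> x / y \<in> frac"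
  by (simp add: divide_inverse frac_mult frac_inverse)

lemma frac_uminus: "x \<in> frac \<Longrightarrow> - x \<in> frac"
  using frac_diff[of 0 x] subset_frac[OF zero_mem] by simp

lemma frac_add: "x \<in> frac \<Longrightarrow> y \<in> frac \<Longrightarrow> x + y \<in> frac"
  using frac_diff[of x "- y"] frac_uminus by simp

lemma frac_power: "x \<in> frac \<Longrightarrow> x ^ n \<in> frac"
  by (induction n) (auto intro: subset_frac one_mem frac_mult)

lemma frac_numeral: "numeral k \<in> frac" by (intro subset_frac numeral_mem)
lemma frac_of_nat: "of_nat k \<in> frac" by (intro subset_frac of_nat_mem)
lemma frac_0: "0 \<in> frac" by (intro subset_frac zero_mem)
lemma frac_1: "1 \<in> frac" by (intro subset_frac one_mem)

lemmas fracs = frac_0 frac_1 frac_diff frac_mult frac_divide frac_add frac_uminus frac_power frac_numeral frac_of_nat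

text \<open>If \<open>s\<close> had negative valuation, say \<open>s = u / 5 ^ Suc k\<close> with a
  unit \<open>u\<close>, then \<open>s\<^sup>2\<close> times a unit and an odd power of 5 would be
  \<open>inverse 5\<close>.\<close>

lemma integrally_closed_square:
  assumes "s \<in> frac" "s\<^sup>2 \<in> A" shows "s \<in> A"
proof (cases "s = 0")
  case False
  then obtain m n u where u: "u \<in> A" "inverse u \<in> A" "s = 5 ^ m * u / 5 ^ n"
    using assms frac_unit by metis
  show ?thesis
  proof (cases "m \<ge> n")
    case True
    then have "s = 5 ^ (m - n) * u" using u by (simp add: power_diff)
    then show ?thesis using u by (simp add: mems)
  next
    case False
    then obtain k where k: "n = m + Suc k" using less_imp_Suc_add not_le by (metis add_Suc_right)
    have "u \<noteq> 0" using u \<open>s \<noteq> 0\<close> by auto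
    have "inverse 5 = s\<^sup>2 * (inverse u)\<^sup>2 * 5 ^ (2 * k + 1)"
      using \<open>u \<noteq> 0\<close> by (simp add: u k power_add power2_eq_square field_simps mult_2_right)
    then show ?thesis using inverse_5 assms u by (metis mult_mem power_mem numeral_mem)
  qed
qed (simp add: zero_mem)

text \<open>The sequence \<open>5 ^ N * q N\<close> tends to 0 in the 5-adic topology, and scaling
  by a fixed fraction does not change this.\<close>

lemma eventually_small:
  assumes "y \<in> frac" "\<And>N. q N \<in> A"
  shows "\<forall>\<^sub>F N in sequentially. y * (5 ^ N * q N) / 5 ^ j \<in> A"
proof -
  obtain n where n: "\<And>m. m \<ge> n \<Longrightarrow> y * 5 ^ m \<in> A" using assms fracE by metis
  show ?thesis
  proof (rule eventually_sequentiallyI[of "n + j"])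
    fix N assume "N \<ge> n + j"
    then have "y * (5 ^ N * q N) / 5 ^ j = (y * 5 ^ (N - j)) * q N" by (simp add: power_diff)
    then show "y * (5 ^ N * q N) / 5 ^ j \<in> A" using n[of "N - j"] assms \<open>N \<ge> n + j\<close> mult_mem by auto
  qed
qed

text \<open>In the completion of \<open>A\<close> the number \<open>1 + 5 * e\<close> has a square
  root. Sending \<open>s\<close> to it embeds the field generated by \<open>s\<close> over
  \<open>frac\<close>, and \<open>B\<close> is the preimage of the completed ring, described through
  approximations instead of the completion.\<close>

lemma adjoin_square_root:
  assumes e: "e \<in> A" and s: "s\<^sup>2 = 1 + 5 * e" "s \<notin> frac"
  shows "\<exists>B. five_adic B \<and> A \<subseteq> B \<and> s \<in> B"
proof -
  define d where "d = 1 + 5 * e"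
  have d: "d \<in> A" using e by (simp add: d_def mems)
  \<comment> \<open>5-adic approximations of \<open>s\<close>: Newton's step with \<open>-2\<close> for \<open>1 / (2 x)\<close>, as \<open>x\<close> is 1 modulo 5.
     Integrality of \<open>x + y s\<close> is tested on \<open>x + y r N\<close> for large \<open>N\<close>.\<close>
  define r where "r = rec_nat 1 (\<lambda>N x. x + 2 * (x\<^sup>2 - d))"
  have r0: "r 0 = 1" and rS: "r (Suc N) = r N + 2 * ((r N)\<^sup>2 - d)" for N
    by (simp_all add: r_def)
  have inv: "r N \<in> A \<and> (\<exists>c\<in>A. r N = 1 + 5 * c) \<and> (\<exists>c\<in>A. (r N)\<^sup>2 - d = 5 ^ N * (5 * c))" for N
  proof (induction N)
    case 0
    show ?case using e
      by (auto simp: r0 mems d_def intro!: bexI[of _ 0] bexI[of _ "- e"])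
  next
    case (Suc N)
    then obtain b c where b: "b \<in> A" "r N = 1 + 5 * b"
      and c: "c \<in> A" "(r N)\<^sup>2 - d = 5 ^ N * (5 * c)" and rN: "r N \<in> A" by blast
    have 1: "r (Suc N) = r N + 2 * (5 ^ N * (5 * c))" by (simp add: rS c)
    have 2: "r (Suc N) = 1 + 5 * (b + 2 * 5 ^ N * c)" by (simp add: 1 b algebra_simps)
    \<comment> \<open>As \<open>r N\<close> is 1 modulo 5, the factor \<open>1 + 4 * r N\<close> is
      divisible by 5. This gains one power of 5 in the linear term, and the quadratic term already
      has it.\<close>
    have "(r (Suc N))\<^sup>2 - d = ((r N)\<^sup>2 - d) * (1 + 4 * r N) + 4 * ((r N)\<^sup>2 - d)\<^sup>2"
      by (simp add: rS power2_eq_square algebra_simps)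
    also have "\<dots> = (5 ^ N * (5 * c)) * (1 + 4 * (1 + 5 * b)) + 4 * (5 ^ N * (5 * c))\<^sup>2"
      by (simp only: c(2) b(2)[symmetric])
    also have "\<dots> = 5 ^ Suc N * (5 * (c * (1 + 4 * b) + 4 * 5 ^ N * c\<^sup>2))"
      by (simp add: power2_eq_square algebra_simps)
    finally have 3: "(r (Suc N))\<^sup>2 - d = 5 ^ Suc N * (5 * (c * (1 + 4 * b) + 4 * 5 ^ N * c\<^sup>2))" .
    have "c * (1 + 4 * b) + 4 * 5 ^ N * c\<^sup>2 \<in> A" "b + 2 * 5 ^ N * c \<in> A" "r (Suc N) \<in> A"
      using b c rN by (auto simp: 1 mems)
    then show ?case using 2 3 by blast
  qed
  have "\<exists>c. c \<in> A \<and> (r N)\<^sup>2 - d = 5 ^ N * c" for N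
    using inv[of N] by (metis mult_mem numeral_mem)
  then obtain q where qA: "\<And>N. q N \<in> A" and q: "\<And>N. (r N)\<^sup>2 - d = 5 ^ N * q N" by metis
  have rA: "r N \<in> A" for N using inv by blast
  have small: "\<forall>\<^sub>F N in sequentially. a * ((r N)\<^sup>2 - d) / 5 ^ j \<in> A" if "a \<in> frac" for a j
    using eventually_small[OF that qA] by (simp add: q)
  have cauchy: "\<forall>\<^sub>F N in sequentially. y * (r (Suc N) - r N) / 5 ^ j \<in> A" if "y \<in> frac" for y j
    using eventually_small[of y "\<lambda>N. 2 * q N" j] that qA by (simp add: rS q mems mult.left_commute)
  define B where "B = {z. \<exists>x\<in>frac. \<exists>y\<in>frac. z = x + y * s \<and> (\<forall>\<^sub>F N in sequentially. x + y * r N \<in> A)}"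
  have uniq: "x = x' \<and> y = y'" if "x + y * s = x' + y' * s" "x \<in> frac" "y \<in> frac" "x' \<in> frac" "y' \<in> frac" for x y x' y'
  proof (cases "y = y'")
    case False
    then have "s = (x' - x) / (y - y')" using that by (simp add: field_simps)
    then show ?thesis using that s by (auto simp: fracs)
  qed (use that in auto)
  have memB: "x + y * s \<in> B \<longleftrightarrow> (\<forall>\<^sub>F N in sequentially. x + y * r N \<in> A)" if "x \<in> frac" "y \<in> frac" for x y
    using uniq that unfolding B_def by blast
  have BE: "\<exists>x\<in>frac. \<exists>y\<in>frac. z = x + y * s \<and> (\<forall>\<^sub>F N in sequentially. x + y * r N \<in> A)" if "z \<in> B" for z
    using that unfolding B_def by blast
  have nrm: "x\<^sup>2 - d * y\<^sup>2 \<noteq> 0" if "x \<in> frac" "y \<in> frac" "x + y * s \<noteq> 0" for x y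
  proof
    assume *: "x\<^sup>2 - d * y\<^sup>2 = 0"
    have "y \<noteq> 0" using * that by auto
    then have "(x / y)\<^sup>2 = s\<^sup>2" using * s by (simp add: d_def field_simps)
    then have "s = x / y \<or> s = - (x / y)" by (metis power2_eq_iff)
    then show False using that s by (auto simp: fracs)
  qed
  have inv_eq: "inverse (x + y * s) = x / (x\<^sup>2 - d * y\<^sup>2) + (- y / (x\<^sup>2 - d * y\<^sup>2)) * s"
    if "x \<in> frac" "y \<in> frac" "x + y * s \<noteq> 0" for x y
  proof -
    have "(x + y * s) * (x / (x\<^sup>2 - d * y\<^sup>2) + (- y / (x\<^sup>2 - d * y\<^sup>2)) * s)
        = (x\<^sup>2 - s\<^sup>2 * y\<^sup>2) / (x\<^sup>2 - d * y\<^sup>2)"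
      using nrm[OF that] by (simp add: divide_simps) (simp add: power2_eq_square algebra_simps)
    also have "\<dots> = 1" using nrm[OF that] s(1) by (simp add: d_def)
    finally show ?thesis by (simp add: inverse_unique)
  qed
  \<comment> \<open>The inverse of \<open>x + y * s\<close>, with \<open>s\<close> replaced by an
    approximation \<open>t\<close>, inverts \<open>x + y * t\<close> up to a multiple of
    \<open>t\<^sup>2 - d\<close>, which is small.\<close>
  have unitid: "(x / n + (- y / n) * t) * (x + y * t) = 1 - y\<^sup>2 / n * (t\<^sup>2 - d)"
    if "n = x\<^sup>2 - d * y\<^sup>2" "n \<noteq> 0" for x y n t
  proof -
    have "(x / n + (- y / n) * t) * (x + y * t) = (x\<^sup>2 - y\<^sup>2 * t\<^sup>2) / n"
      using that(2) by (simp add: divide_simps) (simp add: power2_eq_square algebra_simps)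
    also have "x\<^sup>2 - y\<^sup>2 * t\<^sup>2 = n - y\<^sup>2 * (t\<^sup>2 - d)"
      by (simp add: that(1) algebra_simps)
    also have "(n - y\<^sup>2 * (t\<^sup>2 - d)) / n = 1 - y\<^sup>2 / n * (t\<^sup>2 - d)"
      using that(2) by (simp only: diff_divide_distrib) simp
    finally show ?thesis .
  qed
  have uB: "inverse z \<in> B" if z: "z \<in> B" "z / 5 \<notin> B" for z
  proof -
    obtain x y where xy: "x \<in> frac" "y \<in> frac" "z = x + y * s" and ev: "\<forall>\<^sub>F N in sequentially. x + y * r N \<in> A"
      using BE[OF z(1)] by blast
    define n where "n = x\<^sup>2 - d * y\<^sup>2"
    have z5: "z / 5 = x / 5 + (y / 5) * s" using xy by (simp add: field_simps)
    have "z \<noteq> 0"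
    proof
      assume "z = 0"
      then have "z / 5 = 0 + 0 * s" by simp
      then show False using z(2) memB[of 0 0] by (simp add: fracs zero_mem)
    qed
    then have n0: "n \<noteq> 0" using nrm[OF xy(1,2)] xy(3) by (simp add: n_def)
    have nK: "n \<in> frac" using xy d by (simp add: n_def fracs subset_frac)
    have "\<not> (\<forall>\<^sub>F N in sequentially. x / 5 + y / 5 * r N \<in> A)"
      using z(2) memB[OF frac_divide[OF xy(1) frac_numeral] frac_divide[OF xy(2) frac_numeral]] unfolding z5 by blast
    moreover have "x / 5 + y / 5 * r N = (x + y * r N) / 5" for N by (simp add: field_simps)
    ultimately have nev: "\<not> (\<forall>\<^sub>F N in sequentially. (x + y * r N) / 5 \<in> A)" by (simp add: add_divide_distrib)
    from eventually_conj[OF ev cauchy[OF xy(2), of 1]]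
    obtain N0 where N0: "\<And>N. N \<ge> N0 \<Longrightarrow> x + y * r N \<in> A \<and> y * (r (Suc N) - r N) / 5 \<in> A"
      by (auto simp: eventually_sequentially)
    \<comment> \<open>Beyond \<open>N0\<close> the values \<open>x + y * r N\<close> agree modulo 5,
      so a single one divisible by 5 would make all later ones divisible.\<close>
    have notP: "(x + y * r N) / 5 \<notin> A" if "N \<ge> N0" for N
    proof
      assume *: "(x + y * r N) / 5 \<in> A"
      have "(x + y * r M) / 5 \<in> A" if "M \<ge> N" for M
        using that
      proof (induction M rule: dec_induct)
        case (step M)
        have "(x + y * r (Suc M)) / 5 = (x + y * r M) / 5 + y * (r (Suc M) - r M) / 5"
          by (simp add: field_simps)
        have "y * (r (Suc M) - r M) / 5 \<in> A" using step N0[of M] \<open>N \<ge> N0\<close> by simp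
        with \<open>(x + y * r M) / 5 \<in> A\<close> show ?case unfolding \<open>(x + y * r (Suc M)) / 5 = _\<close> by (rule add_mem)
      qed (rule *)
      then show False using nev by (auto simp: eventually_sequentially)
    qed
    have "\<forall>\<^sub>F N in sequentially. y\<^sup>2 / n * ((r N)\<^sup>2 - d) \<in> A"
      using small[of "y\<^sup>2 / n" 0] xy nK by (simp add: fracs)
    then have "\<forall>\<^sub>F N in sequentially. x / n + (- y / n) * r N \<in> A"
      using eventually_ge_at_top[of N0]
    proof eventually_elim
      case (elim N)
      have a: "inverse (x + y * r N) \<in> A" using N0 notP elim inverse_mem by blast
      have "x + y * r N \<noteq> 0" using notP[OF elim(2)] zero_mem by auto
      then have "x / n + (- y / n) * r N = (1 - y\<^sup>2 / n * ((r N)\<^sup>2 - d)) * inverse (x + y * r N)"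
        using unitid[OF n_def n0, of "r N"] by (simp add: field_simps)
      then show ?case using a elim mult_mem diff_mem one_mem by metis
    qed
    then have "x / n + (- y / n) * s \<in> B" using memB[of "x / n" "- y / n"] xy nK by (simp add: fracs)
    then show ?thesis using inv_eq[of x y] xy \<open>z \<noteq> 0\<close> by (simp add: n_def)
  qed
  \<comment> \<open>The factor \<open>5 ^ (k + l)\<close> makes the coordinates of
    \<open>inverse z\<close> integral. If \<open>z\<close> were divisible by one more power of 5,
    the product of the two would put \<open>inverse 5\<close> in \<open>A\<close>, up to a small
    error.\<close>
  have five_power: "\<exists>n. z / 5 ^ n \<notin> B" if "z \<in> B" "z \<noteq> 0" for z
  proof (rule ccontr)
    assume "\<nexists>n. z / 5 ^ n \<notin> B"
    then have all: "z / 5 ^ n \<in> B" for n by blast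
    obtain x y where xy: "x \<in> frac" "y \<in> frac" "z = x + y * s" using BE[OF \<open>z \<in> B\<close>] by blast
    define n where "n = x\<^sup>2 - d * y\<^sup>2"
    have n0: "n \<noteq> 0" using nrm[OF xy(1,2)] xy(3) \<open>z \<noteq> 0\<close> by (simp add: n_def)
    have nK: "n \<in> frac" using xy d by (simp add: n_def fracs subset_frac)
    obtain k where k: "\<And>m. m \<ge> k \<Longrightarrow> x / n * 5 ^ m \<in> A" using fracE xy nK frac_divide by metis
    obtain l where l: "\<And>m. m \<ge> l \<Longrightarrow> - y / n * 5 ^ m \<in> A" using fracE xy nK frac_divide frac_uminus by metis
    have "z / 5 ^ Suc (k + l) = x / 5 ^ Suc (k + l) + y / 5 ^ Suc (k + l) * s"
      using xy by (simp add: field_simps)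
    then have "\<forall>\<^sub>F N in sequentially. x / 5 ^ Suc (k + l) + y / 5 ^ Suc (k + l) * r N \<in> A"
      using all memB[of "x / 5 ^ Suc (k + l)" "y / 5 ^ Suc (k + l)"] xy by (metis frac_divide frac_power frac_numeral)
    moreover have "\<forall>\<^sub>F N in sequentially. y\<^sup>2 / n * ((r N)\<^sup>2 - d) / 5 \<in> A"
      using small[of "y\<^sup>2 / n" 1] xy nK by (simp add: fracs)
    ultimately have "\<forall>\<^sub>F N in sequentially. False"
    proof eventually_elim
      case (elim N)
      have "(x / n + (- y / n) * r N) * 5 ^ (k + l) = x / n * 5 ^ (k + l) + (- y / n * 5 ^ (k + l)) * r N"
        by (simp add: algebra_simps)
      then have a: "(x / n + (- y / n) * r N) * 5 ^ (k + l) \<in> A"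
        using k[of "k + l"] l[of "k + l"] rA by (metis add_mem mult_mem le_add1 le_add2)
      have "inverse 5 = ((x / n + (- y / n) * r N) * 5 ^ (k + l)) * ((x / 5 ^ Suc (k + l) + y / 5 ^ Suc (k + l) * r N))
           + y\<^sup>2 / n * ((r N)\<^sup>2 - d) / 5"
      proof -
        have "(x / n + (- y / n) * r N) * (x + y * r N) / 5 + y\<^sup>2 / n * ((r N)\<^sup>2 - d) / 5 = inverse 5"
          unfolding unitid[OF n_def n0, of "r N"] by (simp only: add_divide_distrib[symmetric] diff_add_cancel inverse_eq_divide)
        moreover have "x / 5 ^ Suc (k + l) + y / 5 ^ Suc (k + l) * r N = (x + y * r N) / (5 * 5 ^ (k + l))"
          by (simp add: field_simps)
        ultimately show ?thesis by simp
      qed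
      then show ?case using a elim inverse_5 by (metis add_mem mult_mem)
    qed
    then show False by simp
  qed
  have "five_adic B"
  proof
    show "1 \<in> B" using memB[of 1 0] by (simp add: fracs one_mem)
  next
    fix z w assume "z \<in> B" "w \<in> B"
    then obtain x y x' y' where xy: "x \<in> frac" "y \<in> frac" "z = x + y * s" and ev: "\<forall>\<^sub>F N in sequentially. x + y * r N \<in> A"
      and xy': "x' \<in> frac" "y' \<in> frac" "w = x' + y' * s" and ev': "\<forall>\<^sub>F N in sequentially. x' + y' * r N \<in> A"
      using BE by meson
    have "\<forall>\<^sub>F N in sequentially. (x - x') + (y - y') * r N \<in> A"
      using ev ev'
    proof eventually_elim
      case (elim N)
      then show ?case using diff_mem[OF elim] by (simp add: algebra_simps)
    qed
    then show "z - w \<in> B" using memB[of "x - x'" "y - y'"] xy xy' by (simp add: fracs algebra_simps)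
    have "\<forall>\<^sub>F N in sequentially. - (y * y') * ((r N)\<^sup>2 - d) / 5 ^ 0 \<in> A"
      using small[of "- (y * y')" 0] xy xy' by (simp add: fracs)
    then have "\<forall>\<^sub>F N in sequentially. (x * x' + d * (y * y')) + (x * y' + x' * y) * r N \<in> A"
      using ev ev'
    proof eventually_elim
      case (elim N)
      have "(x * x' + d * (y * y')) + (x * y' + x' * y) * r N = (x + y * r N) * (x' + y' * r N) + (- (y * y') * ((r N)\<^sup>2 - d) / 5 ^ 0)"
        by (simp add: power2_eq_square algebra_simps)
      then show ?case using add_mem[OF mult_mem[OF elim(2,3)] elim(1)] by simp
    qed
    moreover have "z * w = (x * x' + d * (y * y')) + (x * y' + x' * y) * s"
    proof -
      have "z * w = x * x' + s\<^sup>2 * (y * y') + (x * y' + x' * y) * s"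
        by (simp add: xy xy' algebra_simps power2_eq_square)
      then show ?thesis by (simp add: s d_def)
    qed
    ultimately show "z * w \<in> B" using memB[of "x * x' + d * (y * y')" "x * y' + x' * y"] xy xy' d by (simp add: fracs subset_frac)
  next
    have "(inverse 5 :: 'a) = inverse 5 + 0 * s" by simp
    moreover have "inverse 5 + 0 * s \<notin> B"
      using memB[of "inverse 5" 0] inverse_5 by (simp add: fracs frac_inverse)
    ultimately show "inverse 5 \<notin> B" by metis
  next
    fix z assume z: "z \<in> B" "z \<noteq> 0"
    \<comment> \<open>Dividing by 5 as often as \<open>B\<close> permits leaves an element that is a
      unit by \<open>uB\<close>.\<close>
    define n where "n = (LEAST n. z / 5 ^ n \<notin> B)"
    have n: "z / 5 ^ n \<notin> B" unfolding n_def using five_power[OF z] by (rule LeastI_ex)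
    then obtain m where m: "n = Suc m" using z by (cases n) auto
    have "z / 5 ^ m \<in> B" using not_less_Least[of m "\<lambda>n. z / 5 ^ n \<notin> B"] m by (auto simp: n_def)
    moreover have "inverse (z / 5 ^ m) \<in> B" using uB[OF \<open>z / 5 ^ m \<in> B\<close>] n by (simp add: m mult.commute)
    ultimately show "\<exists>n u. u \<in> B \<and> inverse u \<in> B \<and> z = 5 ^ n * u"
      by (intro exI[of _ m] exI[of _ "z / 5 ^ m"]) auto
  next
    fix z assume "z \<in> B"
    then obtain x y where xy: "x \<in> frac" "y \<in> frac" "z = x + y * s" and ev: "\<forall>\<^sub>F N in sequentially. x + y * r N \<in> A"
      using BE by blast
    from eventually_conj[OF ev cauchy[OF xy(2), of 1]]
    obtain N0 where N0: "\<And>N. N \<ge> N0 \<Longrightarrow> x + y * r N \<in> A \<and> y * (r (Suc N) - r N) / 5 \<in> A"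
      by (auto simp: eventually_sequentially)
    \<comment> \<open>The residue is read off at \<open>N0\<close>. Later increments are divisible
      by 5, so it serves for all later \<open>N\<close>.\<close>
    obtain k where k: "k < 5" "(x + y * r N0 - of_nat k) / 5 \<in> A" using residue N0[of N0] by blast
    have "(x - of_nat k) / 5 + y / 5 * r N \<in> A" if "N \<ge> N0" for N
      using that
    proof (induction N rule: dec_induct)
      case base
      have "(x - of_nat k) / 5 + y / 5 * r N0 = (x + y * r N0 - of_nat k) / 5" by (simp add: add_divide_distrib diff_divide_distrib)
      then show ?case using k(2) by (simp only:)
    next
      case (step N)
      have "(x - of_nat k) / 5 + y / 5 * r (Suc N) = ((x - of_nat k) / 5 + y / 5 * r N) + y * (r (Suc N) - r N) / 5"
        by (simp add: field_simps)
      then show ?case using step N0[of N] add_mem by metis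
    qed
    then have "(x - of_nat k) / 5 + y / 5 * s \<in> B"
      using memB[of "(x - of_nat k) / 5" "y / 5"] xy by (auto simp: fracs eventually_sequentially)
    then show "\<exists>k<5. (z - of_nat k) / 5 \<in> B"
      using k by (intro exI[of _ k]) (simp add: xy field_simps)
  qed
  moreover have "A \<subseteq> B"
  proof
    fix x assume "x \<in> A"
    then show "x \<in> B" using memB[of x 0] by (simp add: fracs subset_frac)
  qed
  moreover have "s \<in> B" using memB[of 0 1] rA by (simp add: fracs)
  ultimately show ?thesis by blast
qed

end

section \<open>Construction of a maximal five-adic ring\<close>

lemma five_adic_localization:
  "five_adic {of_int a / of_int b :: 'a::field_char_0 | a b. \<not> 5 dvd b}" (is "five_adic ?A")
proof
  have I: "(of_int a / of_int b :: 'a) \<in> ?A" if "\<not> 5 dvd b" for a b using that by blast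
  show "1 \<in> ?A" using I[of 1 1] by simp
  show "inverse 5 \<notin> ?A"
  proof
    assume "inverse 5 \<in> ?A"
    then obtain a b :: int where ab: "inverse 5 = (of_int a / of_int b :: 'a)" "\<not> 5 dvd b" by blast
    then have "b \<noteq> 0" by auto
    then have "of_int b = (of_int (5 * a) :: 'a)" using ab by (simp add: field_simps)
    then have "b = 5 * a" by (simp only: of_int_eq_iff)
    then show False using ab by simp
  qed
next
  fix x y assume "x \<in> ?A" "y \<in> ?A"
  then obtain a b c d :: int where x: "x = of_int a / of_int b" "\<not> 5 dvd b" and y: "y = of_int c / of_int d" "\<not> 5 dvd d" by blast
  then have nz: "b \<noteq> 0" "d \<noteq> 0" by auto
  have bd: "\<not> 5 dvd b * d" using x y by (simp add: prime_dvd_mult_iff)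
  have "x - y = of_int (a * d - c * b) / of_int (b * d)" "x * y = of_int (a * c) / of_int (b * d)"
    using nz by (auto simp: x y field_simps)
  then show "x - y \<in> ?A" "x * y \<in> ?A" using bd by blast+
next
  fix x assume "x \<in> ?A" "x \<noteq> 0"
  then obtain a b :: int where x: "x = of_int a / of_int b" "\<not> 5 dvd b" by blast
  with \<open>x \<noteq> 0\<close> have "a \<noteq> 0" by auto
  then obtain c where c: "a = 5 ^ multiplicity 5 a * c" "\<not> 5 dvd c"
    using multiplicity_decompose'[of a 5] by (auto simp: mult.commute)
  have "x = 5 ^ multiplicity 5 a * (of_int c / of_int b)"
    unfolding x by (subst c(1)) simp
  moreover have "inverse (of_int c / of_int b :: 'a) = of_int b / of_int c" by simp
  ultimately show "\<exists>n u. u \<in> ?A \<and> inverse u \<in> ?A \<and> x = 5 ^ n * u"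
    using c x by blast
next
  fix x assume "x \<in> ?A"
  then obtain a b :: int where x: "x = of_int a / of_int b" "\<not> 5 dvd b" by blast
  \<comment> \<open>Modulo 5 the inverse of \<open>b\<close> is \<open>b ^ 3\<close>, by Fermat's
    little theorem.\<close>
  define k where "k = nat ((a * b ^ 3) mod 5)"
  have k: "int k = (a * b ^ 3) mod 5" "k < 5" by (auto simp: k_def)
  have "b mod 5 = 1 \<or> b mod 5 = 2 \<or> b mod 5 = 3 \<or> b mod 5 = 4" using x(2) by presburger
  then have "b ^ 4 mod 5 = 1" by (subst power_mod[symmetric]) auto
  then have "(a - a * b ^ 4) mod 5 = 0"
    by (metis mod_diff_right_eq mod_mult_right_eq mult.right_neutral diff_self mod_0)
  moreover have "(a - int k * b) mod 5 = (a - (a * b ^ 3) * b) mod 5"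
    unfolding k by (metis mod_diff_right_eq mod_mult_left_eq)
  moreover have "(a * b ^ 3) * b = a * b ^ 4" by (simp add: eval_nat_numeral)
  ultimately have "5 dvd (a - int k * b)" by auto
  then obtain c where c: "a - int k * b = 5 * c" by blast
  have "b \<noteq> 0" using x by auto
  have "of_int (a - int k * b) = (of_int (5 * c) :: 'a)" by (simp add: c)
  then have "(x - of_nat k) / 5 = of_int c / of_int b" using \<open>b \<noteq> 0\<close> by (simp add: x field_simps)
  then show "\<exists>k<5. (x - of_nat k) / 5 \<in> ?A" using k x by blast
qed

text \<open>Each axiom either concerns at most two given elements or excludes
  \<open>inverse 5\<close>, so it passes to unions of chains. These unions are the upper bounds for
  Zorn's lemma.\<close>

lemma five_adic_Union_chain:
  assumes "C \<noteq> {}" "\<And>A. A \<in> C \<Longrightarrow> five_adic A" "\<And>A B. A \<in> C \<Longrightarrow> B \<in> C \<Longrightarrow> A \<subseteq> B \<or> B \<subseteq> A"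
  shows "five_adic (\<Union>C)"
proof
  show "1 \<in> \<Union>C" using assms five_adic.one_mem by blast
  show "inverse 5 \<notin> \<Union>C" using assms five_adic.inverse_5 by blast
next
  fix x y assume "x \<in> \<Union>C" "y \<in> \<Union>C"
  then obtain A where "A \<in> C" "x \<in> A" "y \<in> A" using assms(3) by blast
  then show "x - y \<in> \<Union>C" "x * y \<in> \<Union>C" using assms(2) five_adic.diff_mem five_adic.mult_mem by blast+
next
  fix x assume "x \<in> \<Union>C" "x \<noteq> 0"
  then show "\<exists>n u. u \<in> \<Union>C \<and> inverse u \<in> \<Union>C \<and> x = 5 ^ n * u"
    using five_adic.five_power_unit assms(2) by (meson UnionI UnionE)
next
  fix x assume "x \<in> \<Union>C"
  then show "\<exists>k<5. (x - of_nat k) / 5 \<in> \<Union>C"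
    using five_adic.residue assms(2) by (meson UnionI UnionE)
qed

text \<open>Zorn's lemma, starting from the integers localized at 5, gives a maximal ring. A missing
  square root of a principal unit could be adjoined by \<open>adjoin_square_root\<close>, against
  maximality.\<close>

lemma ex_henselian_five_adic:
  assumes sqrt: "\<And>x :: 'a::field_char_0. \<exists>y. y\<^sup>2 = x"
  shows "\<exists>A :: 'a set. five_adic A \<and> (\<forall>e\<in>A. \<exists>s\<in>A. s\<^sup>2 = 1 + 5 * e)"
proof -
  have "\<exists>M\<in>Collect five_adic. \<forall>B\<in>(Collect five_adic :: 'a set set). M \<subseteq> B \<longrightarrow> B = M"
  proof (rule subset_Zorn_nonempty)
    show "(Collect five_adic :: 'a set set) \<noteq> {}" using five_adic_localization by blast
    show "\<Union>C \<in> (Collect five_adic :: 'a set set)" if "C \<noteq> {}" "subset.chain (Collect five_adic) C" for C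
      using that five_adic_Union_chain[of C] by (auto simp: subset_chain_def)
  qed
  then obtain A :: "'a set" where A: "five_adic A" and max: "\<And>B. five_adic B \<Longrightarrow> A \<subseteq> B \<Longrightarrow> B = A" by blast
  interpret five_adic A by fact
  have "\<exists>s\<in>A. s\<^sup>2 = 1 + 5 * e" if "e \<in> A" for e
  proof -
    obtain s where s: "s\<^sup>2 = 1 + 5 * e" using sqrt by blast
    have "s \<in> frac" using adjoin_square_root[OF that s] max subset_frac by blast
    moreover have "s\<^sup>2 \<in> A" using that by (simp add: s mems)
    ultimately show ?thesis using s integrally_closed_square by blast
  qed
  then show ?thesis using A by blast
qed

section \<open>Square classes in quadratic towers\<close>

locale subfield_set =
  fixes F :: "'a::field_char_0 set"
  assumes one_mem: "1 \<in> F"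
    and diff_mem: "x \<in> F \<Longrightarrow> y \<in> F \<Longrightarrow> x - y \<in> F"
    and mult_mem: "x \<in> F \<Longrightarrow> y \<in> F \<Longrightarrow> x * y \<in> F"
    and inverse_mem: "x \<in> F \<Longrightarrow> inverse x \<in> F"
begin

lemma zero_mem: "0 \<in> F"
  using diff_mem[OF one_mem one_mem] by simp

lemma uminus_mem: "x \<in> F \<Longrightarrow> - x \<in> F"
  using diff_mem[OF zero_mem] by fastforce

lemma add_mem: "x \<in> F \<Longrightarrow> y \<in> F \<Longrightarrow> x + y \<in> F"
  using diff_mem[of x "- y"] uminus_mem by simp

lemma divide_mem: "x \<in> F \<Longrightarrow> y \<in> F \<Longrightarrow> x / y \<in> F"
  by (simp add: divide_inverse mult_mem inverse_mem)

lemma power_mem: "x \<in> F \<Longrightarrow> x ^ n \<in> F"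
  by (induction n) (auto simp: one_mem mult_mem)

lemma of_nat_mem: "of_nat n \<in> F"
  by (induction n) (auto simp: zero_mem one_mem add_mem)

lemma of_int_mem: "of_int n \<in> F"
  by (cases n rule: int_cases2) (auto simp: of_nat_mem uminus_mem)

lemma numeral_mem: "numeral n \<in> F"
  using of_nat_mem[of "numeral n"] by simp

lemmas mems = zero_mem one_mem uminus_mem add_mem diff_mem mult_mem inverse_mem divide_mem power_mem
  of_nat_mem of_int_mem numeral_mem

end

lemma (in five_adic) subfield_frac: "subfield_set frac"
  by standard (auto simp: fracs frac_inverse)

definition adjoin_sqrt :: "'a::field_char_0 set \<Rightarrow> 'a \<Rightarrow> 'a set" where
  "adjoin_sqrt F s = {x + y * s | x y. x \<in> F \<and> y \<in> F}"

lemma adjoin_sqrtI: "x \<in> F \<Longrightarrow> y \<in> F \<Longrightarrow> x + y * s \<in> adjoin_sqrt F s"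
  by (auto simp: adjoin_sqrt_def)

context subfield_set
begin

lemma sub_adjoin_sqrt: "x \<in> F \<Longrightarrow> x \<in> adjoin_sqrt F s"
  using adjoin_sqrtI[of x F 0 s] zero_mem by simp

lemma sqrt_mem_adjoin: "s \<in> adjoin_sqrt F s"
  using adjoin_sqrtI[of 0 F 1 s] zero_mem one_mem by simp

lemma adjoin_sqrt_subset:
  assumes "subfield_set G" "F \<subseteq> G" "s \<in> G" shows "adjoin_sqrt F s \<subseteq> G"
proof -
  interpret G: subfield_set G by fact
  show ?thesis using assms by (auto simp: adjoin_sqrt_def intro!: G.mems)
qed

lemma adjoin_sqrt_norm_nz:
  assumes "s \<notin> F" "x \<in> F" "y \<in> F" "x + y * s \<noteq> 0"
  shows "x\<^sup>2 - s\<^sup>2 * y\<^sup>2 \<noteq> 0"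
proof
  assume *: "x\<^sup>2 - s\<^sup>2 * y\<^sup>2 = 0"
  have "y \<noteq> 0" using * assms by auto
  then have "(x / y)\<^sup>2 = s\<^sup>2" using * by (simp add: field_simps)
  then have "s = x / y \<or> s = - (x / y)" by (metis power2_eq_iff)
  then show False using assms by (auto simp: mems)
qed

lemma adjoin_sqrt_eq_iff:
  assumes "s \<notin> F" "x \<in> F" "y \<in> F" "x' \<in> F" "y' \<in> F"
  shows "x + y * s = x' + y' * s \<longleftrightarrow> x = x' \<and> y = y'"
proof
  assume eq: "x + y * s = x' + y' * s"
  show "x = x' \<and> y = y'"
  proof (cases "y = y'")
    case False
    then have "s = (x' - x) / (y - y')" using eq by (simp add: field_simps)
    then show ?thesis using assms by (auto simp: mems)
  qed (use eq in auto)
qed auto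

lemma subfield_adjoin_sqrt:
  assumes "s \<notin> F" "s\<^sup>2 \<in> F"
  shows "subfield_set (adjoin_sqrt F s)"
proof
  show "1 \<in> adjoin_sqrt F s" by (simp add: sub_adjoin_sqrt one_mem)
next
  fix z w assume "z \<in> adjoin_sqrt F s" "w \<in> adjoin_sqrt F s"
  then obtain x y x' y' where m: "x \<in> F" "y \<in> F" "x' \<in> F" "y' \<in> F" and e: "z = x + y * s" "w = x' + y' * s"
    by (auto simp: adjoin_sqrt_def)
  have "z - w = (x - x') + (y - y') * s" "z * w = (x * x' + s\<^sup>2 * (y * y')) + (x * y' + x' * y) * s"
    by (simp_all add: e algebra_simps power2_eq_square)
  then show "z - w \<in> adjoin_sqrt F s" "z * w \<in> adjoin_sqrt F s"
    using m assms by (auto intro!: adjoin_sqrtI mems)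
next
  fix z assume "z \<in> adjoin_sqrt F s"
  then obtain x y where m: "x \<in> F" "y \<in> F" and e: "z = x + y * s"
    by (auto simp: adjoin_sqrt_def)
  define n where "n = x\<^sup>2 - s\<^sup>2 * y\<^sup>2"
  have nF: "n \<in> F" using m assms by (auto simp: n_def mems)
  show "inverse z \<in> adjoin_sqrt F s"
  proof (cases "z = 0")
    case False
    then have "n \<noteq> 0" using adjoin_sqrt_norm_nz[of s x y] assms m e by (simp add: n_def)
    have "z * (x / n + (- y / n) * s) = n / n"
      using \<open>n \<noteq> 0\<close> by (simp add: divide_simps) (simp add: e n_def power2_eq_square algebra_simps)
    then have "inverse z = x / n + (- y / n) * s" using \<open>n \<noteq> 0\<close> by (simp add: inverse_unique)
    then show ?thesis using m nF by (simp only:) (intro adjoin_sqrtI mems)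
  qed (simp add: sub_adjoin_sqrt zero_mem)
qed

end

text \<open>
  The last two conditions say that \<open>u\<close> and \<open>p\<close> generate the group of square classes of \<open>F\<close>
  and that the quaternion algebra \<open>(u, p)\<close> does not split.
\<close>

definition local_pair :: "'a::field_char_0 set \<Rightarrow> 'a \<Rightarrow> 'a \<Rightarrow> bool" where
  "local_pair F u p \<longleftrightarrow> subfield_set F \<and> u \<in> F \<and> p \<in> F \<and> (\<exists>i\<in>F. i\<^sup>2 = -1) \<and>
     (\<forall>x\<in>F. x \<noteq> 0 \<longrightarrow> (\<exists>s\<in>F. x \<in> {s\<^sup>2, u * s\<^sup>2, p * s\<^sup>2, u * p * s\<^sup>2})) \<and>
     (\<forall>x\<in>F. \<forall>y\<in>F. \<forall>z\<in>F. x\<^sup>2 = u * y\<^sup>2 + p * z\<^sup>2 \<longrightarrow> x = 0 \<and> y = 0 \<and> z = 0)"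

text \<open>Symmetry lets one lemma on adjoining a square root of the first generator serve for both
  generators.\<close>

lemma local_pair_sym: "local_pair F u p \<Longrightarrow> local_pair F p u"
proof -
  assume lp: "local_pair F u p"
  have "\<exists>s\<in>F. x \<in> {s\<^sup>2, p * s\<^sup>2, u * s\<^sup>2, p * u * s\<^sup>2}" if "x \<in> F" "x \<noteq> 0" for x
  proof -
    obtain s where "s \<in> F" "x \<in> {s\<^sup>2, u * s\<^sup>2, p * s\<^sup>2, u * p * s\<^sup>2}"
      using lp \<open>x \<in> F\<close> \<open>x \<noteq> 0\<close> unfolding local_pair_def by blast
    then show ?thesis by (intro bexI[of _ s]) (auto simp: mult.commute)
  qed
  moreover have "x = 0 \<and> y = 0 \<and> z = 0"
    if "x \<in> F" "y \<in> F" "z \<in> F" "x\<^sup>2 = p * y\<^sup>2 + u * z\<^sup>2" for x y z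
  proof -
    have "x\<^sup>2 = u * z\<^sup>2 + p * y\<^sup>2" using that by simp
    then show ?thesis using lp that(1-3) unfolding local_pair_def by blast
  qed
  ultimately show ?thesis using lp unfolding local_pair_def by blast
qed

text \<open>A root \<open>s\<close> in \<open>F\<close> would give the nontrivial zero
  \<open>(s, 1, 0)\<close> of the form.\<close>

lemma local_pair_sqrt_notin:
  assumes "local_pair F u p" "s\<^sup>2 = u" shows "s \<notin> F"
proof
  assume "s \<in> F"
  interpret subfield_set F using assms by (simp add: local_pair_def)
  have "s\<^sup>2 = u * 1\<^sup>2 + p * 0\<^sup>2" using assms by simp
  then have "(1::'a) = 0" using assms \<open>s \<in> F\<close> zero_mem one_mem unfolding local_pair_def by blast
  then show False by simp
qed

text \<open>Norms from the quadratic extension lie only in the square classes of 1 and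
  \<open>u\<close>, because the form is anisotropic. By Hilbert 90, each nonzero element of the
  extension, or its product with \<open>s\<close>, then comes from \<open>F\<close> up to squares;
  there \<open>u\<close> has become a square and only the classes of 1 and \<open>p\<close>
  remain.\<close>

lemma local_pair_adjoin_sqrt:
  assumes lp: "local_pair F u p" and s: "s\<^sup>2 = u"
  shows "local_pair (adjoin_sqrt F s) s p"
proof -
  define L where "L = adjoin_sqrt F s"
  interpret subfield_set F using lp by (simp add: local_pair_def)
  have uF: "u \<in> F" and pF: "p \<in> F" using lp by (auto simp: local_pair_def)
  obtain i where i: "i \<in> F" "i\<^sup>2 = -1" using lp by (auto simp: local_pair_def)
  have cls: "\<And>x. x \<in> F \<Longrightarrow> x \<noteq> 0 \<Longrightarrow> \<exists>s\<in>F. x \<in> {s\<^sup>2, u * s\<^sup>2, p * s\<^sup>2, u * p * s\<^sup>2}"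
    using lp by (auto simp: local_pair_def)
  have aniso: "\<And>x y z. x \<in> F \<Longrightarrow> y \<in> F \<Longrightarrow> z \<in> F \<Longrightarrow> x\<^sup>2 = u * y\<^sup>2 + p * z\<^sup>2 \<Longrightarrow> x = 0 \<and> y = 0 \<and> z = 0"
    using lp unfolding local_pair_def by blast
  have sF: "s \<notin> F" using local_pair_sqrt_notin[OF lp s] .
  have L: "subfield_set L" unfolding L_def using subfield_adjoin_sqrt[OF sF] s uF by simp
  interpret L: subfield_set L by fact
  have FL: "x \<in> L" if "x \<in> F" for x using that sub_adjoin_sqrt by (simp add: L_def)
  have sL: "s \<in> L" using sqrt_mem_adjoin by (simp add: L_def)
  have LE: "\<exists>x\<in>F. \<exists>y\<in>F. z = x + y * s" if "z \<in> L" for z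
    using that by (auto simp: L_def adjoin_sqrt_def)
  have i0: "i \<noteq> 0" using i by auto
  have u0: "u \<noteq> 0" using s sF zero_mem by auto
  have s0: "s \<noteq> 0" using sF zero_mem by auto

  \<comment> \<open>Hilbert 90, as \<open>(z + c)\<^sup>2 = 2 (x + c) z\<close> when \<open>c\<^sup>2\<close> is the norm of \<open>z = x + y s\<close>.\<close>
  have H90: "\<exists>f\<in>F. \<exists>w\<in>L. f \<noteq> 0 \<and> z = f * w\<^sup>2"
    if z: "z = x + y * s" "x \<in> F" "y \<in> F" "z \<noteq> 0" and c: "c \<in> F" "x\<^sup>2 - u * y\<^sup>2 = c\<^sup>2" for x y z c
  proof (cases "x + c = 0")
    case True
    then have "c = - x" by (simp add: eq_neg_iff_add_eq_0 add.commute)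
    then have "y = 0" using c u0 by simp
    then show ?thesis using z by (intro bexI[of _ x] bexI[of _ 1]) (auto simp: L.one_mem)
  next
    case False
    have "(z + c)\<^sup>2 = 2 * (x + c) * z + (c\<^sup>2 - (x\<^sup>2 - s\<^sup>2 * y\<^sup>2))"
      by (simp add: z power2_eq_square algebra_simps)
    moreover define h where "h = 2 * (x + c)"
    ultimately have eq: "(z + c)\<^sup>2 = h * z" using c s by simp
    have "h \<noteq> 0" using False unfolding h_def by (metis mult_eq_0_iff zero_neq_numeral)
    moreover have "z = inverse h * (z + c)\<^sup>2" using \<open>h \<noteq> 0\<close> by (simp add: eq)
    moreover have "z + c \<in> L" using z c FL sL by (auto intro!: L.mems)
    moreover have "inverse h \<in> F" using z c by (auto simp only: h_def intro!: mems)
    ultimately show ?thesis by (meson inverse_nonzero_iff_nonzero)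
  qed
  have FL2: "\<exists>v\<in>L. f = v\<^sup>2 \<or> f = p * v\<^sup>2" if f: "f \<in> F" "f \<noteq> 0" for f
  proof -
    obtain g where g: "g \<in> F" "f \<in> {g\<^sup>2, u * g\<^sup>2, p * g\<^sup>2, u * p * g\<^sup>2}" using cls f by blast
    then have "f = g\<^sup>2 \<or> f = (s * g)\<^sup>2 \<or> f = p * g\<^sup>2 \<or> f = p * (s * g)\<^sup>2"
      by (auto simp: power_mult_distrib s)
    then show ?thesis using FL[OF g(1)] sL L.mult_mem by blast
  qed
  have clsL: "\<exists>w\<in>L. z \<in> {w\<^sup>2, s * w\<^sup>2, p * w\<^sup>2, s * p * w\<^sup>2}" if "z \<in> L" "z \<noteq> 0" for z
  proof -
    obtain x y where xy: "z = x + y * s" "x \<in> F" "y \<in> F" using LE \<open>z \<in> L\<close> by blast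
    define n where "n = x\<^sup>2 - u * y\<^sup>2"
    have n: "n \<in> F" "n \<noteq> 0" using adjoin_sqrt_norm_nz[OF sF xy(2,3)] xy \<open>z \<noteq> 0\<close> s uF
      by (auto simp: n_def mems)
    obtain c where c: "c \<in> F" "n \<in> {c\<^sup>2, u * c\<^sup>2, p * c\<^sup>2, u * p * c\<^sup>2}" using cls n by blast
    have "n \<noteq> p * c\<^sup>2"
    proof
      assume "n = p * c\<^sup>2"
      then have "x\<^sup>2 = u * y\<^sup>2 + p * c\<^sup>2" by (simp add: n_def algebra_simps)
      then show False using aniso[OF xy(2,3) c(1)] xy \<open>z \<noteq> 0\<close> by simp
    qed
    moreover have "n \<noteq> u * p * c\<^sup>2"
    proof
      assume *: "n = u * p * c\<^sup>2"
      \<comment> \<open>Multiplying the norm equation by \<open>u\<close> and writing -1 as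
        \<open>i\<^sup>2\<close> brings it into the form excluded by \<open>aniso\<close>.\<close>
      have "(u * y)\<^sup>2 = u * x\<^sup>2 - u * n" by (simp add: n_def algebra_simps power2_eq_square)
      also have "\<dots> = u * x\<^sup>2 + p * (i * u * c)\<^sup>2" by (simp add: * power_mult_distrib i) (simp add: power2_eq_square)
      finally have "u * y = 0 \<and> x = 0" using aniso[of "u * y" x "i * u * c"] xy c i uF by (simp add: mems)
      then show False using xy \<open>z \<noteq> 0\<close> u0 by simp
    qed
    ultimately consider "n = c\<^sup>2" | "n = u * c\<^sup>2" using c by blast
    then show ?thesis
    proof cases
      case 1
      then obtain f w where fw: "f \<in> F" "w \<in> L" "f \<noteq> 0" "z = f * w\<^sup>2"
        using H90[OF xy \<open>z \<noteq> 0\<close> c(1)] by (auto simp: n_def)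
      then obtain v where "v \<in> L" "f = v\<^sup>2 \<or> f = p * v\<^sup>2" using FL2 by blast
      then have "v * w \<in> L" "z = (v * w)\<^sup>2 \<or> z = p * (v * w)\<^sup>2" using fw
        by (auto simp: power_mult_distrib L.mult_mem)
      then show ?thesis by blast
    next
      case 2
      \<comment> \<open>The norm of \<open>s\<close> is \<open>- u\<close>, so \<open>z * s\<close>
        has norm \<open>- u * n\<close>, which is a square in this case, and Hilbert 90 applies to
        it.\<close>
      have "z * s = u * y + x * s" by (simp add: xy s[symmetric] power2_eq_square algebra_simps)
      moreover have "(u * y)\<^sup>2 - u * x\<^sup>2 = (i * u * c)\<^sup>2"
      proof -
        have "(u * y)\<^sup>2 - u * x\<^sup>2 = - u * n" by (simp add: n_def algebra_simps power2_eq_square)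
        then show ?thesis using 2 by (simp add: power_mult_distrib i) (simp add: power2_eq_square)
      qed
      ultimately obtain f w where fw: "f \<in> F" "w \<in> L" "f \<noteq> 0" "z * s = f * w\<^sup>2"
        using H90[of "z * s" "u * y" x "i * u * c"] mult_mem[OF uF xy(3)] xy(2) mult_mem[OF mult_mem[OF i(1) uF] c(1)]
          no_zero_divisors[OF \<open>z \<noteq> 0\<close> s0] by blast
      then obtain v where v: "v \<in> L" "f = v\<^sup>2 \<or> f = p * v\<^sup>2" using FL2 by blast
      have "z = s * (f * (w / s)\<^sup>2)" using fw s0 by (simp add: field_simps power2_eq_square)
      then have "v * w / s \<in> L" "z = s * (v * w / s)\<^sup>2 \<or> z = s * p * (v * w / s)\<^sup>2" using fw v sL
        by (auto simp: power_mult_distrib power_divide L.mult_mem L.divide_mem)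
      then show ?thesis by blast
    qed
  qed
  have anisoL: "x = 0 \<and> y = 0 \<and> z = 0" if xyz: "x \<in> L" "y \<in> L" "z \<in> L" and eq: "x\<^sup>2 = s * y\<^sup>2 + p * z\<^sup>2" for x y z
  proof (cases "y = 0")
    case False
    \<comment> \<open>Dividing by \<open>y\<^sup>2\<close> and comparing coordinates in the basis 1,
      \<open>s\<close> gives two equations over \<open>F\<close>.\<close>
    obtain a b where ab: "x / y = a + b * s" "a \<in> F" "b \<in> F" using LE xyz L.divide_mem by blast
    obtain c d where cd: "z / y = c + d * s" "c \<in> F" "d \<in> F" using LE xyz L.divide_mem by blast
    have "s = (x / y)\<^sup>2 - p * (z / y)\<^sup>2" using False eq by (simp add: field_simps)
    also have "\<dots> = (a\<^sup>2 + s\<^sup>2 * b\<^sup>2 - p * (c\<^sup>2 + s\<^sup>2 * d\<^sup>2)) + (2 * (a * b) - 2 * p * (c * d)) * s"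
      by (simp add: ab cd power2_eq_square algebra_simps)
    finally have "0 + 1 * s = (a\<^sup>2 + u * b\<^sup>2 - p * (c\<^sup>2 + u * d\<^sup>2)) + (2 * (a * b) - 2 * p * (c * d)) * s"
      by (simp add: s)
    then have e: "0 = a\<^sup>2 + u * b\<^sup>2 - p * (c\<^sup>2 + u * d\<^sup>2)" "1 = 2 * (a * b) - 2 * p * (c * d)"
      using adjoin_sqrt_eq_iff[OF sF zero_mem one_mem, of "a\<^sup>2 + u * b\<^sup>2 - p * (c\<^sup>2 + u * d\<^sup>2)" "2 * (a * b) - 2 * p * (c * d)"]
        ab cd uF pF by (simp_all add: mems)
    \<comment> \<open>\<open>A\<^sup>2 - p B\<^sup>2\<close> is the norm to \<open>F\<close> of \<open>(x - \<surd>p z) / y\<close>, hence equal to \<open>- u\<close>, the norm of \<open>s\<close>.\<close>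
    define A where "A = a\<^sup>2 + p * c\<^sup>2 - u * b\<^sup>2 - u * p * d\<^sup>2"
    define B where "B = 2 * (a * c - u * (b * d))"
    have "A\<^sup>2 - p * B\<^sup>2 = (a\<^sup>2 + u * b\<^sup>2 - p * (c\<^sup>2 + u * d\<^sup>2))\<^sup>2 - u * (2 * (a * b) - 2 * p * (c * d))\<^sup>2"
      by (simp add: A_def B_def power2_eq_square algebra_simps)
    then have "A\<^sup>2 - p * B\<^sup>2 = - u" unfolding e[symmetric] by simp
    then have "A\<^sup>2 = u * i\<^sup>2 + p * B\<^sup>2" by (simp add: i algebra_simps)
    moreover have "A \<in> F" "B \<in> F" using ab cd uF pF by (auto simp: A_def B_def mems)
    ultimately show ?thesis using aniso i i0 by blast
  next
    case True
    show ?thesis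
    proof (cases "z = 0")
      case False
      obtain a b where ab: "x / z = a + b * s" "a \<in> F" "b \<in> F" using LE xyz L.divide_mem by blast
      \<comment> \<open>A square root of \<open>p\<close> in \<open>L\<close> would put
        \<open>p\<close> into the square class of 1 or of \<open>u\<close> in
        \<open>F\<close>.\<close>
      have "p = (x / z)\<^sup>2" using False True eq by (simp add: field_simps)
      also have "\<dots> = (a\<^sup>2 + s\<^sup>2 * b\<^sup>2) + (2 * (a * b)) * s" by (simp add: ab power2_eq_square algebra_simps)
      finally have "p + 0 * s = (a\<^sup>2 + u * b\<^sup>2) + (2 * (a * b)) * s" by (simp add: s)
      then have e: "p = a\<^sup>2 + u * b\<^sup>2" "0 = 2 * (a * b)"
        using adjoin_sqrt_eq_iff[OF sF, of p 0 "a\<^sup>2 + u * b\<^sup>2" "2 * (a * b)"] ab uF pF by (auto simp: mems)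
      from e(2) consider "b = 0" | "a = 0" by auto
      then show ?thesis
      proof cases
        case 1
        then have "a\<^sup>2 = u * 0\<^sup>2 + p * 1\<^sup>2" using e by simp
        then have "(1::'a) = 0" using aniso ab zero_mem one_mem by blast
        then show ?thesis by simp
      next
        case 2
        then have "0\<^sup>2 = u * b\<^sup>2 + p * i\<^sup>2" using e by (simp add: i)
        then show ?thesis using aniso ab zero_mem i i0 by blast
      qed
    qed (use True eq in simp)
  qed
  show ?thesis unfolding local_pair_def L_def[symmetric]
    using L sL FL pF i clsL anisoL by blast
qed

lemma local_pair_adjoin_sqrt2:
  assumes "local_pair F u p" "s\<^sup>2 = u" "t\<^sup>2 = p"
  shows "local_pair (adjoin_sqrt (adjoin_sqrt F s) t) s t"
  using local_pair_adjoin_sqrt local_pair_sym assms by metis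

text \<open>Hensel's lemma reduces units modulo squares to the residue field of order 5, where the
  square roots 2 and 3 of -1 are non-squares. So \<open>i\<close> represents the nontrivial class of
  units, and 5 accounts for the parity of the valuation.\<close>

lemma (in five_adic) local_pair_frac:
  assumes hensel: "\<And>e. e \<in> A \<Longrightarrow> \<exists>s\<in>A. s\<^sup>2 = 1 + 5 * e"
  shows "\<exists>i. i\<^sup>2 = -1 \<and> local_pair frac i 5"
proof -
  \<comment> \<open>As -4 is a principal unit, it has a square root in \<open>A\<close>, and
    \<open>i\<close> is half of that root.\<close>
  obtain s where s: "s \<in> A" "s\<^sup>2 = 1 + 5 * (-1)" using hensel uminus_mem[OF one_mem] by blast
  have "(2::'a) / 5 \<notin> A" using of_int_div_5[of 2] by simp
  then have h: "inverse 2 \<in> A" using inverse_mem[of 2] numeral_mem by blast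
  define i where "i = s * inverse 2"
  have i: "i \<in> A" "i\<^sup>2 = -1" using s mult_mem[OF _ h] by (simp_all only: i_def power_mult_distrib) (simp add: power2_eq_square)
  obtain c where c: "c < 5" "(i - of_nat c) / 5 \<in> A" using residue i by blast
  define f where "f = (i - of_nat c) / 5"
  have five_nz: "(5::'a) \<noteq> 0" by simp
  have cancel5: "5 * (w / 5) = w" for w :: 'a by simp
  have div5: "y = of_nat k + 5 * z" if "z = (y - of_nat k) / 5" for y z :: 'a and k
    unfolding that cancel5 by simp
  have f: "f \<in> A" "i = of_nat c + 5 * f" using c div5 by (auto simp only: f_def)
  have "of_int (int c ^ 2 + 1) / 5 = - (2 * of_nat c * f + 5 * f\<^sup>2)"
  proof -
    have "-1 = (of_nat c + 5 * f)\<^sup>2" using i f by simp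
    also have "\<dots> = of_nat c ^ 2 + 5 * (2 * of_nat c * f + 5 * f\<^sup>2)"
      by (simp add: power2_eq_square algebra_simps)
    finally have "of_nat c ^ 2 + 1 = of_nat c ^ 2 - (of_nat c ^ 2 + 5 * (2 * of_nat c * f + 5 * f\<^sup>2))"
      by (metis diff_minus_eq_add)
    then have "of_nat c ^ 2 + 1 = 5 * (- (2 * of_nat c * f + 5 * f\<^sup>2))" by simp
    moreover have "of_int (int c ^ 2 + 1) = (of_nat c ^ 2 + 1 :: 'a)" by simp
    ultimately show ?thesis by (simp only: nonzero_mult_div_cancel_left[OF five_nz])
  qed
  then have "of_int (int c ^ 2 + 1) / 5 \<in> A" using f by (simp only:) (simp only: mems)
  then have c2: "5 dvd int c ^ 2 + 1" by (simp only: of_int_div_5)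
  have c23: "c = 2 \<or> c = 3"
  proof -
    have "c \<in> {0,1,2,3,4}" using c(1) by auto
    then show ?thesis using c2 by auto
  qed
  have unit_mod: "\<exists>v\<in>A. u = v\<^sup>2 \<or> u = i * v\<^sup>2" if u: "u \<in> A" "inverse u \<in> A" "u \<noteq> 0" for u
  proof -
    have sq: "\<exists>v\<in>A. w = v\<^sup>2" if "w = 1 + 5 * e" "e \<in> A" for w e
      using hensel that by metis
    obtain k where k: "k < 5" "(u - of_nat k) / 5 \<in> A" using residue u by blast
    define e where "e = (u - of_nat k) / 5"
    have e: "e \<in> A" "u = of_nat k + 5 * e" using k div5 by (auto simp only: e_def)
    have "k \<noteq> 0"
    proof
      assume "k = 0"
      then have "inverse u * e = inverse 5" using e u by (simp add: field_simps)
      then show False using u e inverse_5 mult_mem by metis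
    qed
    define g where "g = of_nat k * f + of_nat c * e + 5 * e * f"
    have g: "g \<in> A" "i * u = of_nat (k * c) + 5 * g"
      using e f by (auto simp: g_def mems algebra_simps)
    have i2: "i * (i * z) = - z" for z using i(2) by (simp add: power2_eq_square flip: mult.assoc)
    \<comment> \<open>A residue \<open>k\<close> of 1 or 4 makes \<open>u\<close> or
      \<open>- u\<close> a principal unit. For \<open>k\<close> equal to 2 or 3 the residue
      \<open>k * c\<close> of \<open>i * u\<close> is 1 or -1 modulo 5. The sign is harmless because
      -1 is the square of \<open>i\<close>.\<close>
    consider "k = 1" | "k = 4" | "k * c = 6" | "k * c = 4" | "k * c = 9"
      using k(1) \<open>k \<noteq> 0\<close> c23 by force
    then show ?thesis
    proof cases
      case 1
      then show ?thesis using sq[of u e] e by auto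
    next
      case 2
      then have "- u = 1 + 5 * (- e - 1)" using e by simp
      then obtain v where "v \<in> A" "- u = v\<^sup>2" using sq e by (metis diff_mem uminus_mem one_mem)
      moreover from this have "u = - v\<^sup>2" by (metis minus_minus)
      ultimately show ?thesis using i by (intro bexI[of _ "i * v"]) (auto simp: power_mult_distrib mult_mem)
    next
      case 3
      then have "i * u = 1 + 5 * (g + 1)" using g by simp
      then obtain v where v: "v \<in> A" "i * u = v\<^sup>2" using sq g by (metis add_mem one_mem)
      have "u = - (i * v\<^sup>2)" using i2[of u] v by simp
      then show ?thesis using i v by (intro bexI[of _ "i * v"]) (auto simp: power_mult_distrib mult_mem)
    next
      case 4
      then have "- (i * u) = 1 + 5 * (- g - 1)" using g by simp
      then obtain v where v: "v \<in> A" "- (i * u) = v\<^sup>2" using sq g by (metis diff_mem uminus_mem one_mem)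
      have "u = i * v\<^sup>2" using i2[of u] v(2)[symmetric] by simp
      then show ?thesis using v by blast
    next
      case 5
      then have "- (i * u) = 1 + 5 * (- g - 2)" using g by simp
      then obtain v where v: "v \<in> A" "- (i * u) = v\<^sup>2" using sq g by (metis diff_mem uminus_mem numeral_mem)
      have "u = i * v\<^sup>2" using i2[of u] v(2)[symmetric] by simp
      then show ?thesis using v by blast
    qed
  qed
  have cls: "\<exists>v\<in>frac. x \<in> {v\<^sup>2, i * v\<^sup>2, 5 * v\<^sup>2, i * 5 * v\<^sup>2}" if x: "x \<in> frac" "x \<noteq> 0" for x
  proof -
    obtain m n u where u: "u \<in> A" "inverse u \<in> A" "x = 5 ^ m * u / 5 ^ n"
      using frac_unit[OF x] by metis
    then have "u \<noteq> 0" using x by auto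
    then obtain v where v: "v \<in> A" "u = v\<^sup>2 \<or> u = i * v\<^sup>2" using unit_mod u by blast
    \<comment> \<open>Since \<open>m - n\<close> and \<open>m + n\<close> have the same parity, the
      class depends only on \<open>m + n\<close> modulo 2.\<close>
    define l where "l = (m + n) div 2"
    have "x = 5 ^ (m + n) * u / (5 ^ n)\<^sup>2" by (simp add: u(3) power_add power2_eq_square)
    also have "m + n = 2 * l + (m + n) mod 2" by (simp add: l_def)
    finally have x: "x = 5 ^ ((m + n) mod 2) * u * (5 ^ l / 5 ^ n)\<^sup>2"
      by (simp only: power_add power_even_eq power_divide times_divide_eq_right times_divide_eq_left) (simp only: mult_ac)
    have "v * (5 ^ l / 5 ^ n) \<in> frac"
      by (intro frac_mult frac_divide frac_power frac_numeral subset_frac v(1))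
    moreover have "x \<in> {(v * (5 ^ l / 5 ^ n))\<^sup>2, i * (v * (5 ^ l / 5 ^ n))\<^sup>2, 5 * (v * (5 ^ l / 5 ^ n))\<^sup>2, i * 5 * (v * (5 ^ l / 5 ^ n))\<^sup>2}"
      using v(2) unfolding x by (cases "(m + n) mod 2 = 0") (auto simp: power_mult_distrib power_divide mod2_eq_if)
    ultimately show ?thesis by blast
  qed
  \<comment> \<open>For the residues the equation reads \<open>a\<^sup>2 = c * b\<^sup>2\<close>
    modulo 5 with the non-square \<open>c\<close>, which forces \<open>a = 0\<close> and
    \<open>b = 0\<close>. Then 5 divides \<open>z\<^sup>2\<close>, hence \<open>z\<close>.\<close>
  have descent: "x / 5 \<in> A \<and> y / 5 \<in> A \<and> z / 5 \<in> A"
    if xyz: "x \<in> A" "y \<in> A" "z \<in> A" and eq: "x\<^sup>2 = i * y\<^sup>2 + 5 * z\<^sup>2" for x y z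
  proof -
    obtain a where a: "a < 5" "(x - of_nat a) / 5 \<in> A" using residue xyz by blast
    obtain b where b: "b < 5" "(y - of_nat b) / 5 \<in> A" using residue xyz by blast
    obtain d where d: "d < 5" "(z - of_nat d) / 5 \<in> A" using residue xyz by blast
    define x' y' z' where "x' = (x - of_nat a) / 5" and "y' = (y - of_nat b) / 5" and "z' = (z - of_nat d) / 5"
    have x': "x' \<in> A" "x = of_nat a + 5 * x'" and y': "y' \<in> A" "y = of_nat b + 5 * y'" and z': "z' \<in> A" "z = of_nat d + 5 * z'"
      using a b d div5 by (auto simp only: x'_def y'_def z'_def)
    have "of_int (int a ^ 2 - int c * int b ^ 2) = x\<^sup>2 - 2 * of_nat a * (5 * x') - 25 * x'\<^sup>2
        - (i - 5 * f) * (y\<^sup>2 - 2 * of_nat b * (5 * y') - 25 * y'\<^sup>2)"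
      unfolding x'(2) y'(2) f(2) by (simp add: power2_eq_square algebra_simps)
    also have "\<dots> = 5 * (z\<^sup>2 - 2 * of_nat a * x' - 5 * x'\<^sup>2 + i * (2 * of_nat b * y' + 5 * y'\<^sup>2)
        + f * (y\<^sup>2 - 2 * of_nat b * (5 * y') - 25 * y'\<^sup>2))"
      unfolding eq by (simp add: algebra_simps)
    finally have "of_int (int a ^ 2 - int c * int b ^ 2) / 5 = z\<^sup>2 - 2 * of_nat a * x' - 5 * x'\<^sup>2 + i * (2 * of_nat b * y' + 5 * y'\<^sup>2)
        + f * (y\<^sup>2 - 2 * of_nat b * (5 * y') - 25 * y'\<^sup>2)" by simp
    also have "\<dots> \<in> A" using x' y' z' f i xyz by (intro mems) auto
    finally have dv: "5 dvd int a ^ 2 - int c * int b ^ 2" by (simp only: of_int_div_5)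
    have "a \<in> {0,1,2,3,4}" "b \<in> {0,1,2,3,4}" using a b by auto
    then have ab: "a = 0" "b = 0" using dv c23 by auto
    then have "5 * z\<^sup>2 = (5 * x')\<^sup>2 - i * (5 * y')\<^sup>2" using x' y' eq by simp
    then have "z\<^sup>2 / 5 = x'\<^sup>2 - i * y'\<^sup>2"
    proof -
      have "5 * z\<^sup>2 = 5 * (5 * (x'\<^sup>2 - i * y'\<^sup>2))"
        unfolding \<open>5 * z\<^sup>2 = _\<close> by (simp add: power_mult_distrib algebra_simps)
      then have "z\<^sup>2 = 5 * (x'\<^sup>2 - i * y'\<^sup>2)" by (simp only: mult_cancel_left five_nz simp_thms)
      then show ?thesis by (simp only: nonzero_mult_div_cancel_left[OF five_nz])
    qed
    moreover have "of_int (int d ^ 2) / 5 = z\<^sup>2 / 5 - 2 * of_nat d * z' - 5 * z'\<^sup>2"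
      unfolding z'(2) by (simp add: power2_eq_square field_simps)
    ultimately have "of_int (int d ^ 2) / 5 = x'\<^sup>2 - i * y'\<^sup>2 - 2 * of_nat d * z' - 5 * z'\<^sup>2" by simp
    also have "\<dots> \<in> A" using x' y' z' i by (intro mems) auto
    finally have dv: "5 dvd int d ^ 2" by (simp only: of_int_div_5)
    have "d \<in> {0,1,2,3,4}" using d by auto
    then have "d = 0" using dv by auto
    then show ?thesis using ab x' y' z' by simp
  qed
  have divisible: "x = 0" if "\<And>n. x / 5 ^ n \<in> A" for x
  proof (rule ccontr)
    assume "x \<noteq> 0"
    have "x \<in> A" using that[of 0] by simp
    then obtain m u where u: "u \<in> A" "inverse u \<in> A" "x = 5 ^ m * u" using five_power_unit \<open>x \<noteq> 0\<close> by blast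
    then have "u \<noteq> 0" using \<open>x \<noteq> 0\<close> by auto
    then have "inverse 5 = inverse u * (x / 5 ^ Suc m)" using u by (simp add: field_simps)
    then show False using u that inverse_5 mult_mem by metis
  qed
  have aniso: "x = 0 \<and> y = 0 \<and> z = 0"
    if xyz: "x \<in> frac" "y \<in> frac" "z \<in> frac" and eq: "x\<^sup>2 = i * y\<^sup>2 + 5 * z\<^sup>2" for x y z
  proof -
    obtain k where k: "\<And>m. m \<ge> k \<Longrightarrow> x * 5 ^ m \<in> A" using fracE xyz by metis
    obtain l where l: "\<And>m. m \<ge> l \<Longrightarrow> y * 5 ^ m \<in> A" using fracE xyz by metis
    obtain m where m: "\<And>j. j \<ge> m \<Longrightarrow> z * 5 ^ j \<in> A" using fracE xyz by metis
    \<comment> \<open>A common denominator; \<open>descent\<close> can then be repeated indefinitely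
      on the scaled solution.\<close>
    define t where "t = (5::'a) ^ (k + l + m)"
    have "x * t / 5 ^ n \<in> A \<and> y * t / 5 ^ n \<in> A \<and> z * t / 5 ^ n \<in> A" for n
    proof (induction n)
      case 0
      then show ?case using k[of "k + l + m"] l[of "k + l + m"] m[of "k + l + m"] by (simp add: t_def)
    next
      case (Suc n)
      have "(x * t / 5 ^ n)\<^sup>2 = x\<^sup>2 * (t / 5 ^ n)\<^sup>2" by (simp add: power_mult_distrib power_divide)
      also have "\<dots> = i * (y * t / 5 ^ n)\<^sup>2 + 5 * (z * t / 5 ^ n)\<^sup>2"
        unfolding eq by (simp add: power_mult_distrib power_divide field_simps)
      finally show ?case using descent Suc by (fastforce simp: mult.commute)
    qed
    then have "x * t = 0" "y * t = 0" "z * t = 0" using divisible by blast+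
    then show ?thesis by (simp add: t_def)
  qed
  have "local_pair frac i 5" unfolding local_pair_def
    using subfield_frac i subset_frac fracs cls aniso by (metis (no_types, lifting))
  then show ?thesis using i by blast
qed

section \<open>Galois theory of the algebraic numbers\<close>

type_synonym qbar = "rat alg_closure"

definition qpoly :: "rat poly \<Rightarrow> qbar \<Rightarrow> qbar" where
  "qpoly c x = poly (map_poly to_ac c) x"

lemma qpoly_0 [simp]: "qpoly 0 x = 0"
  by (simp add: qpoly_def)

lemma qpoly_pCons [simp]: "qpoly (pCons a c) x = to_ac a + x * qpoly c x"
  by (simp add: qpoly_def map_poly_pCons)

lemma qpoly_add: "qpoly (c + d) x = qpoly c x + qpoly d x"
  by (induction c d rule: poly_induct2) (auto simp: algebra_simps)

lemma qpoly_smult: "qpoly (Polynomial.smult a c) x = to_ac a * qpoly c x"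
  by (induction c) (auto simp: algebra_simps)

lemma qpoly_diff: "qpoly (c - d) x = qpoly c x - qpoly d x"
  using qpoly_add[of "c - d" d x] by simp

lemma qpoly_mult: "qpoly (c * d) x = qpoly c x * qpoly d x"
  by (induction c) (auto simp: qpoly_add qpoly_smult algebra_simps)

lemma ex_qpoly_root: "\<exists>c. c \<noteq> 0 \<and> qpoly c x = 0"
  using alg_closure_algebraic[of x] unfolding qpoly_def by metis

lemma finite_qpoly_roots: "c \<noteq> 0 \<Longrightarrow> finite {x. qpoly c x = 0}"
  unfolding qpoly_def by (intro poly_roots_finite) (simp add: map_poly_eq_0_iff)

text \<open>The highest possible power of the indeterminate is cancelled from an annihilating
  polynomial. The nonzero constant term is what expresses \<open>inverse x\<close> as a polynomial
  in \<open>x\<close>.\<close>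

lemma ex_qpoly_root_nonzero_const:
  assumes "x \<noteq> 0" shows "\<exists>a c. a \<noteq> 0 \<and> qpoly (pCons a c) x = 0"
proof -
  have *: "\<exists>a c. a \<noteq> 0 \<and> qpoly (pCons a c) x = 0" if "d \<noteq> 0" "qpoly d x = 0" for d
    using that
  proof (induction d)
    case (pCons a c)
    then show ?case
    proof (cases "a = 0")
      case True
      then show ?thesis using pCons assms by simp
    qed blast
  qed simp
  obtain d where "d \<noteq> 0" "qpoly d x = 0" using ex_qpoly_root by blast
  then show ?thesis by (rule *)
qed

lemma inverse_from_qpoly:
  assumes "a \<noteq> 0" "qpoly (pCons a c) x = 0"
  shows "x \<noteq> 0" "inverse x = - to_ac (inverse a) * qpoly c x"
proof -
  have *: "x * qpoly c x = - to_ac a" using assms(2) by (simp add: add_eq_0_iff)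
  then show "x \<noteq> 0" using assms(1) by auto
  have "x * (- to_ac (inverse a) * qpoly c x) = - to_ac (inverse a) * (x * qpoly c x)" by simp
  also have "\<dots> = 1" using assms(1) unfolding * by simp
  finally show "inverse x = - to_ac (inverse a) * qpoly c x" by (simp add: inverse_unique)
qed

lemma to_ac_eq_quotient: "\<exists>a b. to_ac (q :: rat) = of_int a / of_int b"
proof -
  obtain a b where "quotient_of q = (a, b)" by fastforce
  then have "q = of_int a / of_int b" by (rule quotient_of_div)
  then have "to_ac q = of_int a / of_int b" by (simp only: to_ac_divide to_ac_of_int)
  then show ?thesis by blast
qed

locale qbar_subfield = subfield_set F for F :: "qbar set"
begin

lemma to_ac_mem: "to_ac q \<in> F"
  using to_ac_eq_quotient[of q] by (auto simp: mems)

end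

lemma act_simps [simp]:
  "act g (x + y) = act g x + act g y" "act g (x * y) = act g x * act g y" "act g (to_ac q) = to_ac q"
  using act[of g] by auto

lemma bij_act: "bij (act g)" using act[of g] by auto

lemma act_eq_iff [simp]: "act g x = act g y \<longleftrightarrow> x = y"
  using bij_act[of g] by (auto simp: bij_def inj_def)

lemma act_0 [simp]: "act g 0 = 0" and act_1 [simp]: "act g 1 = 1"
  and act_numeral [simp]: "act g (numeral n) = numeral n" and act_of_nat [simp]: "act g (of_nat k) = of_nat k"
  using act_simps(3)[of g 0] act_simps(3)[of g 1] act_simps(3)[of g "numeral n"] act_simps(3)[of g "of_nat k"]
  by (simp_all del: act_simps)

lemma act_uminus [simp]: "act g (- x) = - act g x"
  using act_simps(1)[of g x "- x"] by (simp del: act_simps add: eq_neg_iff_add_eq_0 add.commute)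

lemma act_diff [simp]: "act g (x - y) = act g x - act g y"
  using act_simps(1)[of g x "- y"] by (simp del: act_simps)

lemma act_power [simp]: "act g (x ^ n) = act g x ^ n"
  by (induction n) auto

lemma act_eq_0_iff [simp]: "act g x = 0 \<longleftrightarrow> x = 0"
  using act_eq_iff[of g x 0] by (simp del: act_eq_iff)

lemma act_inverse [simp]: "act g (inverse x) = inverse (act g x)"
proof (cases "x = 0")
  case False
  then have "act g x * act g (inverse x) = 1" by (simp flip: act_simps(2))
  then show ?thesis by (simp add: inverse_unique)
qed auto

lemma act_divide [simp]: "act g (x / y) = act g x / act g y"
  by (simp add: divide_inverse)

lemma act_qpoly: "act g (qpoly c x) = qpoly c (act g x)"
  by (induction c) auto

lemma act_times [simp]: "act (g * h) x = act g (act h x)"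
  by (simp add: times_gal_Q.rep_eq)

lemma act_one [simp]: "act 1 x = x"
  by (simp add: one_gal_Q.rep_eq)

lemma finite_conjugates: "finite {act g x | g. True}"
proof -
  obtain c where c: "c \<noteq> 0" "qpoly c x = 0" using ex_qpoly_root by blast
  have "{act g x | g. True} \<subseteq> {y. qpoly c y = 0}"
    using c by (auto simp flip: act_qpoly)
  then show ?thesis using finite_qpoly_roots[OF c(1)] finite_subset by blast
qed

text \<open>Among the numbers \<open>b + of_nat t * x\<close> it suffices to avoid the finitely many
  \<open>t\<close> equal to a ratio \<open>(b - c) / (d - x)\<close> with conjugates
  \<open>c\<close> of \<open>b\<close> and \<open>d\<close> of \<open>x\<close>. The conclusion
  speaks of stabilizers instead of generated fields.\<close>

lemma primitive_element:
  assumes "finite B" shows "\<exists>x. \<forall>g. act g x = x \<longrightarrow> (\<forall>b\<in>B. act g b = b)"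
  using assms
proof (induction B)
  case (insert b B)
  then obtain x where x: "\<And>g. act g x = x \<Longrightarrow> (\<forall>b\<in>B. act g b = b)" by blast
  let ?C = "{act g b | g. True} \<times> {act g x | g. True}"
  have "finite ((\<lambda>(c, d). (b - c) / (d - x)) ` ?C)"
    using finite_conjugates by blast
  then have "finite ((of_nat :: nat \<Rightarrow> qbar) -` ((\<lambda>(c, d). (b - c) / (d - x)) ` ?C))"
    by (intro finite_vimageI) (auto simp: inj_of_nat)
  from ex_new_if_finite[OF infinite_UNIV_nat this]
  obtain t :: nat where t: "of_nat t \<notin> (\<lambda>(c, d). (b - c) / (d - x)) ` ?C" by blast
  have "\<forall>a\<in>insert b B. act g a = a" if g: "act g (b + of_nat t * x) = b + of_nat t * x" for g
  proof -
    have *: "act g b + of_nat t * act g x = b + of_nat t * x" using g by simp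
    have "act g x = x"
    proof (rule ccontr)
      assume "act g x \<noteq> x"
      moreover have "of_nat t * (act g x - x) = b - act g b" using * by (simp add: algebra_simps)
      ultimately have "of_nat t = (b - act g b) / (act g x - x)" by (simp add: eq_divide_eq)
      moreover have "(act g b, act g x) \<in> ?C" by blast
      ultimately show False using t by (metis (mono_tags, lifting) case_prod_conv image_eqI)
    qed
    then show ?thesis using * x by simp
  qed
  then show ?case by blast
qed auto

text \<open>Graphs of embeddings of subfields of \<open>qbar\<close>.  Closure under inverses is automatic, because
  the inverse of an algebraic number is a rational polynomial in it.\<close>

locale embedding_graph =
  fixes R :: "(qbar \<times> qbar) set"
  assumes rat: "(to_ac q, to_ac q) \<in> R"
    and diff: "(x, x') \<in> R \<Longrightarrow> (y, y') \<in> R \<Longrightarrow> (x - y, x' - y') \<in> R"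
    and mult: "(x, x') \<in> R \<Longrightarrow> (y, y') \<in> R \<Longrightarrow> (x * y, x' * y') \<in> R"
    and zero_unique: "(0, y) \<in> R \<Longrightarrow> y = 0"
begin

lemma zero: "(0, 0) \<in> R" using rat[of 0] by simp
lemma one: "(1, 1) \<in> R" using rat[of 1] by simp

lemma uminus: "(x, x') \<in> R \<Longrightarrow> (- x, - x') \<in> R"
  using diff[OF zero] by fastforce

lemma add: "(x, x') \<in> R \<Longrightarrow> (y, y') \<in> R \<Longrightarrow> (x + y, x' + y') \<in> R"
  using diff[of x x' "- y" "- y'"] uminus by simp

lemma unique: "(x, y) \<in> R \<Longrightarrow> (x, z) \<in> R \<Longrightarrow> y = z"
  using diff[of x y x z] zero_unique[of "y - z"] by simp

lemma qpoly: "(x, x') \<in> R \<Longrightarrow> (qpoly c x, qpoly c x') \<in> R"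
  by (induction c) (auto simp: zero add mult rat)

lemma inverse: assumes "(x, x') \<in> R" shows "(inverse x, inverse x') \<in> R"
proof (cases "x = 0")
  case True
  then show ?thesis using assms zero_unique[of x'] by auto
next
  case False
  then obtain a c where a: "a \<noteq> 0" "qpoly (pCons a c) x = 0" using ex_qpoly_root_nonzero_const by blast
  have "qpoly (pCons a c) x' = 0" using qpoly[OF assms, of "pCons a c"] a(2) zero_unique by metis
  from inverse_from_qpoly(2)[OF a] inverse_from_qpoly(2)[OF a(1) this] show ?thesis
    using qpoly[OF assms, of c] mult[OF uminus[OF rat]] by (metis mult_minus_left)
qed

lemma inj: "(x, 0) \<in> R \<Longrightarrow> x = 0"
  using mult[OF inverse[of x 0], of x 0] zero_unique[of 1] unique[OF one, of 0] by (cases "x = 0") auto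

lemma subfield_Domain: "qbar_subfield (Domain R)"
  by unfold_locales (use one diff mult inverse in blast)+

text \<open>The polynomial \<open>q\<close> arises from \<open>p\<close> by applying the embedding
  to the coefficients; it is a relation because the embedding is given as one.\<close>

definition pgraph :: "qbar poly \<Rightarrow> qbar poly \<Rightarrow> bool" where
  "pgraph p q \<longleftrightarrow> (\<forall>n. (Polynomial.coeff p n, Polynomial.coeff q n) \<in> R)"

lemma pgraph_diff: "pgraph p q \<Longrightarrow> pgraph p' q' \<Longrightarrow> pgraph (p - p') (q - q')"
  by (simp add: pgraph_def diff)

lemma sum: "(\<And>i. i \<in> S \<Longrightarrow> (f i, g i) \<in> R) \<Longrightarrow> (sum f S, sum g S) \<in> R"
  by (induction S rule: infinite_finite_induct) (auto simp: zero add)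

lemma pgraph_mult: "pgraph p q \<Longrightarrow> pgraph p' q' \<Longrightarrow> pgraph (p * p') (q * q')"
  by (simp add: pgraph_def coeff_mult sum mult)

lemma pgraph_monom: "(c, c') \<in> R \<Longrightarrow> pgraph (Polynomial.monom c n) (Polynomial.monom c' n)"
  by (simp add: pgraph_def zero)

lemma pgraph_const: "(c, c') \<in> R \<Longrightarrow> pgraph [:c:] [:c':]"
  using pgraph_monom[of c c' 0] by (simp add: monom_0)

lemma pgraph_exists:
  assumes "\<And>n. Polynomial.coeff p n \<in> Domain R" shows "\<exists>q. pgraph p q"
proof -
  define f where "f x = (THE y. (x, y) \<in> R)" for x
  have f: "(x, f x) \<in> R" if x: "x \<in> Domain R" for x
  proof -
    obtain y where "(x, y) \<in> R" using x by blast
    then show ?thesis unfolding f_def by (rule theI) (rule unique[OF _ \<open>(x, y) \<in> R\<close>])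
  qed
  have "f 0 = 0" using f[of 0] zero zero_unique by blast
  then have "pgraph p (map_poly f p)" using f assms by (simp add: pgraph_def coeff_map_poly)
  then show ?thesis ..
qed

lemma pgraph_degree: "pgraph p q \<Longrightarrow> Polynomial.degree p = Polynomial.degree q"
proof (rule antisym)
  assume *: "pgraph p q"
  show "Polynomial.degree p \<le> Polynomial.degree q"
  proof (intro degree_le allI impI inj)
    fix i assume "Polynomial.degree q < i"
    then show "(Polynomial.coeff p i, 0) \<in> R" using * coeff_eq_0 unfolding pgraph_def by metis
  qed
  show "Polynomial.degree q \<le> Polynomial.degree p"
  proof (intro degree_le allI impI zero_unique)
    fix i assume "Polynomial.degree p < i"
    then show "(0, Polynomial.coeff q i) \<in> R" using * coeff_eq_0 unfolding pgraph_def by metis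
  qed
qed

end

section \<open>Minimal polynomials and the extension of embeddings\<close>

definition poly_over :: "qbar set \<Rightarrow> qbar poly \<Rightarrow> bool" where
  "poly_over F p \<longleftrightarrow> (\<forall>n. Polynomial.coeff p n \<in> F)"

definition min_poly_over :: "qbar set \<Rightarrow> qbar \<Rightarrow> qbar poly \<Rightarrow> bool" where
  "min_poly_over F x m \<longleftrightarrow> poly_over F m \<and> Polynomial.lead_coeff m = 1 \<and> poly m x = 0 \<and>
     (\<forall>p. poly_over F p \<and> p \<noteq> 0 \<and> poly p x = 0 \<longrightarrow> Polynomial.degree m \<le> Polynomial.degree p)"

lemma (in qbar_subfield) ex_min_poly_over: "\<exists>m. min_poly_over F x m"
proof -
  define P where "P p \<longleftrightarrow> poly_over F p \<and> p \<noteq> 0 \<and> poly p x = 0" for p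
  obtain c where c: "c \<noteq> 0" "qpoly c x = 0" using ex_qpoly_root by blast
  have "P (map_poly to_ac c)" using c to_ac_mem
    by (auto simp: P_def poly_over_def coeff_map_poly qpoly_def map_poly_eq_0_iff)
  then obtain m where m: "P m" "\<And>p. P p \<Longrightarrow> Polynomial.degree m \<le> Polynomial.degree p"
    using ex_has_least_nat[of P _ Polynomial.degree] by metis
  define a where "a = inverse (Polynomial.lead_coeff m)"
  have "a \<noteq> 0" "a \<in> F" using m by (auto simp: a_def P_def poly_over_def inverse_mem)
  then have "min_poly_over F x (Polynomial.smult a m)"
    using m unfolding min_poly_over_def P_def poly_over_def by (auto simp: mult_mem a_def)
  then show ?thesis ..
qed

text \<open>Division of \<open>p\<close> by \<open>m\<close> and of \<open>q\<close> by
  \<open>m'\<close> proceeds in parallel, one leading term at a time. By minimality the remainder of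
  \<open>p\<close> is zero, so that of \<open>q\<close> is zero too, and \<open>q\<close> vanishes
  at the root \<open>y\<close> of \<open>m'\<close>. This makes the map from \<open>poly p x\<close>
  to \<open>poly q y\<close> well defined.\<close>

lemma (in embedding_graph) pgraph_root:
  assumes m: "min_poly_over (Domain R) x m" and m': "pgraph m m'" and y: "poly m' y = 0"
    and p: "pgraph p q" "poly p x = 0"
  shows "poly q y = 0"
  using p
proof (induction "Polynomial.degree p" arbitrary: p q rule: less_induct)
  case less
  show ?case
  proof (cases "p = 0")
    case True
    then have "q = 0" using less(2) zero_unique by (auto simp: pgraph_def poly_eq_iff)
    then show ?thesis by simp
  next
    case False
    have "poly_over (Domain R) p" using less(2) unfolding pgraph_def poly_over_def by blast
    then have deg: "Polynomial.degree m \<le> Polynomial.degree p"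
      using m False less(3) unfolding min_poly_over_def by blast
    define n where "n = Polynomial.degree p"
    define k where "k = n - Polynomial.degree m"
    define c c' where "c = Polynomial.coeff p n" and "c' = Polynomial.coeff q n"
    have cc: "(c, c') \<in> R" using less(2) by (simp add: pgraph_def c_def c'_def)
    define p1 where "p1 = p - Polynomial.monom c k * m"
    define q1 where "q1 = q - Polynomial.monom c' k * m'"
    have pq1: "pgraph p1 q1" unfolding p1_def q1_def
      by (intro pgraph_diff less(2) pgraph_mult m' pgraph_monom cc)
    have r1: "poly p1 x = 0" using less(3) m by (simp add: p1_def min_poly_over_def)
    have c0: "c \<noteq> 0" using False by (simp add: c_def n_def)
    have m0: "m \<noteq> 0" "Polynomial.lead_coeff m = 1" using m by (auto simp: min_poly_over_def)
    have degm: "Polynomial.degree (Polynomial.monom c k * m) = n"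
      using c0 m0 deg by (simp add: Polynomial.degree_mult_eq Polynomial.degree_monom_eq k_def n_def)
    have lcm: "Polynomial.coeff (Polynomial.monom c k * m) n = c"
      using Polynomial.lead_coeff_mult[of "Polynomial.monom c k" m] m0 c0 unfolding degm by (simp add: Polynomial.degree_monom_eq)
    have "poly q1 y = 0"
    proof (cases "n = 0")
      \<comment> \<open>A constant cannot drop in degree, so here the difference \<open>p1\<close>
        is shown to be zero directly.\<close>
      case True
      have "p1 = 0"
      proof (rule poly_eqI)
        fix j show "Polynomial.coeff p1 j = Polynomial.coeff 0 j"
        proof (cases "j = 0")
          case True
          then show ?thesis using lcm \<open>n = 0\<close> by (simp add: p1_def c_def)
        next
          case False
          then show ?thesis using \<open>n = 0\<close> degm
            by (simp add: p1_def n_def coeff_eq_0)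
        qed
      qed
      then have "q1 = 0" using pq1 zero_unique by (auto simp: pgraph_def poly_eq_iff)
      then show ?thesis by simp
    next
      case False
      have "Polynomial.degree p1 \<le> n" unfolding p1_def using degm by (intro Polynomial.degree_diff_le) (auto simp: n_def)
      moreover have "Polynomial.coeff p1 n = 0" using lcm by (simp add: p1_def c_def)
      ultimately have "Polynomial.degree p1 < n" using False
        by (metis le_neq_implies_less leading_coeff_0_iff degree_0)
      then show ?thesis using less(1)[OF _ pq1 r1] by (simp add: n_def)
    qed
    then show ?thesis using y by (simp add: q1_def)
  qed
qed

lemma (in embedding_graph) extend:
  assumes m: "min_poly_over (Domain R) x m" and m': "pgraph m m'" and y: "poly m' y = 0"
  shows "\<exists>S. embedding_graph S \<and> R \<subseteq> S \<and> (x, y) \<in> S"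
proof -
  define S where "S = {(poly p x, poly q y) | p q. pgraph p q}"
  have "embedding_graph S"
  proof
    fix q show "(to_ac q, to_ac q) \<in> S"
      unfolding S_def using pgraph_const[OF rat[of q]] by force
  next
    fix a a' b b' assume "(a, a') \<in> S" "(b, b') \<in> S"
    then obtain p q p' q' where "pgraph p q" "a = poly p x" "a' = poly q y" "pgraph p' q'" "b = poly p' x" "b' = poly q' y"
      unfolding S_def by blast
    then have "pgraph (p - p') (q - q')" "a - b = poly (p - p') x" "a' - b' = poly (q - q') y"
       "pgraph (p * p') (q * q')" "a * b = poly (p * p') x" "a' * b' = poly (q * q') y"
      by (auto simp: pgraph_diff pgraph_mult)
    then show "(a - b, a' - b') \<in> S" "(a * b, a' * b') \<in> S" unfolding S_def by blast+
  next
    fix b assume "(0, b) \<in> S"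
    then show "b = 0" unfolding S_def using pgraph_root[OF m m' y] by force
  qed
  moreover have "R \<subseteq> S" unfolding S_def using pgraph_const by force
  moreover have "(x, y) \<in> S"
  proof -
    have "pgraph (Polynomial.monom 1 1) (Polynomial.monom 1 1)" by (intro pgraph_monom one)
    then show ?thesis unfolding S_def by (force simp: poly_monom)
  qed
  ultimately show ?thesis by blast
qed

lemma embedding_graph_Union_chain:
  assumes "C \<noteq> {}" "\<And>R. R \<in> C \<Longrightarrow> embedding_graph R" "\<And>R S. R \<in> C \<Longrightarrow> S \<in> C \<Longrightarrow> R \<subseteq> S \<or> S \<subseteq> R"
  shows "embedding_graph (\<Union>C)"
proof
  show "(to_ac q, to_ac q) \<in> \<Union>C" for q using assms embedding_graph.rat by blast
next
  fix x x' y y' assume "(x, x') \<in> \<Union>C" "(y, y') \<in> \<Union>C"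
  then obtain R where "R \<in> C" "(x, x') \<in> R" "(y, y') \<in> R" using assms(3) by blast
  then show "(x - y, x' - y') \<in> \<Union>C" "(x * y, x' * y') \<in> \<Union>C"
    using assms(2) embedding_graph.diff embedding_graph.mult by blast+
next
  fix y assume "(0, y) \<in> \<Union>C"
  then show "y = 0" using assms(2) embedding_graph.zero_unique by blast
qed

text \<open>A maximal extension, given by Zorn's lemma, is total: any further \<open>x\<close> could
  be sent to a root of the image of its minimal polynomial.\<close>

lemma (in embedding_graph) extend_to_automorphism:
  "\<exists>g. \<forall>(x, y) \<in> R. act g x = y"
proof -
  let ?S = "{S. embedding_graph S \<and> R \<subseteq> S}"
  have "\<exists>M\<in>?S. \<forall>S\<in>?S. M \<subseteq> S \<longrightarrow> S = M"
  proof (rule subset_Zorn_nonempty)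
    show "?S \<noteq> {}" using embedding_graph_axioms by blast
    show "\<Union>C \<in> ?S" if "C \<noteq> {}" "subset.chain ?S C" for C
    proof -
      have "embedding_graph (\<Union>C)"
        using that by (intro embedding_graph_Union_chain) (auto simp: subset_chain_def)
      moreover have "R \<subseteq> \<Union>C" using that unfolding subset_chain_def by blast
      ultimately show ?thesis by simp
    qed
  qed
  then obtain M where "M \<in> ?S" and max': "\<forall>S\<in>?S. M \<subseteq> S \<longrightarrow> S = M" ..
  then have M: "embedding_graph M" "R \<subseteq> M" by simp_all
  have max: "S = M" if "embedding_graph S" "M \<subseteq> S" for S
  proof -
    have "S \<in> ?S" using that M(2) by auto
    from bspec[OF max' this] that(2) show ?thesis by simp
  qed
  interpret M: embedding_graph M by fact
  have total: "\<exists>y. (x, y) \<in> M" for x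
  proof -
    obtain m where m: "min_poly_over (Domain M) x m"
      using qbar_subfield.ex_min_poly_over[OF M.subfield_Domain] by blast
    obtain m' where m': "M.pgraph m m'" using M.pgraph_exists[of m] m
      by (auto simp: min_poly_over_def poly_over_def)
    have "Polynomial.degree m \<noteq> 0"
    proof
      assume "Polynomial.degree m = 0"
      then obtain c where "m = [:c:]" by (rule degree_eq_zeroE)
      then show False using m by (auto simp: min_poly_over_def)
    qed
    then obtain y where "poly m' y = 0"
      using alg_closed_imp_poly_has_root[of m'] M.pgraph_degree[OF m'] by auto
    then obtain S where "embedding_graph S" "M \<subseteq> S" "(x, y) \<in> S" using M.extend[OF m m'] by blast
    with max[of S] show ?thesis by blast
  qed
  then obtain f where f: "\<And>x. (x, f x) \<in> M" by metis
  have fI: "f x = y" if "(x, y) \<in> M" for x y using M.unique f that by blast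
  have hom: "f (x + y) = f x + f y" "f (x * y) = f x * f y" "f (to_ac q) = to_ac q" for x y q
    by (intro fI M.add M.mult M.rat f)+
  have inj: "inj f"
  proof (rule injI)
    fix x y assume "f x = f y"
    then have "(x - y, 0) \<in> M" using M.diff[OF f[of x] f[of y]] by simp
    then show "x = y" using M.inj by fastforce
  qed
  \<comment> \<open>An injective map respecting rational polynomials permutes the finitely many
    roots of each of them.\<close>
  have onto: "\<exists>x. y = f x" for y
  proof -
    obtain c where c: "c \<noteq> 0" "qpoly c y = 0" using ex_qpoly_root by blast
    have "f ` {x. qpoly c x = 0} \<subseteq> {x. qpoly c x = 0}"
      using M.qpoly[OF f] M.zero_unique by (metis (mono_tags, lifting) image_subsetI mem_Collect_eq)
    then have "f ` {x. qpoly c x = 0} = {x. qpoly c x = 0}"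
      using finite_qpoly_roots[OF c(1)] inj by (meson endo_inj_surj inj_on_subset subset_UNIV)
    then show ?thesis using c by blast
  qed
  have "surj f" unfolding surj_def using onto by blast
  then have "act (Gal f) = f" using inj hom by (intro Gal_inverse) (auto simp: bij_def)
  then show ?thesis using fI M(2) by (intro exI[of _ "Gal f"]) auto
qed

text \<open>The minimal polynomial of \<open>y\<close> over \<open>F\<close> is not linear and, in
  characteristic 0, separable. So it has a root other than \<open>y\<close>, and the embedding over
  \<open>F\<close> sending \<open>y\<close> to that root extends to an automorphism.\<close>

lemma (in qbar_subfield) not_fixed_outside:
  assumes y: "y \<notin> F"
  shows "\<exists>g. (\<forall>x\<in>F. act g x = x) \<and> act g y \<noteq> y"
proof -
  interpret R: embedding_graph "Id_on F"
    by standard (auto simp: mems to_ac_mem)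
  obtain m where m: "min_poly_over F y m" using ex_min_poly_over by blast
  have pg: "R.pgraph m m" using m by (auto simp: R.pgraph_def min_poly_over_def poly_over_def)
  have lc: "Polynomial.lead_coeff m = 1" "poly m y = 0" "poly_over F m" using m by (auto simp: min_poly_over_def)
  obtain q where q: "m = [:- y, 1:] * q" using lc by (auto simp: poly_eq_0_iff_dvd)
  have q0: "q \<noteq> 0" using lc q by auto
  have dm: "Polynomial.degree m = Suc (Polynomial.degree q)" using q0 unfolding q by (subst Polynomial.degree_mult_eq) auto
  have "Polynomial.degree q \<noteq> 0"
  proof
    assume "Polynomial.degree q = 0"
    then obtain c where c: "q = [:c:]" by (rule degree_eq_zeroE)
    then have "c = 1" "c \<noteq> 0" using lc(1) q by (auto split: if_splits)
    then have "Polynomial.coeff m 0 = - y" by (simp add: q c)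
    then have "- y \<in> F" using lc(3) by (metis poly_over_def)
    then show False using y uminus_mem by fastforce
  qed
  then obtain z where z: "poly q z = 0" using alg_closed_imp_poly_has_root[of q] by auto
  \<comment> \<open>A double root would be a root of the derivative, whose degree is smaller than
    that of the minimal polynomial.\<close>
  have "z \<noteq> y"
  proof
    assume "z = y"
    have "poly (pderiv m) y = 0" using z \<open>z = y\<close> unfolding q pderiv_mult by simp
    moreover have "poly_over F (pderiv m)"
      using lc(3) by (auto simp: poly_over_def coeff_pderiv simp del: of_nat_Suc intro!: mult_mem of_nat_mem)
    moreover have "pderiv m \<noteq> 0" using dm by (simp add: pderiv_eq_0_iff)
    ultimately have "Polynomial.degree m \<le> Polynomial.degree (pderiv m)" using m unfolding min_poly_over_def by blast
    then show False using dm by (simp add: degree_pderiv)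
  qed
  have "poly m z = 0" using z q by simp
  then obtain S where S: "embedding_graph S" "Id_on F \<subseteq> S" "(y, z) \<in> S"
    using R.extend[of y m m z] pg m by auto
  obtain g where "\<forall>(x, y) \<in> S. act g x = y" using embedding_graph.extend_to_automorphism[OF S(1)] by blast
  then have g: "act g a = b" if "(a, b) \<in> S" for a b using that by auto
  have "act g x = x" if "x \<in> F" for x using g[of x x] S(2) that by blast
  moreover have "act g y = z" using g S(3) .
  ultimately show ?thesis using \<open>z \<noteq> y\<close> by blast
qed

section \<open>The Krull topology\<close>

text \<open>Polynomial expressions in \<open>x\<close> form a field because inverses are again
  polynomial expressions. Reduction modulo an annihilating polynomial bounds the powers of
  \<open>x\<close> in a spanning set.\<close>

lemma finite_subextension_qpoly: "finite_subextension (range (\<lambda>c. qpoly c x))"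
  unfolding finite_subextension_def
proof (intro conjI ballI)
  show "range to_ac \<subseteq> range (\<lambda>c. qpoly c x)"
  proof
    fix y assume "y \<in> range (to_ac :: rat \<Rightarrow> qbar)"
    then obtain q where "y = to_ac q" by blast
    then have "y = qpoly [:q:] x" by simp
    then show "y \<in> range (\<lambda>c. qpoly c x)" by blast
  qed
next
  fix y z assume "y \<in> range (\<lambda>c. qpoly c x)" "z \<in> range (\<lambda>c. qpoly c x)"
  then obtain c d where "y = qpoly c x" "z = qpoly d x" by blast
  then have "y - z = qpoly (c - d) x" "y * z = qpoly (c * d) x" by (simp_all add: qpoly_diff qpoly_mult)
  then show "y - z \<in> range (\<lambda>c. qpoly c x)" "y * z \<in> range (\<lambda>c. qpoly c x)" by blast+
next
  fix y assume "y \<in> range (\<lambda>c. qpoly c x)"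
  show "inverse y \<in> range (\<lambda>c. qpoly c x)"
  proof (cases "y = 0")
    case True
    then have "inverse y = qpoly 0 x" by simp
    then show ?thesis by blast
  next
    case False
    then obtain a c where a: "a \<noteq> 0" "qpoly (pCons a c) y = 0" using ex_qpoly_root_nonzero_const by blast
    obtain e where e: "y = qpoly e x" using \<open>y \<in> _\<close> by blast
    have comp: "\<exists>d'. qpoly d y = qpoly d' x" for d
    proof (induction d)
      case 0
      then show ?case by (intro exI[of _ 0]) simp
    next
      case (pCons b d)
      then obtain d' where "qpoly d y = qpoly d' x" by blast
      then show ?case by (intro exI[of _ "[:b:] + e * d'"]) (simp only: qpoly_add qpoly_mult qpoly_pCons e qpoly_0, simp)
    qed
    then obtain d where "qpoly c y = qpoly d x" by blast
    then have "inverse y = qpoly (0 - Polynomial.smult (inverse a) d) x"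
      using inverse_from_qpoly(2)[OF a] by (simp only: qpoly_diff qpoly_smult) simp
    then show ?thesis by blast
  qed
next
  interpret V: vector_space "\<lambda>q (y::qbar). to_ac q * y"
    by standard (auto simp: algebra_simps)
  obtain d where d: "d \<noteq> 0" "qpoly d x = 0" using ex_qpoly_root by blast
  let ?B = "(\<lambda>i. x ^ i) ` {..<Polynomial.degree d}"
  have low: "qpoly c x \<in> V.span ((\<lambda>i. x ^ i) ` {..<n})" if "c = 0 \<or> Polynomial.degree c < n" for c n
    using that
  proof (induction c arbitrary: n)
    case 0
    then show ?case by (simp add: V.span_zero)
  next
    case (pCons a c)
    from pCons.hyps pCons.prems obtain m where m: "n = Suc m" "c = 0 \<or> Polynomial.degree c < m"
      by (cases n) (auto split: if_splits)
    have 1: "to_ac a * 1 \<in> V.span ((\<lambda>i. x ^ i) ` {..<n})"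
      by (intro V.span_scale V.span_base image_eqI[of _ _ 0]) (auto simp: m)
    have "x * y \<in> V.span ((\<lambda>i. x ^ i) ` {..<n})" if "y \<in> V.span ((\<lambda>i. x ^ i) ` {..<m})" for y
      using that
    proof (induction y rule: V.span_induct_alt)
      case base
      show ?case by (simp add: V.span_zero)
    next
      case (step q z y)
      then obtain i where i: "i < m" "z = x ^ i" by blast
      have "x * z \<in> V.span ((\<lambda>i. x ^ i) ` {..<n})"
        by (intro V.span_base image_eqI[of _ _ "Suc i"]) (auto simp: i m)
      then have "to_ac q * (x * z) + x * y \<in> V.span ((\<lambda>i. x ^ i) ` {..<n})"
        using step by (intro V.span_add V.span_scale) auto
      then show ?case by (simp add: algebra_simps)
    qed
    then show ?case using pCons.IH[OF m(2)] 1 V.span_add by fastforce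
  qed
  have "range (\<lambda>c. qpoly c x) \<subseteq> V.span ?B"
  proof
    fix y assume "y \<in> range (\<lambda>c. qpoly c x)"
    then obtain c where c: "y = qpoly c x" by blast
    have "c = (c div d) * d + c mod d" by simp
    then have "qpoly c x = qpoly (c mod d) x" using d(2) by (metis qpoly_add qpoly_mult mult_zero_right add_0)
    moreover have "c mod d = 0 \<or> Polynomial.degree (c mod d) < Polynomial.degree d"
      using degree_mod_less[OF d(1)] by blast
    ultimately show "y \<in> V.span ?B" using low c by simp
  qed
  then show "\<exists>B. finite B \<and> range (\<lambda>c. qpoly c x) \<subseteq> V.span B" by blast
qed

lemma open_coset:
  assumes "finite_subextension E"
  shows "open ((\<lambda>\<tau>. \<sigma> * \<tau>) ` fixing_subgroup E)"
  unfolding open_gal_Q_def using assms by (intro generate_topology.Basis) blast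

text \<open>This set is the left coset by \<open>g\<close> of the subgroup fixing the finite
  extension generated by \<open>x\<close>.\<close>

lemma open_act_eq: "open {h. act h x = act g x}"
proof -
  have "{h. act h x = act g x} = (\<lambda>\<tau>. g * \<tau>) ` fixing_subgroup (range (\<lambda>c. qpoly c x))" (is "?L = ?R")
  proof
    show "?R \<subseteq> ?L"
    proof -
      have "x = qpoly [:0, 1:] x" by simp
      then have "x \<in> range (\<lambda>c. qpoly c x)" by blast
      then have "act \<tau> x = x" if "\<tau> \<in> fixing_subgroup (range (\<lambda>c. qpoly c x))" for \<tau>
        using that unfolding fixing_subgroup_def by blast
      then show ?thesis by auto
    qed
    show "?L \<subseteq> ?R"
    proof
      fix h assume "h \<in> ?L"
      then have h: "act h x = act g x" by simp
      obtain g' where g': "g' * g = 1" "g * g' = 1" using gal_Q_has_inverse by blast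
      have "act g' (act h x) = x" using g' h by (metis act_one act_times)
      then have "g' * h \<in> fixing_subgroup (range (\<lambda>c. qpoly c x))"
        by (auto simp: fixing_subgroup_def act_qpoly)
      moreover have "h = g * (g' * h)" using g' by (simp flip: mult.assoc)
      ultimately show "h \<in> ?R" by blast
    qed
  qed
  then show ?thesis using open_coset finite_subextension_qpoly by metis
qed

section \<open>Continuity in terms of finitely many algebraic numbers\<close>

lemma cochainsI_gal:
  fixes f :: "gal_Q \<Rightarrow> 'r"
  assumes "finite B" "\<And>g h. (\<And>b. b \<in> B \<Longrightarrow> act h b = act g b) \<Longrightarrow> f h = f g"
  shows "f \<in> cochains"
proof -
  have "open {g. f g \<in> U}" for U
  proof -
    have "{g. f g \<in> U} = (\<Union>g\<in>{g. f g \<in> U}. \<Inter>b\<in>B. {h. act h b = act g b})" (is "?L = ?R")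
    proof
      show "?R \<subseteq> ?L"
      proof
        fix h assume "h \<in> ?R"
        then obtain g where g: "f g \<in> U" "\<And>b. b \<in> B \<Longrightarrow> act h b = act g b" by blast
        then have "f h = f g" using assms(2) by blast
        then show "h \<in> ?L" using g by simp
      qed
    qed auto
    moreover have "open ?R" using assms(1) open_act_eq by (intro open_UN ballI open_INT) auto
    ultimately show ?thesis by simp
  qed
  then show ?thesis by (simp add: cochains_def continuous_map_def)
qed

text \<open>By induction on the generated topology: for a coset of the subgroup fixing
  \<open>E\<close>, a finite set whose span contains \<open>E\<close> serves as
  \<open>B\<close>.\<close>

lemma open_gal_finite:
  assumes "open U" "g \<in> U"
  shows "\<exists>B. finite B \<and> (\<forall>h. (\<forall>b\<in>B. act h b = act g b) \<longrightarrow> h \<in> U)"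
proof -
  have "generate_topology {(\<lambda>\<tau>. \<sigma> * \<tau>) ` fixing_subgroup E | \<sigma> E. finite_subextension E} U"
    using assms(1) by (simp add: open_gal_Q_def)
  then show ?thesis using assms(2)
  proof (induction U rule: generate_topology.induct)
    case UNIV
    then show ?case by auto
  next
    case (Int a b)
    then obtain A B where "finite A" "\<forall>h. (\<forall>b\<in>A. act h b = act g b) \<longrightarrow> h \<in> a"
      "finite B" "\<forall>h. (\<forall>b\<in>B. act h b = act g b) \<longrightarrow> h \<in> b" by auto
    then show ?case by (intro exI[of _ "A \<union> B"]) auto
  next
    case (UN K)
    then obtain k where k: "k \<in> K" "g \<in> k" by blast
    then show ?case using UN.IH[OF k] by blast
  next
    case (Basis s)
    then obtain \<sigma> E where s: "s = (\<lambda>\<tau>. \<sigma> * \<tau>) ` fixing_subgroup E" and E: "finite_subextension E" by blast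
    interpret V: vector_space "\<lambda>q (y::qbar). to_ac q * y"
      by standard (auto simp: algebra_simps)
    obtain B where B: "finite B" "E \<subseteq> V.span B" using E unfolding finite_subextension_def by blast
    obtain \<tau> where \<tau>: "\<tau> \<in> fixing_subgroup E" "g = \<sigma> * \<tau>" using Basis s by blast
    obtain \<sigma>' where \<sigma>': "\<sigma>' * \<sigma> = 1" "\<sigma> * \<sigma>' = 1" using gal_Q_has_inverse by blast
    have "h \<in> s" if h: "\<forall>b\<in>B. act h b = act g b" for h
    proof -
      have "act h y = act g y" if "y \<in> V.span B" for y
        using that by (induction y rule: V.span_induct_alt) (auto simp: h)
      then have hE: "act h y = act g y" if "y \<in> E" for y using B that by blast
      have "\<sigma>' * h \<in> fixing_subgroup E"
      proof -
        have "act (\<sigma>' * h) y = y" if "y \<in> E" for y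
        proof -
          have "act (\<sigma>' * h) y = act \<sigma>' (act g y)" using hE[OF that] by simp
          also have "\<dots> = act ((\<sigma>' * \<sigma>) * \<tau>) y" by (simp add: \<tau> mult.assoc del: act_times) (simp add: mult.assoc)
          also have "\<dots> = y" using \<tau> that by (simp add: \<sigma>' fixing_subgroup_def del: act_times)
          finally show ?thesis .
        qed
        then show ?thesis by (simp add: fixing_subgroup_def)
      qed
      moreover have "h = \<sigma> * (\<sigma>' * h)" using \<sigma>' by (simp flip: mult.assoc)
      ultimately show ?thesis unfolding s by blast
    qed
    then show ?case using B by blast
  qed
qed

lemma cochains_finite:
  assumes "f \<in> (cochains :: (gal_Q \<Rightarrow> 'r) set)"
  shows "\<exists>B. finite B \<and> (\<forall>h. (\<forall>b\<in>B. act h b = b) \<longrightarrow> f h = f 1)"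
proof -
  have "open {g. f g \<in> {f 1}}"
    using assms spec[of "\<lambda>U. open {g. f g \<in> U}" "{f 1}"] unfolding cochains_def continuous_map_def by simp
  from open_gal_finite[OF this, of 1] show ?thesis by auto
qed

lemma infinite_range_to_ac: "infinite (range (to_ac :: rat \<Rightarrow> qbar))"
  using inj_to_ac infinite_UNIV_char_0 finite_imageD by blast

section \<open>Homomorphisms on the Galois group of a quadratically closed field\<close>

context qbar_subfield
begin

lemma mem_if_fixed: "(\<And>g. g \<in> fixing_subgroup F \<Longrightarrow> act g y = y) \<Longrightarrow> y \<in> F"
  using not_fixed_outside[of y] by (auto simp: fixing_subgroup_def)

text \<open>A nontrivial \<open>\<psi>\<close> would have a kernel of index 2, with a quadratic
  extension of \<open>F\<close> as fixed field, but \<open>F\<close> has none. Continuity supplies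
  an algebraic number \<open>x\<close> whose stabilizer over \<open>F\<close> lies in the kernel,
  and the argument runs over the orbit of \<open>x\<close>.\<close>

lemma order_2_hom_trivial:
  fixes \<psi> :: "gal_Q \<Rightarrow> 'r::comm_ring_1"
  assumes sqrt: "\<And>d. d \<in> F \<Longrightarrow> \<exists>s\<in>F. s\<^sup>2 = d"
    and cont: "finite B" "\<And>h. h \<in> fixing_subgroup F \<Longrightarrow> (\<forall>b\<in>B. act h b = b) \<Longrightarrow> \<psi> h = 0"
    and hom: "\<And>g h. g \<in> fixing_subgroup F \<Longrightarrow> h \<in> fixing_subgroup F \<Longrightarrow> \<psi> (g * h) = \<psi> g + \<psi> h"
    and v: "v + v = 0" "\<And>g. g \<in> fixing_subgroup F \<Longrightarrow> \<psi> g = 0 \<or> \<psi> g = v"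
    and g: "g \<in> fixing_subgroup F"
  shows "\<psi> g = 0"
proof (rule ccontr)
  assume "\<psi> g \<noteq> 0"
  then have gv: "\<psi> g = v" using v g by blast
  define G where "G = fixing_subgroup F"
  have one: "1 \<in> G" by (simp add: G_def fixing_subgroup_def)
  have times: "a * b \<in> G" if "a \<in> G" "b \<in> G" for a b using that by (simp add: G_def fixing_subgroup_def)
  have hom: "\<psi> (a * b) = \<psi> a + \<psi> b" if "a \<in> G" "b \<in> G" for a b using hom that by (simp add: G_def)
  have gG: "g \<in> G" using g by (simp add: G_def)
  obtain g' where g': "g' * g = 1" "g * g' = 1" using gal_Q_has_inverse by blast
  have g'G: "g' \<in> G" unfolding G_def fixing_subgroup_def
  proof (intro CollectI ballI)
    fix x assume "x \<in> F"
    then have "act g x = x" using g by (simp add: fixing_subgroup_def)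
    then show "act g' x = x" using g' by (metis act_one act_times)
  qed
  have \<psi>1: "\<psi> 1 = 0" using hom[OF one one] by simp
  have "\<psi> g' + v = 0" using hom[OF g'G gG] g' gv \<psi>1 by simp
  then have g'v: "\<psi> g' = v" using v(1) by (metis add_right_cancel)
  define H where "H = {h \<in> G. \<psi> h = 0}"
  \<comment> \<open>An element fixed by the kernel \<open>H\<close> but moved by \<open>g\<close>
    would yield a nonzero \<open>z\<close> negated by \<open>g\<close>. Its square is fixed by the
    whole group and lies in \<open>F\<close>, so \<open>z\<close> lies in \<open>F\<close> too, a
    contradiction.\<close>
  have key: "act g y = y" if y: "\<And>h. h \<in> H \<Longrightarrow> act h y = y" for y
  proof -
    define z where "z = y - act g y"
    have hz: "act h z = z" if "h \<in> H" for h
    proof -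
      have "g' * (h * g) \<in> H" using that gG g'G times hom gv g'v v(1) by (simp add: H_def)
      then have "act g' (act h (act g y)) = y" using y by fastforce
      then have "act h (act g y) = act g y" using g' by (metis act_one act_times)
      then show ?thesis using y[OF that] by (simp add: z_def)
    qed
    have "g * g \<in> H" using gG times hom gv v(1) by (simp add: H_def)
    then have "act g (act g y) = y" using y by fastforce
    then have gz: "act g z = - z" by (simp add: z_def)
    have "z\<^sup>2 \<in> F"
    proof (rule mem_if_fixed)
      fix k assume "k \<in> fixing_subgroup F"
      then have kG: "k \<in> G" by (simp add: G_def)
      show "act k (z\<^sup>2) = z\<^sup>2"
      proof (cases "\<psi> k = 0")
        case True
        then show ?thesis using hz kG by (simp add: H_def)
      next
        case False
        then have "\<psi> k = v" using v kG by (auto simp: G_def)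
        \<comment> \<open>The element \<open>k\<close> lies in the same coset of \<open>H\<close> as
          \<open>g\<close>, so it negates \<open>z\<close> as well.\<close>
        then have "k * g' \<in> H" using kG g'G times hom g'v v(1) by (simp add: H_def)
        then have "act (k * g') (act g z) = act g z" using hz by (simp add: gz del: act_times)
        moreover have "act (k * g') (act g z) = act k z" using g' by (metis act_one act_times)
        ultimately have "act k z = - z" using gz by metis
        then show ?thesis by simp
      qed
    qed
    then obtain s where s: "s \<in> F" "s\<^sup>2 = z\<^sup>2" using sqrt by blast
    then have "z = s \<or> z = - s" by (metis power2_eq_iff)
    then have "z \<in> F" using s uminus_mem by blast
    then have "act g z = z" using g by (simp add: fixing_subgroup_def)
    then have "z = 0" using gz by simp
    then show ?thesis by (simp add: z_def)
  qed
  obtain x where x: "\<And>h. act h x = x \<Longrightarrow> (\<forall>b\<in>B. act h b = b)" using primitive_element[OF cont(1)] by blast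
  \<comment> \<open>The orbits \<open>H x\<close> and \<open>g H x\<close> are disjoint, yet \<open>key\<close> applied to the values at rational points of
     the polynomial with root set \<open>H x\<close> shows that they have the same polynomial.\<close>
  define S where "S = (\<lambda>h. act h x) ` H"
  have "S \<subseteq> {act g x | g. True}" by (auto simp: S_def)
  then have finS: "finite S" using finite_conjugates finite_subset by blast
  have act_prod: "act k (\<Prod>z\<in>S. t - z) = (\<Prod>z\<in>act k ` S. t - z)" if "act k t = t" for k t
  proof -
    have "act k (\<Prod>z\<in>T. t - z) = (\<Prod>z\<in>T. t - act k z)" for T
      by (induction T rule: infinite_finite_induct) (auto simp: that)
    moreover have "(\<Prod>z\<in>act k ` S. t - z) = (\<Prod>z\<in>S. t - act k z)"
      by (subst prod.reindex) (auto simp: inj_on_def)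
    ultimately show ?thesis by simp
  qed
  have HS: "act h ` S = S" if "h \<in> H" for h
  proof (rule endo_inj_surj[OF finS])
    show "act h ` S \<subseteq> S"
    proof
      fix z assume "z \<in> act h ` S"
      then obtain k where k: "k \<in> H" "z = act (h * k) x" by (auto simp: S_def)
      moreover have "h * k \<in> H" using that k times hom by (simp add: H_def)
      ultimately show "z \<in> S" unfolding S_def by blast
    qed
  qed (auto simp: inj_on_def)
  define P where "P T = (\<Prod>z\<in>T. [:- z, 1:])" for T :: "qbar set"
  have P: "poly (P T) t = (\<Prod>z\<in>T. t - z)" for T t by (simp add: P_def poly_prod)
  have "poly (P S) (to_ac q) = poly (P (act g ` S)) (to_ac q)" for q
  proof -
    have "act h (\<Prod>z\<in>S. to_ac q - z) = (\<Prod>z\<in>S. to_ac q - z)" if "h \<in> H" for h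
      using act_prod[of h "to_ac q"] HS[OF that] by simp
    from key[OF this] act_prod[of g "to_ac q"] show ?thesis by (simp add: P)
  qed
  then have "range to_ac \<subseteq> {t. poly (P S - P (act g ` S)) t = 0}" by auto
  then have "P S - P (act g ` S) = 0"
    using poly_roots_finite infinite_range_to_ac finite_subset by metis
  then have eq: "P S = P (act g ` S)" by simp
  have "x \<in> S" using one \<psi>1 by (auto simp: S_def H_def intro!: image_eqI[of _ _ 1])
  then have "poly (P S) x = 0" using finS by (auto simp: P prod_zero_iff)
  then have "x \<in> act g ` S" using finS unfolding eq P by (auto simp: prod_zero_iff)
  then obtain h where h: "h \<in> H" "act (g * h) x = x" by (auto simp: S_def)
  then have "\<psi> (g * h) = 0" using x[of "g * h"] cont(2) times gG by (auto simp: H_def G_def)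
  then show False using h hom gG \<open>\<psi> g \<noteq> 0\<close> by (simp add: H_def)
qed

end

section \<open>A tower with tame Galois group\<close>

lemma Z8_cases: "(x :: Z8) \<in> {0, 1, 2, 3, 4, 5, 6, 7}"
proof (cases x)
  case (of_int k)
  then have "k \<in> {0, 1, 2, 3, 4, 5, 6, 7}" by auto
  then show ?thesis using of_int(1) by auto
qed

lemma Z8_double_eq_0: "x + x = 0 \<Longrightarrow> x = 0 \<or> x = (4 :: Z8)"
  using Z8_cases[of x] by auto

text \<open>The case of order 2 is applied to \<open>4 * \<theta>\<close>, then to
  \<open>2 * \<theta>\<close>, then to \<open>\<theta>\<close>: once \<open>2 * k * \<theta>\<close>
  vanishes on the group, \<open>k * \<theta>\<close> takes only the values 0 and 4 there.\<close>

lemma (in qbar_subfield) Z8_hom_trivial: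
  fixes \<theta> :: "gal_Q \<Rightarrow> Z8"
  assumes sqrt: "\<And>d. d \<in> F \<Longrightarrow> \<exists>s\<in>F. s\<^sup>2 = d"
    and cont: "\<theta> \<in> cochains"
    and hom: "\<And>g h. g \<in> fixing_subgroup F \<Longrightarrow> h \<in> fixing_subgroup F \<Longrightarrow> \<theta> (g * h) = \<theta> g + \<theta> h"
    and g: "g \<in> fixing_subgroup F"
  shows "\<theta> g = 0"
proof -
  have "1 \<in> fixing_subgroup F" by (simp add: fixing_subgroup_def)
  then have "\<theta> 1 = 0" using hom[of 1 1] by simp
  then obtain B where B: "finite B" "\<And>h. (\<forall>b\<in>B. act h b = b) \<Longrightarrow> \<theta> h = 0"
    using cochains_finite[OF cont] by auto
  have halve: "k * \<theta> h = 0"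
    if two: "\<And>h. h \<in> fixing_subgroup F \<Longrightarrow> 2 * k * \<theta> h = 0" and h: "h \<in> fixing_subgroup F" for k h
  proof (rule order_2_hom_trivial[where \<psi> = "\<lambda>h. k * \<theta> h" and v = 4 and B = B])
    fix g assume "g \<in> fixing_subgroup F"
    then have "k * \<theta> g + k * \<theta> g = 0" using two[of g] by (simp only: mult_2 distrib_right)
    then show "k * \<theta> g = 0 \<or> k * \<theta> g = 4" by (rule Z8_double_eq_0)
  next
    fix g assume "\<forall>b\<in>B. act g b = b"
    then show "k * \<theta> g = 0" using B(2)[of g] by simp
  next
    fix g h assume "g \<in> fixing_subgroup F" "h \<in> fixing_subgroup F"
    then show "k * \<theta> (g * h) = k * \<theta> g + k * \<theta> h" by (simp add: hom distrib_left)
  next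
    show "(4 :: Z8) + 4 = 0" by simp
  qed (fact sqrt B(1) h)+
  have e8: "(8 :: Z8) = 0" by simp
  have "4 * \<theta> h = 0" if "h \<in> fixing_subgroup F" for h
    by (rule halve[OF _ that]) (simp add: e8)
  then have "2 * \<theta> h = 0" if "h \<in> fixing_subgroup F" for h
    by (intro halve[OF _ that]) simp
  then have "1 * \<theta> g = 0" by (intro halve[OF _ g]) simp
  then show ?thesis by simp
qed

text \<open>The ring of pairs generated by \<open>S\<close> and the diagonal rationals. When it is
  an embedding graph, it is the smallest one with the images that \<open>S\<close> prescribes for
  the generators.\<close>

inductive_set ring_gen :: "(qbar \<times> qbar) set \<Rightarrow> (qbar \<times> qbar) set" for S where
  rat: "(to_ac q, to_ac q) \<in> ring_gen S"
| base: "s \<in> S \<Longrightarrow> s \<in> ring_gen S"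
| diff: "(x, x') \<in> ring_gen S \<Longrightarrow> (y, y') \<in> ring_gen S \<Longrightarrow> (x - y, x' - y') \<in> ring_gen S"
| mult: "(x, x') \<in> ring_gen S \<Longrightarrow> (y, y') \<in> ring_gen S \<Longrightarrow> (x * y, x' * y') \<in> ring_gen S"

lemma ring_gen_subset_graph:
  assumes "embedding_graph R" "S \<subseteq> R" shows "ring_gen S \<subseteq> R"
proof
  interpret embedding_graph R by fact
  show "s \<in> R" if "s \<in> ring_gen S" for s
    using that by induction (use assms rat diff mult in auto)
qed

lemma ring_gen_subset: "S \<subseteq> ring_gen T \<Longrightarrow> ring_gen S \<subseteq> ring_gen T"
proof
  show "s \<in> ring_gen T" if "S \<subseteq> ring_gen T" "s \<in> ring_gen S" for s
    using that(2) by induction (use that(1) in \<open>auto intro: ring_gen.intros\<close>)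
qed

lemma embedding_graph_ring_gen:
  assumes "embedding_graph R" "ring_gen S \<subseteq> R" shows "embedding_graph (ring_gen S)"
  using assms by unfold_locales (auto intro: ring_gen.intros dest: embedding_graph.zero_unique)

lemma Domain_ring_gen:
  assumes "qbar_subfield F" "Domain S \<subseteq> F" shows "Domain (ring_gen S) \<subseteq> F"
proof
  interpret qbar_subfield F by fact
  have "fst s \<in> F" if "s \<in> ring_gen S" for s
    using that by induction (use assms(2) in \<open>auto simp: to_ac_mem mems\<close>)
  then show "x \<in> F" if "x \<in> Domain (ring_gen S)" for x using that by fastforce
qed

lemma (in qbar_subfield) min_poly_over_sqrt:
  assumes "s \<notin> F" "s\<^sup>2 \<in> F"
  shows "min_poly_over F s [:- s\<^sup>2, 0, 1:]"
  unfolding min_poly_over_def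
proof (intro conjI allI impI)
  show "poly_over F [:- s\<^sup>2, 0, 1:]"
    using assms by (auto simp: poly_over_def coeff_pCons mems split: nat.splits)
  show "poly [:- s\<^sup>2, 0, 1:] s = 0" by (simp add: power2_eq_square)
next
  fix p assume p: "poly_over F p \<and> p \<noteq> 0 \<and> poly p s = 0"
  show "Polynomial.degree [:- s\<^sup>2, 0, 1:] \<le> Polynomial.degree p"
  proof (rule ccontr)
    assume "\<not> ?thesis"
    then have deg: "Polynomial.degree p \<le> 1" by simp
    define a b where "a = Polynomial.coeff p 1" and "b = Polynomial.coeff p 0"
    have ab: "p = [:b, a:]"
      using deg by (intro poly_eqI) (auto simp: a_def b_def coeff_pCons coeff_eq_0 split: nat.splits)
    have "a \<in> F" "b \<in> F" using p by (auto simp: a_def b_def poly_over_def)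
    moreover have e: "b + s * a = 0" using p ab by simp
    moreover have "a \<noteq> 0" using p ab e by auto
    moreover have "s = - b / a" using e \<open>a \<noteq> 0\<close> by (simp add: field_simps add_eq_0_iff)
    ultimately show False using assms by (metis divide_mem uminus_mem)
  qed
qed auto

text \<open>The minimal polynomial of \<open>s\<close> over the domain is quadratic, and
  \<open>t\<close> is a root of its image. The field \<open>F\<close>, which may be larger than the
  domain, certifies that \<open>s\<close> is new.\<close>

lemma embedding_graph_adjoin_sqrt:
  assumes R: "embedding_graph (ring_gen S)" and F: "qbar_subfield F" "Domain S \<subseteq> F" "s \<notin> F"
    and st: "(s\<^sup>2, t\<^sup>2) \<in> ring_gen S"
  shows "embedding_graph (ring_gen (insert (s, t) S))"
proof -
  interpret embedding_graph "ring_gen S" by fact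
  interpret D: qbar_subfield "Domain (ring_gen S)" by (rule subfield_Domain)
  have sD: "s \<notin> Domain (ring_gen S)" using Domain_ring_gen[OF F(1,2)] F(3) by blast
  have "pgraph [:- s\<^sup>2, 0, 1:] [:- t\<^sup>2, 0, 1:]"
    using uminus[OF st] zero one by (auto simp: pgraph_def coeff_pCons split: nat.splits)
  moreover have "poly [:- t\<^sup>2, 0, 1:] t = 0" by (simp add: power2_eq_square)
  ultimately obtain R where R: "embedding_graph R" "ring_gen S \<subseteq> R" "(s, t) \<in> R"
    using extend[OF D.min_poly_over_sqrt[OF sD]] st by blast
  then have "insert (s, t) S \<subseteq> R" using ring_gen.base by blast
  then show ?thesis using embedding_graph_ring_gen[OF R(1)] ring_gen_subset_graph[OF R(1)] by blast
qed

text \<open>Each \<open>z n\<close> is a root of unity of exact order \<open>4 * 2 ^ n\<close>, and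
  \<open>p n\<close> is a root of \<open>p 0\<close> of degree \<open>2 ^ n\<close>.\<close>

locale sqrt_tower =
  fixes K :: "qbar set" and z p :: "nat \<Rightarrow> qbar"
  assumes local_pair_0: "local_pair K (z 0) (p 0)" and z0: "(z 0)\<^sup>2 = -1"
    and zS: "(z (Suc n))\<^sup>2 = z n" and pS: "(p (Suc n))\<^sup>2 = p n"
begin

fun E :: "nat \<Rightarrow> qbar set" where
  "E 0 = K"
| "E (Suc n) = adjoin_sqrt (adjoin_sqrt (E n) (z (Suc n))) (p (Suc n))"

lemma local_pair_E: "local_pair (E n) (z n) (p n)"
  by (induction n) (auto simp: local_pair_0 intro!: local_pair_adjoin_sqrt2 zS pS)

lemma subfield_E: "qbar_subfield (E n)"
  using local_pair_E by (simp add: local_pair_def qbar_subfield_def)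

lemma half_step:
  "local_pair (adjoin_sqrt (E n) (z (Suc n))) (z (Suc n)) (p n)"
  "qbar_subfield (adjoin_sqrt (E n) (z (Suc n)))"
  "z (Suc n) \<notin> E n" "p (Suc n) \<notin> adjoin_sqrt (E n) (z (Suc n))"
proof -
  show *: "local_pair (adjoin_sqrt (E n) (z (Suc n))) (z (Suc n)) (p n)"
    by (intro local_pair_adjoin_sqrt[OF local_pair_E] zS)
  then show "qbar_subfield (adjoin_sqrt (E n) (z (Suc n)))" by (simp add: local_pair_def qbar_subfield_def)
  show "z (Suc n) \<notin> E n" using local_pair_sqrt_notin[OF local_pair_E zS] .
  show "p (Suc n) \<notin> adjoin_sqrt (E n) (z (Suc n))" using local_pair_sqrt_notin[OF local_pair_sym[OF *] pS] .
qed

lemma E_Suc_mem: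
  "x \<in> E n \<Longrightarrow> x \<in> E (Suc n)" "z (Suc n) \<in> E (Suc n)" "p (Suc n) \<in> E (Suc n)"
proof -
  interpret A: qbar_subfield "E n" by (rule subfield_E)
  interpret B: qbar_subfield "adjoin_sqrt (E n) (z (Suc n))" by (rule half_step)
  show "x \<in> E n \<Longrightarrow> x \<in> E (Suc n)" "z (Suc n) \<in> E (Suc n)" "p (Suc n) \<in> E (Suc n)"
    by (auto intro!: B.sub_adjoin_sqrt A.sub_adjoin_sqrt A.sqrt_mem_adjoin B.sqrt_mem_adjoin)
qed

declare E.simps(2) [simp del]

lemma E_mono: "m \<le> n \<Longrightarrow> E m \<subseteq> E n"
  by (rule lift_Suc_mono_le[of E]) (rule subsetI, rule E_Suc_mem(1))

definition M :: "qbar set" where "M = (\<Union>n. E n)"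

lemma E_subset_M: "E n \<subseteq> M" by (auto simp: M_def)

lemma subfield_M: "qbar_subfield M"
proof -
  have two: "\<exists>n. x \<in> E n \<and> y \<in> E n" if "x \<in> M" "y \<in> M" for x y
  proof -
    obtain a b where "x \<in> E a" "y \<in> E b" using \<open>x \<in> M\<close> \<open>y \<in> M\<close> by (auto simp: M_def)
    then show ?thesis using E_mono[of a "max a b"] E_mono[of b "max a b"] by auto
  qed
  show ?thesis
  proof unfold_locales
    show "1 \<in> M" using subfield_set.one_mem[of "E 0"] subfield_E[of 0] unfolding M_def qbar_subfield_def by blast
    fix x y assume "x \<in> M" "y \<in> M"
    then obtain n where n: "x \<in> E n" "y \<in> E n" using two by blast
    interpret qbar_subfield "E n" by (rule subfield_E)
    show "x - y \<in> M" "x * y \<in> M" "inverse x \<in> M"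
      using diff_mem[OF n] mult_mem[OF n] inverse_mem[OF n(1)] by (auto simp: M_def)
  qed
qed

text \<open>The four square classes of \<open>E n\<close> all become trivial one level up.\<close>

lemma sqrt_M: assumes "d \<in> M" shows "\<exists>s\<in>M. s\<^sup>2 = d"
proof -
  obtain n where n: "d \<in> E n" using assms by (auto simp: M_def)
  interpret qbar_subfield "E (Suc n)" by (rule subfield_E)
  show ?thesis
  proof (cases "d = 0")
    case True
    then show ?thesis using zero_mem E_subset_M[of "Suc n"] by (intro bexI[of _ 0]) auto
  next
    case False
    then obtain s where s: "s \<in> E n" "d \<in> {s\<^sup>2, z n * s\<^sup>2, p n * s\<^sup>2, z n * p n * s\<^sup>2}"
      using local_pair_E[of n] n unfolding local_pair_def by blast
    then have "d \<in> {s\<^sup>2, (z (Suc n) * s)\<^sup>2, (p (Suc n) * s)\<^sup>2, (z (Suc n) * p (Suc n) * s)\<^sup>2}"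
      by (simp only: power_mult_distrib zS pS)
    moreover have "s \<in> E (Suc n)" "z (Suc n) \<in> E (Suc n)" "p (Suc n) \<in> E (Suc n)"
      using s(1) E_Suc_mem by blast+
    ultimately have "\<exists>w\<in>E (Suc n). d = w\<^sup>2" using mult_mem by (metis insertE singletonD)
    then show ?thesis by (auto simp: M_def)
  qed
qed

lemma z_mem: "z n \<in> E n" and p_mem: "p n \<in> E n"
  using local_pair_E[of n] by (auto simp: local_pair_def)

lemma M_subset:
  assumes "qbar_subfield G" "K \<subseteq> G" "\<And>n. z n \<in> G" "\<And>n. p n \<in> G"
  shows "M \<subseteq> G"
proof -
  have "E n \<subseteq> G" for n
  proof (induction n)
    case (Suc n)
    interpret A: qbar_subfield "E n" by (rule subfield_E)
    interpret B: qbar_subfield "adjoin_sqrt (E n) (z (Suc n))" by (rule half_step)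
    have G: "subfield_set G" using assms(1) by (simp add: qbar_subfield_def)
    show ?case using B.adjoin_sqrt_subset[OF G A.adjoin_sqrt_subset[OF G Suc assms(3)] assms(4)] by (simp add: E.simps(2))
  qed (use assms in simp)
  then show ?thesis by (auto simp: M_def)
qed

text \<open>The conditions on \<open>a\<close> and \<open>b\<close> say that \<open>z 0\<close> and
  \<open>p 0\<close>, which lie in \<open>K\<close>, are fixed. Above \<open>K\<close> each new
  generator is a square root of a non-square, so it may be sent to either square root of the image
  of its square.\<close>

lemma ex_automorphism:
  assumes a: "z 0 ^ a = z 0" and b: "z 0 ^ b = 1"
  shows "\<exists>g. (\<forall>x\<in>K. act g x = x) \<and> (\<forall>n. act g (z n) = z n ^ a) \<and> (\<forall>n. act g (p n) = z n ^ b * p n)"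
proof -
  \<comment> \<open>Only the generators of level \<open>n\<close> are recorded, since the lower ones
    are powers of them.\<close>
  define S where "S n = Id_on K \<union> {(z n, z n ^ a), (p n, z n ^ b * p n)}" for n
  have K: "qbar_subfield K" using subfield_E[of 0] by simp
  have z2: "z n ^ k = (z (Suc n) ^ k)\<^sup>2" for n k
  proof -
    have "z n ^ k = ((z (Suc n))\<^sup>2) ^ k" by (simp only: zS)
    then show ?thesis by (simp only: power_mult[symmetric] mult.commute)
  qed
  have SD: "Domain (S n) \<subseteq> E n" for n
    using E_mono[of 0 n] z_mem p_mem by (auto simp: S_def)
  have lift: "(x, y) \<in> ring_gen T \<Longrightarrow> (x\<^sup>2, y\<^sup>2) \<in> ring_gen T" for x y T
    by (simp add: power2_eq_square ring_gen.mult)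
  have chain: "ring_gen (S n) \<subseteq> ring_gen (S (Suc n))" for n
  proof (rule ring_gen_subset)
    have "(z (Suc n), z (Suc n) ^ a) \<in> ring_gen (S (Suc n))"
      "(p (Suc n), z (Suc n) ^ b * p (Suc n)) \<in> ring_gen (S (Suc n))"
      by (auto simp: S_def intro: ring_gen.base)
    from lift[OF this(1)] lift[OF this(2)]
    have "(z n, z n ^ a) \<in> ring_gen (S (Suc n))" "(p n, z n ^ b * p n) \<in> ring_gen (S (Suc n))"
      by (simp_all add: zS pS power_mult_distrib flip: z2)
    then show "S n \<subseteq> ring_gen (S (Suc n))" by (auto simp: S_def intro: ring_gen.base)
  qed
  have "embedding_graph (ring_gen (S n))" for n
  proof (induction n)
    case 0
    interpret qbar_subfield K by fact
    have "embedding_graph (Id_on K)"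
      by standard (auto simp: mems to_ac_mem)
    moreover have "S 0 \<subseteq> Id_on K" using z_mem[of 0] p_mem[of 0] by (auto simp: S_def a b)
    ultimately show ?case using embedding_graph_ring_gen ring_gen_subset_graph by blast
  next
    case (Suc n)
    let ?S1 = "insert (z (Suc n), z (Suc n) ^ a) (S n)"
    let ?S2 = "insert (p (Suc n), z (Suc n) ^ b * p (Suc n)) ?S1"
    interpret A: qbar_subfield "E n" by (rule subfield_E)
    have 1: "embedding_graph (ring_gen ?S1)"
    proof (rule embedding_graph_adjoin_sqrt[OF Suc subfield_E SD half_step(3)])
      show "((z (Suc n))\<^sup>2, (z (Suc n) ^ a)\<^sup>2) \<in> ring_gen (S n)"
        by (auto simp: S_def zS simp flip: z2 intro: ring_gen.base)
    qed
    have 2: "embedding_graph (ring_gen ?S2)"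
    proof (rule embedding_graph_adjoin_sqrt[OF 1 half_step(2) _ half_step(4)])
      show "Domain ?S1 \<subseteq> adjoin_sqrt (E n) (z (Suc n))"
        using SD[of n] A.sub_adjoin_sqrt A.sqrt_mem_adjoin by auto
      show "((p (Suc n))\<^sup>2, (z (Suc n) ^ b * p (Suc n))\<^sup>2) \<in> ring_gen ?S1"
        by (auto simp: S_def pS power_mult_distrib simp flip: z2 intro: ring_gen.base)
    qed
    have "S (Suc n) \<subseteq> ?S2" by (auto simp: S_def)
    then have "ring_gen (S (Suc n)) \<subseteq> ring_gen ?S2" by (intro ring_gen_subset) (auto intro: ring_gen.base)
    then show ?case using embedding_graph_ring_gen[OF 2] by blast
  qed
  then have "embedding_graph (\<Union>(range (\<lambda>n. ring_gen (S n))))"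
    using lift_Suc_mono_le[of "\<lambda>n. ring_gen (S n)", OF chain]
    by (intro embedding_graph_Union_chain) (auto, meson nle_le subsetD)
  from embedding_graph.extend_to_automorphism[OF this]
  obtain g where "\<forall>(x, y)\<in>\<Union>(range (\<lambda>n. ring_gen (S n))). act g x = y" ..
  then have g: "(x, y) \<in> ring_gen (S n) \<Longrightarrow> act g x = y" for x y n by auto
  have "act g x = x" if "x \<in> K" for x by (rule g[of _ _ 0]) (use that in \<open>auto simp: S_def intro: ring_gen.base\<close>)
  moreover have "act g (z n) = z n ^ a" for n by (rule g[of _ _ n]) (auto simp: S_def intro: ring_gen.base)
  moreover have "act g (p n) = z n ^ b * p n" for n by (rule g[of _ _ n]) (auto simp: S_def intro: ring_gen.base)
  ultimately show ?thesis by blast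
qed

text \<open>Both sides send \<open>z n\<close> to \<open>z n ^ 5\<close> and \<open>p n\<close> to
  \<open>z n ^ 20 * p n\<close>, and the numbers on which two automorphisms agree form a field. This
  is the relation between a Frobenius and a tame inertia generator for a residue field of order
  5.\<close>

lemma ex_tame_pair:
  "\<exists>\<sigma> \<tau>. (\<forall>x\<in>M. act (\<sigma> * \<tau>) x = act (\<tau> ^ 5 * \<sigma>) x) \<and>
     (\<forall>n. act \<sigma> (z n) = z n ^ 5) \<and> (\<forall>n. act \<tau> (z n) = z n) \<and> (\<forall>n. act \<tau> (p n) = z n ^ 4 * p n)"
proof -
  have z4: "z 0 ^ 4 = 1" using z0 by (simp add: eval_nat_numeral)
  have z5: "z 0 ^ 5 = z 0" using z0 by (simp add: eval_nat_numeral)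
  obtain \<sigma> where s: "\<And>x. x \<in> K \<Longrightarrow> act \<sigma> x = x" "\<And>n. act \<sigma> (z n) = z n ^ 5" "\<And>n. act \<sigma> (p n) = p n"
    using ex_automorphism[of 5 0, OF z5] by auto
  obtain \<tau> where t: "\<And>x. x \<in> K \<Longrightarrow> act \<tau> x = x" "\<And>n. act \<tau> (z n) = z n" "\<And>n. act \<tau> (p n) = z n ^ 4 * p n"
    using ex_automorphism[of 1 4, OF _ z4] by auto
  define G where "G = {x. act (\<sigma> * \<tau>) x = act (\<tau> ^ 5 * \<sigma>) x}"
  have "qbar_subfield G" by unfold_locales (auto simp: G_def)
  have pow5: "act (\<tau> ^ 5) x = act \<tau> (act \<tau> (act \<tau> (act \<tau> (act \<tau> x))))" for x
    by (simp add: eval_nat_numeral)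
  have "M \<subseteq> G"
  proof (rule M_subset)
    show "K \<subseteq> G" by (auto simp: G_def pow5 s t)
    show "z n \<in> G" for n by (simp add: G_def pow5 s t)
    show "p n \<in> G" for n by (simp add: G_def pow5 s t)
  qed fact
  then show ?thesis using s t by (auto simp: G_def)
qed

end

lemma ex_sqrt_qbar: "\<exists>y. y\<^sup>2 = (x :: qbar)"
proof -
  obtain y where "poly [:- x, 0, 1:] y = 0" using alg_closed_imp_poly_has_root[of "[:- x, 0, 1:]"] by auto
  then show ?thesis by (intro exI[of _ y]) (simp add: power2_eq_square)
qed

lemma ex_sqrt_tower: "\<exists>K z p. sqrt_tower K z p \<and> p 0 = 5"
proof -
  obtain A :: "qbar set" where A: "five_adic A" "\<forall>e\<in>A. \<exists>s\<in>A. s\<^sup>2 = 1 + 5 * e"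
    using ex_henselian_five_adic ex_sqrt_qbar by blast
  interpret five_adic A by fact
  obtain i where i: "i\<^sup>2 = -1" "local_pair frac i 5" using local_pair_frac A(2) by blast
  define r :: "qbar \<Rightarrow> nat \<Rightarrow> qbar" where "r x = rec_nat x (\<lambda>_ y. SOME w. w\<^sup>2 = y)" for x
  have r: "r x 0 = x" "(r x (Suc n))\<^sup>2 = r x n" for x n
    using someI_ex[OF ex_sqrt_qbar[of "r x n"]] by (simp_all add: r_def)
  have "sqrt_tower frac (r i) (r 5)" by standard (simp_all add: r i)
  then show ?thesis using r by blast
qed

section \<open>The characters and the obstruction\<close>

lemma Z8_of_nat_eq_iff: "(of_nat a :: Z8) = of_nat b \<longleftrightarrow> a mod 8 = b mod 8"
proof -
  have "(of_nat a :: Z8) = of_nat b \<longleftrightarrow> Rep_bit0 (of_nat a :: Z8) = Rep_bit0 (of_nat b :: Z8)"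
    by (rule bit0.Rep_inject_sym)
  also have "\<dots> \<longleftrightarrow> int a mod 8 = int b mod 8"
    using bit0.Rep_Abs_mod[where 'a = 4, of "int a"] bit0.Rep_Abs_mod[where 'a = 4, of "int b"]
    by (simp add: bit0.of_nat_eq)
  also have "\<dots> \<longleftrightarrow> a mod 8 = b mod 8"
    by (metis nat_mod_distrib of_nat_0_le_iff nat_int zmod_int of_nat_numeral)
  finally show ?thesis .
qed

lemma Z8_eq_of_nat: "\<exists>n. (x :: Z8) = of_nat n"
  using Z8_cases[of x] by (metis of_nat_0 of_nat_1 of_nat_numeral empty_iff insert_iff)

lemma Z8_eqs: "(8 :: Z8) = 0" "(16 :: Z8) = 0"
  by simp_all

text \<open>The table lists the products of a sign and a power of 5, with 31 for -1; they exhaust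
  the odd residues.\<close>

lemma units_mod_32:
  assumes "odd m" shows "\<exists>k. \<exists>e\<in>{1, 31}. (e * 5 ^ k) mod 32 = m mod (32 :: nat)"
proof -
  define x where "x = m mod 32"
  have "x < 32" "odd x" using assms by (auto simp: x_def dvd_mod_iff)
  then have "x = 1 \<or> x = 3 \<or> x = 5 \<or> x = 7 \<or> x = 9 \<or> x = 11 \<or> x = 13 \<or> x = 15 \<or>
    x = 17 \<or> x = 19 \<or> x = 21 \<or> x = 23 \<or> x = 25 \<or> x = 27 \<or> x = 29 \<or> x = 31"
    by presburger
  moreover have "(1 * 5 ^ 0) mod 32 = (1::nat)" "(1 * 5 ^ 1) mod 32 = (5::nat)"
    "(1 * 5 ^ 2) mod 32 = (25::nat)" "(1 * 5 ^ 3) mod 32 = (29::nat)"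
    "(1 * 5 ^ 4) mod 32 = (17::nat)" "(1 * 5 ^ 5) mod 32 = (21::nat)"
    "(1 * 5 ^ 6) mod 32 = (9::nat)" "(1 * 5 ^ 7) mod 32 = (13::nat)"
    "(31 * 5 ^ 0) mod 32 = (31::nat)" "(31 * 5 ^ 1) mod 32 = (27::nat)"
    "(31 * 5 ^ 2) mod 32 = (7::nat)" "(31 * 5 ^ 3) mod 32 = (3::nat)"
    "(31 * 5 ^ 4) mod 32 = (15::nat)" "(31 * 5 ^ 5) mod 32 = (11::nat)"
    "(31 * 5 ^ 6) mod 32 = (23::nat)" "(31 * 5 ^ 7) mod 32 = (19::nat)"
    by simp_all
  ultimately show ?thesis unfolding x_def[symmetric] by (elim disjE) (metis insertI1 insertI2)+
qed

lemma power_5_mod_32: "(5 :: nat) ^ k mod 32 = 5 ^ (k mod 8) mod 32"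
proof -
  have "(5 :: nat) ^ k = (5 ^ 8) ^ (k div 8) * 5 ^ (k mod 8)"
    by (simp only: power_mult[symmetric] power_add[symmetric] mult_div_mod_eq)
  also have "\<dots> mod 32 = ((5 ^ 8 mod 32) ^ (k div 8) * 5 ^ (k mod 8)) mod 32"
    by (metis mod_mult_left_eq power_mod)
  finally show ?thesis by simp
qed

text \<open>Modulo 32 the number 5 has order 8 and -1 is not a power of it, so the unit group is the
  direct product of the two subgroups they generate.\<close>

lemma log_mod_32_unique:
  assumes "(e * 5 ^ k) mod 32 = (e' * 5 ^ k') mod (32 :: nat)" "e \<in> {1, 31}" "e' \<in> {1, 31}"
  shows "k mod 8 = k' mod 8" "e = e'"
proof -
  have "(e * 5 ^ (k mod 8)) mod 32 = (e' * 5 ^ (k' mod 8)) mod 32"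
    using assms(1) power_5_mod_32 by (metis mod_mult_right_eq)
  moreover have "k mod 8 \<in> {0, 1, 2, 3, 4, 5, 6, 7}" "k' mod 8 \<in> {0, 1, 2, 3, 4, 5, 6, 7}" by auto
  ultimately have "k mod 8 = k' mod 8 \<and> e = e'" using assms(2,3)
    by (elim insertE emptyE) simp_all
  then show "k mod 8 = k' mod 8" "e = e'" by simp_all
qed

section \<open>Roots of unity and the cyclotomic character\<close>

context sqrt_tower
begin

lemma z_power_eq_1_iff: "z n ^ k = 1 \<longleftrightarrow> 4 * 2 ^ n dvd k"
proof (induction n arbitrary: k)
  case 0
  have z4: "z 0 ^ 4 = 1" using z0 by (simp add: eval_nat_numeral)
  have "z 0 ^ k = (z 0 ^ 4) ^ (k div 4) * z 0 ^ (k mod 4)"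
    by (simp only: power_mult[symmetric] power_add[symmetric] mult_div_mod_eq)
  then have *: "z 0 ^ k = z 0 ^ (k mod 4)" by (simp add: z4)
  have ne: "z 0 \<noteq> 1" "z 0 ^ 2 \<noteq> 1" "z 0 ^ 3 \<noteq> 1"
  proof -
    show "z 0 \<noteq> 1" "z 0 ^ 2 \<noteq> 1" using z0 by auto
    show "z 0 ^ 3 \<noteq> 1"
    proof
      assume "z 0 ^ 3 = 1"
      then have "- z 0 = 1" using z0 by (simp add: eval_nat_numeral)
      then have "(- z 0)\<^sup>2 = 1" by simp
      then show False using z0 by simp
    qed
  qed
  have "k mod 4 \<in> {0, 1, 2, 3}" by auto
  then show ?case using ne unfolding * by (auto simp: dvd_eq_mod_eq_0)
next
  case (Suc n)
  show ?case
  proof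
    assume *: "z (Suc n) ^ k = 1"
    have "z n ^ k = (z (Suc n) ^ k) ^ 2" by (simp only: zS[symmetric, of n] power_mult[symmetric] mult.commute)
    then have "4 * 2 ^ n dvd k" using Suc by (simp add: *)
    then have "even k" by (meson dvd_trans dvd_triv_left even_numeral dvd_mult2)
    then obtain c where c: "k = 2 * c" by blast
    then have "z n ^ c = 1" using * by (simp add: power_mult zS)
    then show "4 * 2 ^ Suc n dvd k" using Suc c by simp
  next
    assume "4 * 2 ^ Suc n dvd k"
    then obtain c where c: "k = 2 * c" "4 * 2 ^ n dvd c" by (auto simp: mult.assoc)
    then show "z (Suc n) ^ k = 1" using Suc by (simp add: power_mult zS)
  qed
qed

lemma z_power_eq_iff: "z n ^ a = z n ^ b \<longleftrightarrow> a mod (4 * 2 ^ n) = b mod (4 * 2 ^ n)"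
proof -
  have "z n \<noteq> 0" using z_power_eq_1_iff[of n "4 * 2 ^ n"] by (auto simp: power_0_left)
  have *: "z n ^ a = z n ^ b \<longleftrightarrow> a mod (4 * 2 ^ n) = b mod (4 * 2 ^ n)" if "a \<le> b" for a b
  proof -
    have "z n ^ b = z n ^ a * z n ^ (b - a)" using that by (simp flip: power_add)
    then have "z n ^ a = z n ^ b \<longleftrightarrow> z n ^ (b - a) = 1" using \<open>z n \<noteq> 0\<close> by simp
    also have "\<dots> \<longleftrightarrow> b mod (4 * 2 ^ n) = a mod (4 * 2 ^ n)"
      unfolding z_power_eq_1_iff using mod_eq_dvd_iff_nat[OF that] by simp
    finally show ?thesis by auto
  qed
  show ?thesis using *[of a b] *[of b a] by (cases "a \<le> b") auto
qed

lemma root_of_unity: "y ^ (4 * 2 ^ n) = 1 \<Longrightarrow> \<exists>k. y = z n ^ k"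
proof (induction n arbitrary: y)
  case 0
  then have "(y\<^sup>2)\<^sup>2 = 1" by (simp flip: power_mult)
  then have "y\<^sup>2 = 1 \<or> y\<^sup>2 = (z 0)\<^sup>2" by (metis z0 power2_eq_1_iff)
  then have "y = z 0 ^ 0 \<or> y = - (z 0 ^ 0) \<or> y = z 0 ^ 1 \<or> y = - (z 0 ^ 1)" by (auto simp: power2_eq_1_iff power2_eq_iff)
  moreover have "- (z 0 ^ k) = z 0 ^ (k + 2)" for k by (simp only: power_add z0) simp
  ultimately show ?case by metis
next
  case (Suc n)
  have "(y\<^sup>2) ^ (4 * 2 ^ n) = 1" using Suc.prems by (simp add: power_mult[symmetric] mult.left_commute)
  then obtain k where "y\<^sup>2 = z n ^ k" using Suc.IH by blast
  also have "z n ^ k = (z (Suc n) ^ k)\<^sup>2" by (simp only: zS[symmetric, of n] power_mult[symmetric] mult.commute)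
  finally have y: "y = z (Suc n) ^ k \<or> y = - (z (Suc n) ^ k)" by (simp add: power2_eq_iff)
  \<comment> \<open>The exponent is half the order of \<open>z (Suc n)\<close>, so this power is -1
    and absorbs the sign of \<open>y\<close>.\<close>
  have "(z (Suc n) ^ (2 * 2 ^ Suc n))\<^sup>2 = 1" by (simp flip: power_mult add: z_power_eq_1_iff)
  moreover have "z (Suc n) ^ (2 * 2 ^ Suc n) \<noteq> 1" by (simp add: z_power_eq_1_iff)
  ultimately have "z (Suc n) ^ (2 * 2 ^ Suc n) = -1" by (simp add: power2_eq_1_iff)
  then have "- (z (Suc n) ^ k) = z (Suc n) ^ (k + 2 * 2 ^ Suc n)" by (simp add: power_add)
  then show ?case using y by metis
qed

lemma z3: "z 3 ^ 8 = z 0" "z 3 ^ 4 = z 1"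
proof -
  have 1: "(z 3)\<^sup>2 = z 2" "(z 2)\<^sup>2 = z 1" "(z 1)\<^sup>2 = z 0"
    using zS[of 2] zS[of 1] zS[of 0] by (simp_all only: Suc_1 Suc_numeral One_nat_def[symmetric]) simp
  have "z 3 ^ 4 = ((z 3)\<^sup>2)\<^sup>2" "z 3 ^ 8 = (((z 3)\<^sup>2)\<^sup>2)\<^sup>2" by (simp_all flip: power_mult)
  then show "z 3 ^ 8 = z 0" "z 3 ^ 4 = z 1" by (simp_all only: 1)
qed

lemma act_z3: "\<exists>k. \<exists>e\<in>{1, 31}. act g (z 3) = z 3 ^ (e * 5 ^ k)"
proof -
  have 32: "z 3 ^ 32 = 1" by (simp add: z_power_eq_1_iff)
  have "act g (z 3) ^ (4 * 2 ^ 3) = act g (z 3 ^ 32)" by (simp del: act_power) simp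
  then have "act g (z 3) ^ (4 * 2 ^ 3) = 1" by (simp add: 32 del: act_power)
  then obtain m where m: "act g (z 3) = z 3 ^ m" using root_of_unity by blast
  have "odd m"
  proof
    assume "even m"
    then obtain c where "m = 2 * c" by blast
    then have "act g (z 3 ^ 16) = (z 3 ^ 32) ^ c" using m by (simp flip: power_mult add: mult.commute)
    then have "z 3 ^ 16 = 1" using 32 act_eq_iff[of g "z 3 ^ 16" 1] by simp
    then show False by (simp add: z_power_eq_1_iff)
  qed
  then obtain k e where "e \<in> {1, 31}" "(e * 5 ^ k) mod 32 = m mod 32" using units_mod_32 by blast
  then have "z 3 ^ (e * 5 ^ k) = z 3 ^ m" by (simp add: z_power_eq_iff)
  then show ?thesis using \<open>e \<in> _\<close> m by metis
qed

text \<open>The logarithm to base 5, up to sign, of the cyclotomic character modulo 32; 31 stands for \<open>-1\<close>.\<close>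

definition chi :: "gal_Q \<Rightarrow> Z8" where
  "chi g = of_nat (SOME k. \<exists>e\<in>{1, 31}. act g (z 3) = z 3 ^ (e * 5 ^ k))"

lemma chiI:
  assumes "act g (z 3) = z 3 ^ (e * 5 ^ k)" "e \<in> {1, 31}"
  shows "chi g = of_nat k"
proof -
  define l where "l = (SOME k. \<exists>e\<in>{1, 31}. act g (z 3) = z 3 ^ (e * 5 ^ k))"
  obtain e' where "e' \<in> {1, 31}" "act g (z 3) = z 3 ^ (e' * 5 ^ l)"
    using someI_ex[OF act_z3[of g]] unfolding l_def by blast
  then have "(e * 5 ^ k) mod 32 = (e' * 5 ^ l) mod 32" using assms by (simp add: z_power_eq_iff)
  then have "k mod 8 = l mod 8" using log_mod_32_unique assms \<open>e' \<in> _\<close> by blast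
  then show ?thesis unfolding chi_def l_def[symmetric] by (simp add: Z8_of_nat_eq_iff)
qed

lemma chi_mult: "chi (g * h) = chi g + chi h"
proof -
  obtain k e where g: "e \<in> {1, 31}" "act g (z 3) = z 3 ^ (e * 5 ^ k)" using act_z3 by blast
  obtain l f where h: "f \<in> {1, 31}" "act h (z 3) = z 3 ^ (f * 5 ^ l)" using act_z3 by blast
  have gh: "act (g * h) (z 3) = z 3 ^ ((e * f) * 5 ^ (k + l))"
    by (simp add: g h power_add flip: power_mult) (simp add: mult_ac)
  have "\<exists>d\<in>{1, 31}. (e * f) mod 32 = d mod 32" using g h by auto
  then obtain d where d: "d \<in> {1, 31}" "(e * f) mod 32 = d mod 32" by blast
  then have "z 3 ^ ((e * f) * 5 ^ (k + l)) = z 3 ^ (d * 5 ^ (k + l))"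
    unfolding z_power_eq_iff by (simp, metis mod_mult_left_eq)
  then have "chi (g * h) = of_nat (k + l)" using chiI gh d by metis
  then show ?thesis using chiI[OF g(2,1)] chiI[OF h(2,1)] by simp
qed

lemma chi_cochain: "chi \<in> cochains"
  by (rule cochainsI_gal[of "{z 3}"]) (auto simp: chi_def)

text \<open>The isomorphism from the integers modulo 8 to the eighth roots of unity with 1 going to
  \<open>z 1\<close>; the exponent is the representative between 0 and 7.\<close>

definition zp :: "Z8 \<Rightarrow> qbar" where
  "zp c = z 1 ^ nat (Rep_bit0 c)"

lemma zp_of_nat: "zp (of_nat n) = z 1 ^ n"
proof -
  have "Rep_bit0 (of_nat n :: Z8) = int n mod 8"
    using bit0.Rep_Abs_mod[where 'a = 4, of "int n"] by (simp add: bit0.of_nat_eq)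
  then have "nat (Rep_bit0 (of_nat n :: Z8)) = n mod 8" by (simp add: nat_mod_distrib)
  then show ?thesis by (simp add: zp_def z_power_eq_iff)
qed

lemma zp_add: "zp (a + b) = zp a * zp b"
proof -
  obtain m n where "a = of_nat m" "b = of_nat n" using Z8_eq_of_nat by metis
  then show ?thesis using zp_of_nat[of "m + n"] by (simp add: zp_of_nat power_add)
qed

lemma zp_inj: "zp a = zp b \<longleftrightarrow> a = b"
proof -
  obtain m n where "a = of_nat m" "b = of_nat n" using Z8_eq_of_nat by metis
  then show ?thesis by (simp add: zp_of_nat z_power_eq_iff Z8_of_nat_eq_iff)
qed

lemma zp_0: "zp 0 = 1" and zp_1: "zp 1 = z 1" and zp_numeral: "zp (numeral k) = z 1 ^ numeral k"
  using zp_of_nat[of 0] zp_of_nat[of 1] zp_of_nat[of "numeral k"] by simp_all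

lemma zp_uminus: "zp (- a) = inverse (zp a)"
proof -
  have "zp a * zp (- a) = 1" by (simp flip: zp_add add: zp_0)
  then show ?thesis by (simp add: inverse_unique)
qed

lemma zp_power: "zp a ^ n = zp (of_nat n * a)"
  by (induction n) (auto simp: zp_0 zp_add distrib_right)

text \<open>The cyclotomic character modulo 4, as a sign in \<open>Z8\<close>.\<close>

definition eta :: "gal_Q \<Rightarrow> Z8" where
  "eta g = (if act g (z 0) = z 0 then 1 else -1)"

lemma z0_nz: "z 0 \<noteq> 0" "- z 0 \<noteq> z 0"
proof -
  show "z 0 \<noteq> 0" using z0 by auto
  then show "- z 0 \<noteq> z 0" by simp
qed

lemma act_z0: "act g (z 0) = z 0 \<or> act g (z 0) = - z 0"
proof -
  have "(act g (z 0))\<^sup>2 = (z 0)\<^sup>2" using z0 by (simp flip: act_power)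
  then show ?thesis by (simp add: power2_eq_iff)
qed

lemma eta_mult: "eta (g * h) = eta g * eta h"
  using act_z0[of g] act_z0[of h] z0_nz by (auto simp: eta_def)

lemma eta_square: "eta g * eta g = 1"
  by (simp add: eta_def)

text \<open>The factor is the cyclotomic character modulo 8, because there 31 is -1 and
  \<open>5 ^ k\<close> is \<open>1 + 4 * k\<close>.\<close>

lemma act_zp: "act g (zp c) = zp (eta g * (1 + 4 * chi g) * c)"
proof -
  obtain k e where g: "e \<in> {1, 31}" "act g (z 3) = z 3 ^ (e * 5 ^ k)" using act_z3 by blast
  have five: "(5 :: Z8) ^ k = 1 + 4 * of_nat k"
  proof (induction k)
    case (Suc k)
    then have "(5 :: Z8) ^ Suc k = 5 + 20 * of_nat k" by (simp add: algebra_simps)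
    moreover have "(20 :: Z8) = 4" by simp
    ultimately show ?case by (simp add: algebra_simps)
  qed simp
  have "act g (z 1) = act g (z 3 ^ 4)" by (simp only: z3)
  also have "\<dots> = (z 3 ^ (e * 5 ^ k)) ^ 4" by (simp only: act_power g)
  also have "\<dots> = (z 3 ^ 4) ^ (e * 5 ^ k)" by (simp only: power_mult[symmetric] mult.commute)
  finally have z1: "act g (z 1) = zp (of_nat (e * 5 ^ k))" by (simp only: z3 zp_of_nat)
  have z10: "(z 1)\<^sup>2 = z 0" using zS[of 0] by simp
  \<comment> \<open>The sign is read off from the action on \<open>z 0\<close>, the square of
    \<open>z 1\<close>, where the power of 5 has no effect since \<open>2 * 5 ^ k\<close> is 2
    modulo 8.\<close>
  have "of_nat e = eta g"
  proof -
    have "act g (z 0) = (act g (z 1))\<^sup>2" by (simp flip: z10)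
    also have "\<dots> = zp (2 * (of_nat e * 5 ^ k))" by (simp only: z1 zp_power) simp
    also have "2 * (of_nat e * 5 ^ k) = 2 * of_nat e + 8 * (of_nat e * of_nat k :: Z8)"
      by (simp add: five algebra_simps)
    also have "\<dots> = 2 * of_nat e" by (simp add: Z8_eqs(1))
    finally have *: "act g (z 0) = zp (2 * of_nat e)" .
    have "zp 2 = z 0" using z10 by (simp add: zp_numeral)
    consider "e = 1" | "e = 31" using g by blast
    then show ?thesis
    proof cases
      case 1
      then show ?thesis using * by (simp add: eta_def \<open>zp 2 = z 0\<close>)
    next
      case e: 2
      have "2 * (of_nat 31 :: Z8) = 6" by simp
      then have "act g (z 0) = zp 6" using * \<open>e = 31\<close> by (simp only:)
      then have "act g (z 0) \<noteq> z 0" using zp_inj[of 6 2] by (simp add: \<open>zp 2 = z 0\<close>)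
      then show ?thesis using e by (simp add: eta_def)
    qed
  qed
  then have z1': "act g (z 1) = zp (eta g * (1 + 4 * chi g))" using z1 chiI[OF g(2,1)] by (simp add: five)
  obtain n where n: "c = of_nat n" using Z8_eq_of_nat by blast
  have "act g (zp c) = act g (z 1) ^ n" by (simp add: n zp_of_nat)
  then show ?thesis by (simp only: z1' zp_power n mult_ac)
qed

end

section \<open>The Kummer function of an eighth root\<close>

locale kummer_tower = sqrt_tower +
  fixes r :: qbar
  assumes p0: "p 0 = 5" and r8: "r ^ 8 = (2 + z 0) / (2 - z 0)"
begin

lemma norm_5: "(2 + z 0) * (2 - z 0) = 5"
proof -
  have "(2 + z 0) * (2 - z 0) = 4 - (z 0)\<^sup>2" by (simp add: algebra_simps power2_eq_square)
  then show ?thesis by (simp add: z0)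
qed

lemma nz: "2 + z 0 \<noteq> 0" "2 - z 0 \<noteq> 0" "r \<noteq> 0"
proof -
  show 1: "2 + z 0 \<noteq> 0" "2 - z 0 \<noteq> 0" using norm_5 by (metis mult_zero_left mult_zero_right zero_neq_numeral)+
  then show "r \<noteq> 0" using r8 by auto
qed

text \<open>The radicand \<open>(2 + z 0) / (2 - z 0)\<close> is inverted when \<open>z 0\<close>
  changes sign, so this is an eighth root of its image under \<open>g\<close>.\<close>

definition conj_r :: "gal_Q \<Rightarrow> qbar" where
  "conj_r g = (if act g (z 0) = z 0 then r else inverse r)"

lemma conj_r_nz: "conj_r g \<noteq> 0"
  using nz by (simp add: conj_r_def)

lemma act_r_ex: "\<exists>a. act g r = zp a * conj_r g"
proof -
  have "act g r ^ 8 = (2 + act g (z 0)) / (2 - act g (z 0))"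
    using arg_cong[OF r8, of "act g"] by simp
  then have "act g r ^ 8 = conj_r g ^ 8"
    using act_z0[of g] by (auto simp: conj_r_def r8 power_inverse)
  then have "(act g r / conj_r g) ^ (4 * 2 ^ 1) = 1" using conj_r_nz by (simp add: power_divide)
  then obtain k where "act g r / conj_r g = z 1 ^ k" using root_of_unity by blast
  then have "act g r = zp (of_nat k) * conj_r g" using conj_r_nz[of g] by (simp add: zp_of_nat field_simps)
  then show ?thesis ..
qed

text \<open>The factor \<open>eta g\<close> is built in so that all signs cancel in
  \<open>kum_mult\<close>.\<close>

definition kum :: "gal_Q \<Rightarrow> Z8" where
  "kum g = eta g * (SOME a. act g r = zp a * conj_r g)"

lemma kumI: "act g r = zp a * conj_r g \<Longrightarrow> kum g = eta g * a"
proof -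
  assume *: "act g r = zp a * conj_r g"
  have "act g r = zp (SOME a. act g r = zp a * conj_r g) * conj_r g"
    using someI_ex[OF act_r_ex] .
  then have "zp (SOME a. act g r = zp a * conj_r g) = zp a" using * conj_r_nz by (metis mult_right_cancel)
  then show ?thesis by (simp add: kum_def zp_inj)
qed

lemma act_r: "act g r = zp (eta g * kum g) * conj_r g"
proof -
  obtain a where a: "act g r = zp a * conj_r g" using act_r_ex by blast
  then have "eta g * kum g = a" using kumI[OF a] eta_square[of g] by (simp flip: mult.assoc)
  then show ?thesis using a by simp
qed

text \<open>The action on roots of unity contributes the twist
  \<open>eta g * (1 + 4 * chi g)\<close>, and the inversion of the radicand contributes further
  signs. All signs cancel against those in \<open>kum\<close>, which leaves the twist
  \<open>1 + 4 * chi g\<close>.\<close>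

lemma kum_mult: "kum (g * h) = kum g + kum h + 4 * chi g * kum h"
proof -
  have "act g (conj_r h) = zp (eta h * eta g * kum g) * conj_r (g * h)"
    using act_z0[of g] act_z0[of h] z0_nz
    by (auto simp: conj_r_def act_r eta_def zp_uminus)
  then have "act (g * h) r = zp (eta g * (1 + 4 * chi g) * (eta h * kum h) + eta h * eta g * kum g) * conj_r (g * h)"
    by (simp add: act_r[of h] act_zp zp_add)
  then have "kum (g * h) = eta (g * h) * (eta g * (1 + 4 * chi g) * (eta h * kum h) + eta h * eta g * kum g)"
    by (rule kumI)
  also have "\<dots> = (eta g * eta g) * (eta h * eta h) * ((1 + 4 * chi g) * kum h + kum g)"
    by (simp only: eta_mult distrib_left mult_ac)
  finally show ?thesis by (simp add: eta_square algebra_simps)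
qed

lemma kum_cochain: "kum \<in> cochains"
  by (rule cochainsI_gal[of "{z 0, r}"]) (auto simp: kum_def eta_def conj_r_def)

lemma four_kum_mult: "4 * kum (g * h) = 4 * kum g + 4 * kum h"
proof -
  have "4 * kum (g * h) = 4 * kum g + 4 * kum h + 16 * (chi g * kum h)"
    by (simp add: kum_mult algebra_simps)
  then show ?thesis by (simp add: Z8_eqs(2))
qed

text \<open>Up to sign \<open>r ^ 4\<close> is \<open>(2 + z 0) / p 1\<close>, and
  \<open>p 1\<close> is a square root of 5. Since \<open>\<tau>\<close> fixes \<open>z 0\<close> and
  negates \<open>p 1\<close>, it negates \<open>r ^ 4\<close>.\<close>

lemma kum_tau:
  assumes "\<And>n. act \<tau> (z n) = z n" "\<And>n. act \<tau> (p n) = z n ^ 4 * p n"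
  shows "4 * kum \<tau> = 4"
proof -
  have p1: "(p 1)\<^sup>2 = 5" using pS[of 0] p0 by simp
  then have "p 1 \<noteq> 0" by auto
  have z14: "z 1 ^ 4 = -1"
  proof -
    have "z 1 ^ 4 = ((z 1)\<^sup>2)\<^sup>2" by (simp flip: power_mult)
    then show ?thesis using zS[of 0] z0 by simp
  qed
  have "(r ^ 4)\<^sup>2 = ((2 + z 0) / p 1)\<^sup>2"
  proof -
    have "(r ^ 4)\<^sup>2 = (2 + z 0) / (2 - z 0)" by (simp flip: r8 power_mult)
    also have "\<dots> = (2 + z 0)\<^sup>2 / ((2 + z 0) * (2 - z 0))" using nz by (simp add: power2_eq_square)
    finally show ?thesis by (simp only: norm_5 power_divide p1)
  qed
  then have r4: "r ^ 4 = (2 + z 0) / p 1 \<or> r ^ 4 = - ((2 + z 0) / p 1)" by (simp only: power2_eq_iff)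
  have "act \<tau> (p 1) = - p 1" using assms(2)[of 1] z14 by simp
  then have "act \<tau> (r ^ 4) = - (r ^ 4)" using r4 assms(1)[of 0] by (auto simp del: act_power)
  moreover have "act \<tau> r = zp (kum \<tau>) * r" using act_r[of \<tau>] assms(1)[of 0] by (simp add: eta_def conj_r_def)
  ultimately have "zp (kum \<tau>) ^ 4 * r ^ 4 = (-1) * r ^ 4" by (simp add: power_mult_distrib)
  then have "zp (kum \<tau>) ^ 4 = -1" using nz by (metis mult_right_cancel power_not_zero)
  then have "zp (4 * kum \<tau>) = zp 4" using z14 by (simp add: zp_power zp_numeral)
  then show ?thesis by (simp only: zp_inj)
qed

end

text \<open>The relation \<open>\<sigma> \<tau> = \<tau>\<^sup>5 \<sigma>\<close> computed in a unipotent representation: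
  its (1,3) and (2,4) entries determine \<open>4 u \<tau>\<close> and \<open>4 w \<tau>\<close>, after which the (1,4) entry fails modulo 8.\<close>

lemma tame_relation_obstruction:
  fixes x k u w c :: "'g::monoid_mult \<Rightarrow> Z8"
  assumes x: "\<And>g h. x (g * h) = x g + x h"
    and k: "\<And>g h. 4 * k (g * h) = 4 * k g + 4 * k h"
    and u: "\<And>g h. u (g * h) = u g + u h + 2 * x g * x h"
    and w: "\<And>g h. w (g * h) = w g + w h + x g * (4 * k h)"
    and c: "\<And>g h. c (g * h) = c g + c h + 2 * x g * w h + u g * (4 * k h)"
    and vals: "x \<sigma> = 1" "x \<tau> = 0" "4 * k \<tau> = 4"
    and rel: "u (\<sigma> * \<tau>) = u (\<tau> ^ 5 * \<sigma>)" "w (\<sigma> * \<tau>) = w (\<tau> ^ 5 * \<sigma>)" "c (\<sigma> * \<tau>) = c (\<tau> ^ 5 * \<sigma>)"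
  shows False
proof -
  have t5: "\<tau> ^ 5 = \<tau> * (\<tau> * (\<tau> * (\<tau> * \<tau>)))" by (simp add: eval_nat_numeral)
  have x5: "x (\<tau> ^ 5) = 0" by (simp add: t5 x vals)
  have w5: "w (\<tau> ^ 5) = 5 * w \<tau>" by (simp add: t5 w x vals)
  have u5: "u (\<tau> ^ 5) = 5 * u \<tau>" by (simp add: t5 u x vals)
  have "w \<sigma> + w \<tau> + 4 = 5 * w \<tau> + w \<sigma>" using rel(2) by (simp add: w w5 x5 vals)
  then have w4: "4 * w \<tau> = 4" by (simp add: algebra_simps)
  have "u \<sigma> + u \<tau> = 5 * u \<tau> + u \<sigma>" using rel(1) by (simp add: u u5 x5 vals)
  then have u4: "4 * u \<tau> = 0" by (simp add: algebra_simps)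
  then have u4': "u \<tau> * 4 = 0" by (simp add: mult.commute)
  have vanish: "u \<tau> * (4 * y) = 0" for y using u4' by (simp flip: mult.assoc)
  \<comment> \<open>Both cross terms vanish for left multiplication by \<open>\<tau>\<close>: one
    because \<open>x \<tau> = 0\<close>, the other by \<open>vanish\<close>.\<close>
  have step: "c (\<tau> * g) = c \<tau> + c g" for g by (simp add: c vals vanish)
  have c5: "c (\<tau> ^ 5) = 5 * c \<tau>" by (simp add: t5 step)
  have "c (\<sigma> * \<tau>) = c \<sigma> + c \<tau> + 2 * w \<tau> + u \<sigma> * 4" by (simp add: c vals)
  moreover have "c (\<tau> ^ 5 * \<sigma>) = 5 * c \<tau> + c \<sigma>" by (simp add: c c5 x5 u5 mult.assoc vanish)
  ultimately have "c \<sigma> + c \<tau> + 2 * w \<tau> + u \<sigma> * 4 = 5 * c \<tau> + c \<sigma>" using rel(3) by simp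
  then have "2 * w \<tau> + 4 * u \<sigma> = 4 * c \<tau>" by (simp add: algebra_simps)
  \<comment> \<open>Doubling removes the unknown values \<open>u \<sigma>\<close> and
    \<open>c \<tau>\<close> and leaves \<open>4 * w \<tau> = 0\<close>, against
    \<open>w4\<close>.\<close>
  then have "2 * (2 * w \<tau> + 4 * u \<sigma>) = 2 * (4 * c \<tau>)" by simp
  then have "4 * w \<tau> + 8 * u \<sigma> = 8 * c \<tau>" by (simp add: algebra_simps)
  then show False using w4 by (simp add: Z8_eqs)
qed

text \<open>For the trivial action \<open>d0\<close> is zero, so a class in degree 1 is a single
  cochain. The superdiagonal entries of a defining system are therefore determined exactly.\<close>

lemma class1_eq: "class1 f = {f :: 'g::{monoid_mult,topological_space} \<Rightarrow> 'r::comm_ring_1}"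
  by (auto simp: class1_def r_coset_def coboundaries1_def d0_def cocycles1_def pointwise_add_group_def)

lemma class1_in_H1: "f \<in> cochains \<Longrightarrow> d1 f = (\<lambda>_. 0) \<Longrightarrow> class1 f \<in> carrier H1"
  by (auto simp: H1_def carrier_FactGroup class1_def cocycles1_def pointwise_add_group_def)

lemma class2_eq_one_imp_coboundary:
  assumes "class2 f = \<one>\<^bsub>H2\<^esub>"
  shows "\<exists>c\<in>cochains. f = d1 (c :: 'g::{monoid_mult,topological_space} \<Rightarrow> 'r::comm_ring_1)"
proof -
  have "(\<lambda>_. 0 :: 'r) \<in> (cochains :: ('g \<Rightarrow> 'r) set)" by (simp add: cochains_def)
  moreover have "d1 (\<lambda>_ :: 'g. 0 :: 'r) = (\<lambda>_. 0)" by (auto simp: d1_def)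
  ultimately have "(\<lambda>_. 0) \<in> (coboundaries2 :: ('g \<times> 'g \<Rightarrow> 'r) set)" unfolding coboundaries2_def by force
  then have "f \<in> class2 f"
    by (auto simp: class2_def r_coset_def cocycles2_def pointwise_add_group_def intro!: bexI[of _ "\<lambda>_. 0"])
  then have "f \<in> coboundaries2" using assms by (simp add: H2_def FactGroup_def)
  then show ?thesis by (auto simp: coboundaries2_def)
qed

lemma cochains_compose: "f \<in> cochains \<Longrightarrow> (\<lambda>x. t (f x)) \<in> cochains"
  using continuous_map_compose[of euclidean "discrete_topology UNIV" f "discrete_topology UNIV" t]
  by (simp add: cochains_def o_def)

theorem theorem7p5:
  shows "\<exists>\<chi>01 \<in> carrier H1. \<exists>\<chi>12 \<in> carrier H1. \<exists>\<chi>23 \<in> carrier H1.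
    triple_massey \<chi>01 \<chi>12 (\<chi>23 :: (gal_Q \<Rightarrow> Z8) set) \<noteq> {} \<and>
    \<one>\<^bsub>H2\<^esub> \<notin> triple_massey \<chi>01 \<chi>12 \<chi>23"
proof -
  obtain K z p where tower: "sqrt_tower K z p" and p0: "p 0 = 5" using ex_sqrt_tower by blast
  interpret sqrt_tower K z p by fact
  obtain s1 s2 where s1: "s1\<^sup>2 = (2 + z 0) / (2 - z 0)" and s2: "s2\<^sup>2 = s1" using ex_sqrt_qbar by metis
  obtain r where r: "r\<^sup>2 = s2" using ex_sqrt_qbar by blast
  interpret kummer_tower K z p r
  proof
    have "r ^ 8 = ((r\<^sup>2)\<^sup>2)\<^sup>2" by (simp flip: power_mult)
    then show "r ^ 8 = (2 + z 0) / (2 - z 0)" by (simp add: s1 s2 r)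
  qed (fact p0)
  interpret M: qbar_subfield M by (rule subfield_M)
  let ?x01 = "\<lambda>g. 2 * chi g" and ?x23 = "\<lambda>g. 4 * kum g"
  have cont: "?x01 \<in> cochains" "chi \<in> cochains" "?x23 \<in> cochains" "kum \<in> cochains" "(\<lambda>g. chi g * chi g) \<in> cochains"
    using cochains_compose[OF chi_cochain] cochains_compose[OF kum_cochain] chi_cochain kum_cochain by simp_all
  have cocycle: "d1 ?x01 = (\<lambda>_. 0)" "d1 chi = (\<lambda>_. 0)" "d1 ?x23 = (\<lambda>_. 0)"
    by (auto simp: d1_def chi_mult four_kum_mult distrib_left)
  have I: "{0<..<Suc 0} = {}" "{Suc 0<..<2} = {}" "{2<..<3::nat} = {}" "{0<..<2::nat} = {1}" "{Suc 0<..<3} = {2}"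
      "{Suc 0..2} = {1, 2}"
    by auto
  define a where "a = (\<lambda>i j. if i = (0::nat) then if j = (1::nat) then ?x01 else (\<lambda>g. chi g * chi g)
    else if i = 1 then if j = 2 then chi else kum else ?x23)"
  have "defining_system (class1 ?x01) (class1 chi) (class1 ?x23) a"
    unfolding defining_system_def
  proof (intro conjI allI impI)
    fix i j :: nat assume *: "i < j \<and> j \<le> 3 \<and> (i, j) \<noteq> (0, 3)"
    then have cases: "i = 0 \<and> j = 1 \<or> i = 1 \<and> j = 2 \<or> i = 2 \<and> j = 3 \<or> i = 0 \<and> j = 2 \<or> i = 1 \<and> j = 3" by auto
    then show "a i j \<in> cochains" using cont by (auto simp: a_def)
    have "d1 (\<lambda>g. chi g * chi g) (g, h) = - (2 * chi g * chi h)" for g h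
      by (simp add: d1_def chi_mult algebra_simps)
    moreover have "d1 kum (g, h) = - (chi g * (4 * kum h))" for g h
      by (simp add: d1_def kum_mult algebra_simps)
    ultimately show "d1 (a i j) = (\<lambda>x. - (\<Sum>m\<in>{i<..<j}. (a i m \<smile> a m j) x))"
      using cases cocycle by (auto simp: a_def I cup_def fun_eq_iff)
  qed (simp_all add: a_def)
  then have "triple_massey (class1 ?x01) (class1 chi) (class1 ?x23) \<noteq> {}"
    unfolding triple_massey_def by blast
  moreover have "\<one>\<^bsub>H2\<^esub> \<notin> triple_massey (class1 ?x01) (class1 chi) (class1 ?x23)"
  proof
    assume "\<one>\<^bsub>H2\<^esub> \<in> triple_massey (class1 ?x01) (class1 chi) (class1 ?x23)"
    then obtain b where b1: "class2 (massey_cocycle b) = \<one>\<^bsub>H2\<^esub>"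
      and b: "defining_system (class1 ?x01) (class1 chi) (class1 ?x23) b"
      unfolding triple_massey_def by force
    \<comment> \<open>The cochain \<open>c\<close> fills the corner that a defining system leaves
      open, completing a unipotent representation of size 4.\<close>
    obtain c where c: "c \<in> cochains" "massey_cocycle b = d1 c" using class2_eq_one_imp_coboundary[OF b1] by blast
    have b_eq: "b 0 1 = ?x01" "b 1 2 = chi" "b 2 3 = ?x23"
      using b by (simp_all add: defining_system_def class1_eq)
    define u w where "u = b 0 2" and "w = b 1 3"
    have uw: "u \<in> cochains" "w \<in> cochains" using b by (simp_all add: defining_system_def u_def w_def)
    have "d1 u = (\<lambda>x. - (b 0 1 \<smile> b 1 2) x)" "d1 w = (\<lambda>x. - (b 1 2 \<smile> b 2 3) x)"
      using b by (simp_all add: defining_system_def u_def w_def I)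
    then have "d1 u (g, h) = - (2 * chi g * chi h)" "d1 w (g, h) = - (chi g * (4 * kum h))" for g h
      by (simp_all add: b_eq[simplified] cup_def)
    then have u: "u (g * h) = u g + u h + 2 * chi g * chi h"
      and w: "w (g * h) = w g + w h + chi g * (4 * kum h)" for g h
      by (simp_all add: d1_def algebra_simps)
    have "massey_cocycle b (g, h) = - (2 * chi g * w h + u g * (4 * kum h))" for g h
      using b_eq by (simp add: massey_cocycle_def I cup_def u_def w_def)
    then have c': "c (g * h) = c g + c h + 2 * chi g * w h + u g * (4 * kum h)" for g h
      using c(2) by (simp add: d1_def algebra_simps)
    obtain \<sigma> \<tau> where rel: "\<And>x. x \<in> M \<Longrightarrow> act (\<sigma> * \<tau>) x = act (\<tau> ^ 5 * \<sigma>) x"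
      and \<sigma>: "\<And>n. act \<sigma> (z n) = z n ^ 5" and \<tau>: "\<And>n. act \<tau> (z n) = z n" "\<And>n. act \<tau> (p n) = z n ^ 4 * p n"
      using ex_tame_pair by blast
    let ?G = "fixing_subgroup M"
    note trivial = M.Z8_hom_trivial[OF sqrt_M]
    \<comment> \<open>In each of the following facts the earlier ones remove the cross terms on
      \<open>?G\<close>, so that the function restricts to a homomorphism there.\<close>
    have chi0: "chi g = 0" if "g \<in> ?G" for g by (rule trivial[OF _ chi_cochain _ that]) (simp_all add: chi_mult)
    have kum0: "4 * kum g = 0" if "g \<in> ?G" for g by (rule trivial[OF _ cont(3) _ that]) (simp_all add: four_kum_mult)
    have u0: "u g = 0" if "g \<in> ?G" for g by (rule trivial[OF _ uw(1) _ that]) (simp_all add: u chi0)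
    have w0: "w g = 0" if "g \<in> ?G" for g by (rule trivial[OF _ uw(2) _ that]) (simp_all add: w chi0)
    have c0: "c g = 0" if "g \<in> ?G" for g by (rule trivial[OF _ c(1) _ that]) (simp_all add: c' chi0 u0)
    obtain t where t: "t * (\<tau> ^ 5 * \<sigma>) = 1" "(\<tau> ^ 5 * \<sigma>) * t = 1" using gal_Q_has_inverse by blast
    \<comment> \<open>The tame relation is known on \<open>M\<close> only. The defect
      \<open>n\<close> fixes \<open>M\<close>, so right multiplication by it changes none of the
      values of \<open>u\<close>, \<open>w\<close> and \<open>c\<close>.\<close>
    define n where "n = t * (\<sigma> * \<tau>)"
    have "act t (act (\<tau> ^ 5 * \<sigma>) x) = x" for x using t(1) by (metis act_one act_times)
    then have "n \<in> ?G" by (auto simp: n_def fixing_subgroup_def rel simp del: act_times simp: act_times[of t])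
    have eq: "\<sigma> * \<tau> = (\<tau> ^ 5 * \<sigma>) * n" using t(2) by (simp add: n_def mult.assoc[symmetric])
    have "chi \<sigma> = of_nat 1" using \<sigma>[of 3] by (intro chiI[of _ 1]) simp_all
    moreover have "chi \<tau> = of_nat 0" using \<tau>(1)[of 3] by (intro chiI[of _ 1]) simp_all
    ultimately show False
      using tame_relation_obstruction[of chi kum u w c \<sigma> \<tau>, OF chi_mult four_kum_mult u w c']
        kum_tau[OF \<tau>] \<open>n \<in> ?G\<close>
      unfolding eq by (simp add: u w c' chi0 kum0 u0 w0 c0 del: mult.assoc)
  qed
  ultimately show ?thesis
    using class1_in_H1[OF cont(1) cocycle(1)] class1_in_H1[OF cont(2) cocycle(2)] class1_in_H1[OF cont(3) cocycle(3)]
    by blast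
qed

end
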